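(* Let $d\ge 1$ and $p\in(0,1)$. Let $S$ be the walk on $\mathbb{Z}^d$ started at the origin corresponding to the constant sequence $p_n=p$, $n\ge 2$. Extend $S$ to all non-negative times using linear interpolation and for $n\ge 1$ define the rescaled walk $S^n$ by $$S^n(t):=\sqrt{\frac{p}{2-p}}\cdot\frac{S_{nt}}{\sqrt n},\qquad t\ge 0.$$ Let $\mathcal{W}^{(d)}$ denote the $d$-dimensional Wiener measure. Then $\lim_{n\to\infty}\mathsf{Law}(S^n)=\mathcal{W}^{(d)}$ on $C([0,\infty),\mathbb{R}^d)$ (weak convergence of laws).
   Context: For $d=1$ (coin-turning walk): $Y_1$ is uniform on $\{-1,+1\}$ and for $n\ge 2$, independently of the past, with probability $p_n$ the variable $Y_n$ is a fresh uniform element of $\{-1,+1\}$, and otherwise $Y_n=Y_{n-1}$; $S_0=0$, $S_n=Y_1+\dots+Y_n$. For $d\ge 2$ (conservative random walk corresponding to a sequence $(p_n)_{n\ge 2}$ in $[0,1]$, with the convention $p_1:=1$): let $e_1,\dots,e_d$ be the standard basis vectors of $\mathbb{R}^d$. Let $Y_1$ be uniform on the $2d$-element set $\{\pm e_1,\dots,\pm e_d\}$, and let $Y_1,Y_2,\dots$ be the Markov chain on this set whose transition matrix between times $n$ and $n+1$ is $(1-p_n)I+\frac{p_n}{2d}A$, $n\ge 1$, where $I$ is the $2d\times 2d$ identity matrix and $A$ the $2d\times 2d$ matrix of ones; i.e. with probability $1-p_n$ the next step repeats the previous one, and with probability $p_n$ a fresh direction is chosen uniformly among all $2d$ directions. Set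 $S_0=\mathbf{0}$, $S_n=Y_1+\dots+Y_n$. The $d$-dimensional Wiener measure is the law of standard $d$-dimensional Brownian motion started at $\mathbf{0}$. $C([0,\infty),\mathbb{R}^d)$ carries the topology of uniform convergence on compact sets.
   Formalization: The scaling constant is corrected from sqrt(p/(2-p)) to sqrt(d·p/(2-p)): for d≥2 the printed constant gives Brownian motion with covariance (t/d)I, not standard Brownian motion; for d=1 nothing changes. *)

theory Defs
  imports "HOL-Probability.Probability"
begin

section \<open>The walk\<close>

definition directions :: "(real ^ 'd) set" where
  "directions = (\<Union>i. {axis i 1, - axis i 1})"

definition transition :: "real \<Rightarrow> real ^ 'd \<Rightarrow> real ^ 'd \<Rightarrow> real" where
  "transition q x z = (1 - q) * (if x = z then 1 else 0) + q / (2 * real CARD('d))"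

text \<open>
  The probability of choosing a fresh direction between times \<open>n\<close> and \<open>n + 1\<close> (\<open>n \<ge> 1\<close>), for a
  sequence \<open>(p\<^sub>n)\<close> of which only the terms with \<open>n \<ge> 2\<close> are used.  The indexing differs
  between the two cases: the coin-turning walk (\<open>d = 1\<close>) uses \<open>p\<^sub>n\<^sub>+\<^sub>1\<close>, the conservative walk
  (\<open>d \<ge> 2\<close>) uses \<open>p\<^sub>n\<close> with the convention \<open>p\<^sub>1 = 1\<close>.
\<close>

definition refresh_prob :: "'d itself \<Rightarrow> (nat \<Rightarrow> real) \<Rightarrow> nat \<Rightarrow> real" where
  "refresh_prob _ p n =
     (if CARD('d) = 1 then p (Suc n) else if n = 1 then 1 else p n)"

text \<open>
  The steps \<open>Y\<^sub>1, Y\<^sub>2, \<dots>\<close> (the index \<open>0\<close> is unused): a Markov chain on the \<open>2d\<close> directions, uniform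
  at time \<open>1\<close>.
\<close>

definition walk_steps :: "'m measure \<Rightarrow> (nat \<Rightarrow> real) \<Rightarrow> (nat \<Rightarrow> 'm \<Rightarrow> real ^ 'd) \<Rightarrow> bool" where
  "walk_steps M p Y \<longleftrightarrow>
     prob_space M \<and>
     (\<forall>n\<ge>1. Y n \<in> M \<rightarrow>\<^sub>M count_space directions) \<and>
     (\<forall>z\<in>directions. \<P>(\<omega> in M. Y 1 \<omega> = z) = 1 / (2 * real CARD('d))) \<and>
     (\<forall>n\<ge>1. \<forall>y. \<forall>z\<in>directions.
        \<P>(\<omega> in M. \<forall>k\<in>{1..n}. Y k \<omega> = y k) > 0 \<longrightarrow>
        \<P>(\<omega> in M. Y (Suc n) \<omega> = z \<bar> \<forall>k\<in>{1..n}. Y k \<omega> = y k) =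
          transition (refresh_prob TYPE('d) p n) (y n) z)"

definition walk :: "(nat \<Rightarrow> 'm \<Rightarrow> real ^ 'd) \<Rightarrow> nat \<Rightarrow> 'm \<Rightarrow> real ^ 'd" where
  "walk Y n \<omega> = (\<Sum>k=1..n. Y k \<omega>)"

definition linear_interpolation :: "(nat \<Rightarrow> 'a::real_vector) \<Rightarrow> real \<Rightarrow> 'a" where
  "linear_interpolation s t =
     (1 - frac t) *\<^sub>R s (nat \<lfloor>t\<rfloor>) + frac t *\<^sub>R s (Suc (nat \<lfloor>t\<rfloor>))"

text \<open>
  The factor \<open>d\<close> under the root is the normalisation for which the limit is standard Brownian
  motion: each coordinate of a step has variance \<open>1 / d\<close>, and summing the correlations
  \<open>(1 - p)\<^sup>k\<close> over all lags gives the asymptotic covariance matrix \<open>(2 - p) / (d p) I\<close> of the walk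
  per unit time.  For \<open>d = 1\<close> this is the constant \<open>sqrt (p / (2 - p))\<close>; for \<open>d \<ge> 2\<close> the
  constant \<open>sqrt (p / (2 - p))\<close> would lead to Brownian motion with covariance \<open>t / d I\<close>.
\<close>

definition rescaled_walk ::
    "real \<Rightarrow> (nat \<Rightarrow> 'm \<Rightarrow> real ^ 'd) \<Rightarrow> nat \<Rightarrow> real \<Rightarrow> 'm \<Rightarrow> real ^ 'd" where
  "rescaled_walk p Y n t \<omega> =
     sqrt (real CARD('d) * (p / (2 - p))) *\<^sub>R
       (linear_interpolation (\<lambda>k. walk Y k \<omega>) (real n * t) /\<^sub>R sqrt (real n))"


section \<open>Path space\<close>

text \<open>
  \<open>C([0,\<infinity>), E)\<close>; functions on \<open>[0,\<infinity>)\<close> are represented by their extensional representatives.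
\<close>

definition paths :: "(real \<Rightarrow> 'a::metric_space) set" where
  "paths = {w \<in> extensional {0..}. continuous_on {0..} w}"

definition open_paths :: "(real \<Rightarrow> 'a::metric_space) set \<Rightarrow> bool" where
  "open_paths U \<longleftrightarrow> U \<subseteq> paths \<and>
     (\<forall>f\<in>U. \<exists>K e. compact K \<and> K \<subseteq> {0..} \<and> e > 0 \<and>
        (\<forall>g\<in>paths. (\<forall>t\<in>K. dist (g t) (f t) < e) \<longrightarrow> g \<in> U))"

lemma open_pathsD:
  assumes "open_paths U" and "f \<in> U"
  obtains K e where "compact K" "K \<subseteq> {0..}" "e > 0"
    "\<And>g. g \<in> paths \<Longrightarrow> (\<And>t. t \<in> K \<Longrightarrow> dist (g t) (f t) < e) \<Longrightarrow> g \<in> U"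
  using assms unfolding open_paths_def by metis

lemma open_pathsI:
  assumes "U \<subseteq> paths"
    and "\<And>f. f \<in> U \<Longrightarrow> \<exists>K e. compact K \<and> K \<subseteq> {0..} \<and> e > 0 \<and>
        (\<forall>g\<in>paths. (\<forall>t\<in>K. dist (g t) (f t) < e) \<longrightarrow> g \<in> U)"
  shows "open_paths U"
  using assms unfolding open_paths_def by simp

lemma open_paths_subset: "open_paths U \<Longrightarrow> U \<subseteq> paths"
  unfolding open_paths_def by (rule conjunct1)

lemma istopology_open_paths: "istopology open_paths"
  unfolding istopology_def
proof (intro conjI allI impI)
  fix U V :: "(real \<Rightarrow> 'a) set"
  assume U: "open_paths U" and V: "open_paths V"
  show "open_paths (U \<inter> V)"
  proof (rule open_pathsI)
    show "U \<inter> V \<subseteq> paths"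
      using open_paths_subset[OF U] by (rule le_infI1)
    fix f assume "f \<in> U \<inter> V"
    then have fU: "f \<in> U" and fV: "f \<in> V" by simp_all
    obtain K e where K: "compact K" "K \<subseteq> {0..}" "e > 0"
      and KU: "\<And>g. g \<in> paths \<Longrightarrow> (\<And>t. t \<in> K \<Longrightarrow> dist (g t) (f t) < e) \<Longrightarrow> g \<in> U"
      using open_pathsD[OF U fU] by metis
    obtain L e' where L: "compact L" "L \<subseteq> {0..}" "e' > 0"
      and LV: "\<And>g. g \<in> paths \<Longrightarrow> (\<And>t. t \<in> L \<Longrightarrow> dist (g t) (f t) < e') \<Longrightarrow> g \<in> V"
      using open_pathsD[OF V fV] by metis
    show "\<exists>K e. compact K \<and> K \<subseteq> {0..} \<and> e > 0 \<and>
        (\<forall>g\<in>paths. (\<forall>t\<in>K. dist (g t) (f t) < e) \<longrightarrow> g \<in> U \<inter> V)"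
    proof (intro exI conjI ballI impI)
      show "compact (K \<union> L)" using K L by (intro compact_Un)
      show "K \<union> L \<subseteq> {0..}" using K L by (intro Un_least)
      show "0 < min e e'" using K L by simp
      fix g assume g: "g \<in> paths" and d: "\<forall>t\<in>K \<union> L. dist (g t) (f t) < min e e'"
      have "g \<in> U" using d by (intro KU g) simp
      moreover have "g \<in> V" using d by (intro LV g) simp
      ultimately show "g \<in> U \<inter> V" by (rule IntI)
    qed
  qed
next
  fix \<U> :: "(real \<Rightarrow> 'a) set set"
  assume *: "\<forall>U\<in>\<U>. open_paths U"
  show "open_paths (\<Union>\<U>)"
  proof (rule open_pathsI)
    show "\<Union>\<U> \<subseteq> paths"
      using * by (intro Union_least open_paths_subset) simp
    fix f assume "f \<in> \<Union>\<U>"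
    then obtain U where U: "U \<in> \<U>" "f \<in> U" by (rule UnionE)
    have "open_paths U" using * U(1) by (rule bspec)
    then obtain K e where K: "compact K" "K \<subseteq> {0..}" "e > 0"
      and KU: "\<And>g. g \<in> paths \<Longrightarrow> (\<And>t. t \<in> K \<Longrightarrow> dist (g t) (f t) < e) \<Longrightarrow> g \<in> U"
      using open_pathsD[OF _ U(2)] by metis
    show "\<exists>K e. compact K \<and> K \<subseteq> {0..} \<and> e > 0 \<and>
        (\<forall>g\<in>paths. (\<forall>t\<in>K. dist (g t) (f t) < e) \<longrightarrow> g \<in> \<Union>\<U>)"
    proof (intro exI conjI ballI impI)
      fix g assume "g \<in> paths" "\<forall>t\<in>K. dist (g t) (f t) < e"
      then have "g \<in> U" by (intro KU) simp_all
      with U(1) show "g \<in> \<Union>\<U>" by (rule UnionI)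
    qed (fact K)+
  qed
qed

text \<open>Uniform convergence on compact sets.\<close>

definition path_topology :: "(real \<Rightarrow> 'a::metric_space) topology" where
  "path_topology = topology open_paths"

lemma openin_path_topology: "openin path_topology = open_paths"
  unfolding path_topology_def by (rule topology_inverse'[OF istopology_open_paths])

lemma topspace_path_topology: "topspace path_topology = paths"
proof
  show "topspace path_topology \<subseteq> paths"
    unfolding topspace_def openin_path_topology
    by (intro Union_least) (simp add: open_paths_subset)
  have "open_paths (paths :: (real \<Rightarrow> 'a) set)"
    by (rule open_pathsI) (simp, intro exI[of _ "{}"] exI[of _ "1::real"], simp)
  then show "(paths :: (real \<Rightarrow> 'a) set) \<subseteq> topspace path_topology"
    by (intro openin_subset) (simp add: openin_path_topology)
qed

definition borel_of :: "'a topology \<Rightarrow> 'a measure" where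
  "borel_of X = sigma (topspace X) {U. openin X U}"

definition weakly_converges_on ::
    "'a topology \<Rightarrow> (nat \<Rightarrow> 'a measure) \<Rightarrow> 'a measure \<Rightarrow> bool" where
  "weakly_converges_on X \<mu> \<nu> \<longleftrightarrow>
     (\<forall>f. continuous_map X euclideanreal f \<and> bounded (f ` topspace X) \<longrightarrow>
        (\<lambda>n. \<integral>w. f w \<partial>\<mu> n) \<longlonglongrightarrow> (\<integral>w. f w \<partial>\<nu>))"

definition Law :: "'m measure \<Rightarrow> (real \<Rightarrow> 'm \<Rightarrow> 'a::metric_space) \<Rightarrow> (real \<Rightarrow> 'a) measure" where
  "Law M X = distr M (borel_of path_topology) (\<lambda>\<omega>. restrict (\<lambda>t. X t \<omega>) {0..})"


section \<open>Wiener measure\<close>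

definition standard_brownian_motion :: "'m measure \<Rightarrow> (real \<Rightarrow> 'm \<Rightarrow> real ^ 'd) \<Rightarrow> bool" where
  "standard_brownian_motion M B \<longleftrightarrow>
     prob_space M \<and>
     (\<forall>t\<ge>0. B t \<in> borel_measurable M) \<and>
     (\<forall>\<omega>\<in>space M. continuous_on {0..} (\<lambda>t. B t \<omega>)) \<and>
     (AE \<omega> in M. B 0 \<omega> = 0) \<and>
     (\<forall>s t. 0 \<le> s \<and> s < t \<longrightarrow>
        distributed M lborel (\<lambda>\<omega>. B t \<omega> - B s \<omega>)
          (\<lambda>x. ennreal (\<Prod>i\<in>UNIV. normal_density 0 (sqrt (t - s)) (x $ i)))) \<and>
     (\<forall>(t :: nat \<Rightarrow> real) k. 0 \<le> t 0 \<and> (\<forall>i<k. t i < t (Suc i)) \<longrightarrow>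
        prob_space.indep_vars M (\<lambda>_. borel) (\<lambda>i \<omega>. B (t (Suc i)) \<omega> - B (t i) \<omega>) {..<k})"

text \<open>
  A measure on path space is the law of standard Brownian motion iff the coordinate process is a
  standard Brownian motion under it.
\<close>

definition wiener_measure :: "(real \<Rightarrow> real ^ 'd) measure \<Rightarrow> bool" where
  "wiener_measure W \<longleftrightarrow>
     sets W = sets (borel_of path_topology) \<and> standard_brownian_motion W (\<lambda>t w. w t)"

end

theory Submission
  imports Defs
begin

text \<open>
  From time \<open>2\<close> on, \<open>E[Y\<^sub>n\<^sub>+\<^sub>1 | past] = (1 - p) Y\<^sub>n\<close>, so up to a bounded error the walk is a martingale \<open>N\<close>
  with bounded increments.  Given the past these have a diagonal second-moment matrix, whose
  deviation from \<open>(2 - p) / (d p) I\<close> contracts by the factor \<open>1 - p\<close> in each step and hence averages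
  out; a second-order expansion therefore gives the joint characteristic functions of the increments
  of \<open>N\<close> in the limit.  Stone-Weierstrass for trigonometric polynomials turns this into convergence of
  finite-dimensional distributions.  A maximal inequality from fourth moments shows that the rescaled
  walk is close to its piecewise linear interpolation on a fixed grid.

  Compactness in path space is not needed: a bounded continuous functional is the pointwise limit
  of functionals that are Lipschitz for the sup norm on \<open>[0, k]\<close>, approximated from below, and applying
  this also to its negative reduces weak convergence to Lipschitz functionals, for which the
  approximation by polygons is uniform.
\<close>

section \<open>Weak convergence from trigonometric test functions\<close>

text \<open>For d \<ge> 2 the conditional covariance of a martingale difference depends on the
  current direction, so the factors of the characteristic function do not simply multiply. The
  expansion has to carry the correlation between the centred squares of the coordinates and the
  product built so far; the contraction keeps this correlation of the order of the test vectors, so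
  that it enters the error only at third order.

  Fourth moments are forced by a union bound over about \<open>m * T\<close> blocks of length about
  \<open>n / m\<close>. At a level of order \<open>sqrt n\<close>, second moments bound each block
  by a multiple of \<open>1 / m\<close>, which does not vanish after summation; fourth moments give
  \<open>1 / m^2\<close>.

  Conditional expectations are never formed. The first \<open>n\<close> steps take finitely many
  values, so a statement given the past becomes an identity between plain expectations, tested
  against every function of these steps.\<close>

inductive_set trig_span :: "'i set \<Rightarrow> (('i \<Rightarrow> real) \<Rightarrow> real) set" for J where
  cos: "(\<lambda>x. a * cos ((\<Sum>i\<in>J. \<theta> i * x i) + \<phi>)) \<in> trig_span J"
| add: "f \<in> trig_span J \<Longrightarrow> g \<in> trig_span J \<Longrightarrow> (\<lambda>x. f x + g x) \<in> trig_span J"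

lemma trig_span_const: "(\<lambda>_. c) \<in> trig_span J"
  using trig_span.cos[where a=c and \<theta>="\<lambda>_. 0" and \<phi>=0] by simp

lemma trig_span_sin:
  assumes "finite J" "i \<in> J"
  shows "(\<lambda>x. sin (c * x i)) \<in> trig_span J"
proof -
  have eq: "(\<Sum>j\<in>J. (if j = i then c else 0) * x j) = c * x i" for x :: "'a \<Rightarrow> real"
    using assms by (subst sum.remove[of _ i]) auto
  have "cos (t + (- pi / 2)) = sin t" for t
    by (subst cos_add) simp
  then show ?thesis
    using trig_span.cos[where a=1 and \<theta>="\<lambda>j. if j = i then c else 0" and \<phi>="- pi / 2" and J=J]
    unfolding eq by simp
qed

text \<open>The product-to-sum formula. The phases in the generators are what keeps products inside
  the span, so that it is an algebra as Stone-Weierstrass requires.\<close>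

lemma trig_span_mult:
  assumes "f \<in> trig_span J" "g \<in> trig_span J"
  shows "(\<lambda>x. f x * g x) \<in> trig_span J"
  using assms
proof (induction arbitrary: g)
  case (cos a \<theta> \<phi>)
  show ?case using cos
  proof induction
    case (cos b \<eta> \<psi>)
    have "(\<lambda>x. a * cos ((\<Sum>i\<in>J. \<theta> i * x i) + \<phi>) * (b * cos ((\<Sum>i\<in>J. \<eta> i * x i) + \<psi>))) =
      (\<lambda>x. (a * b / 2) * cos ((\<Sum>i\<in>J. (\<theta> i - \<eta> i) * x i) + (\<phi> - \<psi>)) +
           (a * b / 2) * cos ((\<Sum>i\<in>J. (\<theta> i + \<eta> i) * x i) + (\<phi> + \<psi>)))"
      (is "?l = ?r")
    proof
      fix x
      let ?A = "(\<Sum>i\<in>J. \<theta> i * x i) + \<phi>" and ?B = "(\<Sum>i\<in>J. \<eta> i * x i) + \<psi>"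
      have "a * cos ?A * (b * cos ?B) = a * b * ((cos (?A - ?B) + cos (?A + ?B)) / 2)"
        by (subst cos_times_cos[symmetric]) simp
      moreover have "?A - ?B = (\<Sum>i\<in>J. (\<theta> i - \<eta> i) * x i) + (\<phi> - \<psi>)"
        by (simp add: algebra_simps sum_subtractf)
      moreover have "?A + ?B = (\<Sum>i\<in>J. (\<theta> i + \<eta> i) * x i) + (\<phi> + \<psi>)"
        by (simp add: algebra_simps sum.distrib)
      ultimately show "?l x = ?r x" by (simp add: algebra_simps)
    qed
    then show ?case
      using trig_span.add[OF trig_span.cos[where a="a * b / 2"] trig_span.cos[where a="a * b / 2"]]
      by (simp only:)
  next
    case (add f h)
    then show ?case
      using trig_span.add[OF add.IH] by (simp add: algebra_simps)
  qed
next
  case (add f h)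
  show ?case
    using trig_span.add[OF add.IH(1)[OF add.prems] add.IH(2)[OF add.prems]]
    by (simp add: algebra_simps)
qed

text \<open>Comparison up to a bad event \<open>A\<close>. It serves twice: with \<open>A\<close>
  the complement of a cube for truncation, and with \<open>A\<close> the event that the martingale
  oscillates too much within a block.\<close>

lemma (in prob_space) expectation_diff_le:
  fixes f g :: "'a \<Rightarrow> real"
  assumes "integrable M f" "integrable M g" and A: "A \<in> events"
    and good: "\<And>\<omega>. \<omega> \<in> space M \<Longrightarrow> \<omega> \<notin> A \<Longrightarrow> \<bar>f \<omega> - g \<omega>\<bar> \<le> a"
    and bad: "\<And>\<omega>. \<omega> \<in> space M \<Longrightarrow> \<omega> \<in> A \<Longrightarrow> \<bar>f \<omega> - g \<omega>\<bar> \<le> b" and "0 \<le> a"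
  shows "\<bar>expectation f - expectation g\<bar> \<le> a + b * prob A"
proof -
  have "\<bar>expectation f - expectation g\<bar> = \<bar>expectation (\<lambda>\<omega>. f \<omega> - g \<omega>)\<bar>"
    using assms(1,2) by simp
  also have "\<dots> \<le> expectation (\<lambda>\<omega>. \<bar>f \<omega> - g \<omega>\<bar>)"
    by (rule integral_abs_bound)
  also have "\<dots> \<le> expectation (\<lambda>\<omega>. a + b * indicator A \<omega>)"
  proof (rule integral_mono)
    show "integrable M (\<lambda>\<omega>. \<bar>f \<omega> - g \<omega>\<bar>)" using assms(1,2) by simp
    show "integrable M (\<lambda>\<omega>. a + b * indicator A \<omega>)"
      using A by (intro Bochner_Integration.integrable_add integrable_mult_right
          integrable_real_indicator) (auto simp: emeasure_eq_measure)
    show "\<bar>f \<omega> - g \<omega>\<bar> \<le> a + b * indicator A \<omega>" if "\<omega> \<in> space M" for \<omega>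
      using good[OF that] bad[OF that] \<open>0 \<le> a\<close> by (cases "\<omega> \<in> A") auto
  qed
  also have "\<dots> = a + b * prob A"
    using A by (subst Bochner_Integration.integral_add)
      (auto simp: emeasure_eq_measure prob_space intro!: integrable_mult_right)
  finally show ?thesis .
qed

lemma (in prob_space) integrable_bounded_real:
  fixes f :: "'a \<Rightarrow> real"
  assumes "f \<in> borel_measurable M" "\<And>\<omega>. \<omega> \<in> space M \<Longrightarrow> \<bar>f \<omega>\<bar> \<le> B"
  shows "integrable M f"
  using assms by (intro integrable_const_bound[where B=B]) auto

text \<open>The exceptional events decrease to the empty set as the level grows, so continuity of
  measure from above applies.\<close>

lemma (in prob_space) tight_real_family:
  fixes V :: "'a \<Rightarrow> 'i \<Rightarrow> real"
  assumes "finite J" and meas: "\<And>i. i \<in> J \<Longrightarrow> (\<lambda>\<omega>. V \<omega> i) \<in> borel_measurable M" and "0 < e"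
  shows "\<exists>R0. \<forall>R\<ge>R0. prob {\<omega> \<in> space M. \<exists>i\<in>J. \<not> \<bar>V \<omega> i\<bar> \<le> R} \<le> e"
proof -
  define A where "A k = {\<omega> \<in> space M. \<exists>i\<in>J. \<not> \<bar>V \<omega> i\<bar> \<le> real k}" for k
  have A_meas: "{\<omega> \<in> space M. \<exists>i\<in>J. \<not> \<bar>V \<omega> i\<bar> \<le> R} \<in> events" for R
  proof -
    have "{\<omega> \<in> space M. \<exists>i\<in>J. \<not> \<bar>V \<omega> i\<bar> \<le> R} = (\<Union>i\<in>J. {\<omega> \<in> space M. R < \<bar>V \<omega> i\<bar>})"
      by (auto simp: not_le)
    also have "\<dots> \<in> events"
      using assms(1) meas by (intro sets.finite_UN) measurable
    finally show ?thesis .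
  qed
  have "(\<lambda>k. prob (A k)) \<longlonglongrightarrow> prob (\<Inter>k. A k)"
  proof (rule finite_Lim_measure_decseq)
    show "range A \<subseteq> events" using A_meas by (auto simp: A_def)
    show "decseq A"
    proof (rule decseq_SucI, rule subsetI)
      fix k \<omega> assume "\<omega> \<in> A (Suc k)"
      then show "\<omega> \<in> A k" by (auto simp: A_def) (smt (verit))
    qed
  qed
  moreover have "(\<Inter>k. A k) = {}"
  proof -
    have False if w: "\<And>k. \<omega> \<in> A k" for \<omega>
    proof -
      obtain k where k: "(\<Sum>i\<in>J. \<bar>V \<omega> i\<bar>) \<le> real k" using real_arch_simple by blast
      have "\<bar>V \<omega> i\<bar> \<le> real k" if "i \<in> J" for i
        using member_le_sum[of i J "\<lambda>i. \<bar>V \<omega> i\<bar>"] that k assms(1) by auto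
      with w[of k] show False by (auto simp: A_def)
    qed
    then show ?thesis by blast
  qed
  ultimately have "(\<lambda>k. prob (A k)) \<longlonglongrightarrow> 0" by simp
  then have "\<forall>\<^sub>F k in sequentially. prob (A k) < e"
    using \<open>0 < e\<close> by (rule order_tendstoD(2))
  then obtain k where k: "prob (A k) < e"
    by (auto simp: eventually_sequentially)
  have "prob {\<omega> \<in> space M. \<exists>i\<in>J. \<not> \<bar>V \<omega> i\<bar> \<le> R} \<le> e" if "R \<ge> real k" for R
  proof -
    have "prob {\<omega> \<in> space M. \<exists>i\<in>J. \<not> \<bar>V \<omega> i\<bar> \<le> R} \<le> prob (A k)"
      using A_meas that by (intro finite_measure_mono) (force simp: A_def)+
    with k show ?thesis by simp
  qed
  then show ?thesis by (intro exI[of _ "real k"] allI impI)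
qed

text \<open>Tychonoff. Coordinates outside \<open>J\<close> are pinned to 0, which keeps the product
  compact and lets the coordinates in \<open>J\<close> alone separate points.\<close>

lemma compact_restricted_cube:
  "compact {u :: 'i \<Rightarrow> real. \<forall>i. if i \<in> J then \<bar>u i\<bar> \<le> 1 else u i = 0}"
proof -
  have "compactin (product_topology (\<lambda>_. euclidean) UNIV)
      (PiE UNIV (\<lambda>i. if i \<in> J then {-1..1} else {0::real}))"
    by (subst compactin_PiE) auto
  moreover have "PiE UNIV (\<lambda>i. if i \<in> J then {-1..1} else {0::real}) =
      {u. \<forall>i. if i \<in> J then \<bar>u i\<bar> \<le> 1 else u i = 0}"
    by (auto simp: PiE_UNIV_domain Pi_iff abs_le_iff split: if_splits; smt (verit))
  ultimately show ?thesis
    unfolding euclidean_product_topology compactin_euclidean_iff by (rule back_subst)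
qed

text \<open>
  A continuous function of \<open>x\<close> in the cube \<open>[-R, R]\<^sup>J\<close> is a continuous function of
  \<open>u = sin (\<pi> x / (2 R))\<close>; a polynomial approximation in \<open>u\<close> is a trigonometric polynomial in \<open>x\<close>
  that, being periodic, stays bounded outside the cube.
\<close>

lemma trig_approximation:
  fixes G :: "('i::countable \<Rightarrow> real) \<Rightarrow> real"
  assumes J: "finite J" and G: "continuous_on UNIV G" "\<And>x. \<bar>G x\<bar> \<le> B"
    and dep: "\<And>x y. (\<And>i. i \<in> J \<Longrightarrow> x i = y i) \<Longrightarrow> G x = G y"
    and "0 < e" "0 < R"
  obtains Q where "Q \<in> trig_span J" "\<And>x. \<bar>Q x\<bar> \<le> B + e"
    "\<And>x. (\<And>i. i \<in> J \<Longrightarrow> \<bar>x i\<bar> \<le> R) \<Longrightarrow> \<bar>G x - Q x\<bar> \<le> e"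
proof -
  define S where "S = {u :: 'i::countable \<Rightarrow> real. \<forall>i. if i \<in> J then \<bar>u i\<bar> \<le> 1 else u i = 0}"
  \<comment> \<open>With this choice \<open>c * R = pi / 2\<close>, so on the cube
    \<open>c * x i\<close> stays in the interval where \<open>arcsin\<close> inverts
    \<open>sin\<close>.\<close>
  define c where "c = pi / (2 * R)"
  have "c > 0" using \<open>0 < R\<close> by (simp add: c_def)
  define s where "s x = (\<lambda>i. if i \<in> J then sin (c * x i) else 0)" for x :: "'i \<Rightarrow> real"
  define H where "H u = G (\<lambda>i. arcsin (u i) / c)" for u
  have sS: "s x \<in> S" for x by (simp add: s_def S_def)
  have S1: "\<bar>u i\<bar> \<le> 1" if "u \<in> S" for u i
    using that by (auto simp: S_def split: if_splits dest: spec[of _ i])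
  have contH: "continuous_on S H"
    unfolding H_def
  proof (rule continuous_on_compose2[OF G(1)])
    show "continuous_on S (\<lambda>u i. arcsin (u i) / c)"
    proof (rule continuous_on_coordinatewise_then_product)
      fix i
      have "continuous_on S (\<lambda>u. arcsin (u i))"
        by (rule continuous_on_arcsin)
          (use S1 in \<open>auto intro: continuous_on_subset[OF continuous_on_product_coordinates]
                           simp: abs_le_iff minus_le_iff dest: abs_le_D1 abs_le_D2\<close>)
      then show "continuous_on S (\<lambda>u. arcsin (u i) / c)"
        using \<open>c > 0\<close> by (intro continuous_on_divide continuous_on_const) auto
    qed
  qed auto
  \<comment> \<open>The algebra handed to Stone-Weierstrass consists of the continuous functions of
    \<open>u\<close> whose pull-back along \<open>s\<close> is a trigonometric polynomial in
    \<open>x\<close>.\<close>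
  have "\<exists>h. (continuous_on S h \<and> (\<lambda>x. h (s x)) \<in> trig_span J) \<and> (\<forall>u\<in>S. \<bar>H u - h u\<bar> < e)"
  proof (rule Stone_Weierstrass_HOL[where P="\<lambda>h. continuous_on S h \<and> (\<lambda>x. h (s x)) \<in> trig_span J"])
    show "compact S" unfolding S_def by (rule compact_restricted_cube)
    show "continuous_on S (\<lambda>x. c) \<and> (\<lambda>x. c) \<in> trig_span J" for c
      by (simp add: trig_span_const)
    show "\<exists>f. (continuous_on S f \<and> (\<lambda>x. f (s x)) \<in> trig_span J) \<and> f x \<noteq> f y"
      if "x \<in> S \<and> y \<in> S \<and> x \<noteq> y" for x y
    proof -
      from that obtain i where i: "x i \<noteq> y i" by blast
      with that have "i \<in> J" by (auto simp: S_def split: if_splits) metis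
      then have "(\<lambda>x. s x i) \<in> trig_span J"
        using trig_span_sin[OF J] by (simp add: s_def)
      with i show ?thesis
        by (intro exI[of _ "\<lambda>u. u i"])
          (auto intro: continuous_on_subset[OF continuous_on_product_coordinates])
    qed
  qed (auto intro!: continuous_intros trig_span.add trig_span_mult contH \<open>0 < e\<close>)
  then obtain h where h: "(\<lambda>x. h (s x)) \<in> trig_span J" "\<And>u. u \<in> S \<Longrightarrow> \<bar>H u - h u\<bar> < e"
    by blast
  show ?thesis
  proof
    show "(\<lambda>x. h (s x)) \<in> trig_span J" by fact
    show "\<bar>h (s x)\<bar> \<le> B + e" for x
      using h(2)[OF sS[of x]] G(2)[of "\<lambda>i. arcsin (s x i) / c"] unfolding H_def by linarith
    show "\<bar>G x - h (s x)\<bar> \<le> e" if "\<And>i. i \<in> J \<Longrightarrow> \<bar>x i\<bar> \<le> R" for x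
    proof -
      have "arcsin (sin (c * x i)) / c = x i" if "i \<in> J" for i
      proof -
        have "c * R = pi / 2" using \<open>0 < R\<close> by (simp add: c_def)
        moreover have "\<bar>c * x i\<bar> \<le> c * R"
          using \<open>c > 0\<close> \<open>\<And>i. i \<in> J \<Longrightarrow> \<bar>x i\<bar> \<le> R\<close>[OF that] by (simp add: abs_mult)
        ultimately have "arcsin (sin (c * x i)) = c * x i"
          by (intro arcsin_sin) auto
        then show ?thesis using \<open>c > 0\<close> by simp
      qed
      then have "H (s x) = G x"
        unfolding H_def by (intro dep) (simp add: s_def)
      with h(2)[OF sS[of x]] show ?thesis by simp
    qed
  qed
qed

text \<open>Measurability is assumed only for the coordinates in \<open>J\<close>. The others are
  replaced by 0, a change that \<open>G\<close> cannot detect.\<close>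

lemma measurable_finite_dependence:
  fixes G :: "('i::countable \<Rightarrow> real) \<Rightarrow> real"
  assumes "continuous_on UNIV G" and dep: "\<And>x y. (\<And>i. i \<in> J \<Longrightarrow> x i = y i) \<Longrightarrow> G x = G y"
    and meas: "\<And>i. i \<in> J \<Longrightarrow> (\<lambda>\<omega>. V \<omega> i) \<in> borel_measurable M"
  shows "(\<lambda>\<omega>. G (V \<omega>)) \<in> borel_measurable M"
proof -
  have eq: "G (V \<omega>) = G (\<lambda>i. if i \<in> J then V \<omega> i else 0)" for \<omega>
    by (rule dep) simp
  have "(\<lambda>\<omega> i. if i \<in> J then V \<omega> i else 0) \<in> borel_measurable M"
  proof (rule measurable_coordinatewise_then_product)
    show "(\<lambda>\<omega>. if i \<in> J then V \<omega> i else 0) \<in> borel_measurable M" for i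
      using meas by (cases "i \<in> J") auto
  qed
  moreover have "G \<in> borel_measurable borel"
    by (rule borel_measurable_continuous_onI) fact
  ultimately show ?thesis unfolding eq by measurable
qed

text \<open>Uniform tightness puts all laws into one cube up to mass \<open>e\<close>. Inside,
  \<open>G\<close> is within \<open>e\<close> of a trigonometric polynomial, whose integrals
  converge by linearity; outside, both functions are bounded and the small mass controls the
  difference.\<close>

theorem weak_convergence_trig:
  fixes V :: "nat \<Rightarrow> 'm \<Rightarrow> 'i::countable \<Rightarrow> real" and V' :: "'k \<Rightarrow> 'i \<Rightarrow> real"
    and G :: "('i \<Rightarrow> real) \<Rightarrow> real"
  assumes M: "prob_space M" and M': "prob_space M'" and J: "finite J"
    and meas: "\<And>n i. i \<in> J \<Longrightarrow> (\<lambda>\<omega>. V n \<omega> i) \<in> borel_measurable M"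
    and meas': "\<And>i. i \<in> J \<Longrightarrow> (\<lambda>\<omega>. V' \<omega> i) \<in> borel_measurable M'"
    and conv: "\<And>\<theta> \<phi>. (\<lambda>n. \<integral>\<omega>. cos ((\<Sum>i\<in>J. \<theta> i * V n \<omega> i) + \<phi>) \<partial>M)
        \<longlonglongrightarrow> (\<integral>\<omega>. cos ((\<Sum>i\<in>J. \<theta> i * V' \<omega> i) + \<phi>) \<partial>M')"
    and tight: "\<And>e. e > 0 \<Longrightarrow>
        \<exists>R0. \<forall>R\<ge>R0. \<forall>n. measure M {\<omega> \<in> space M. \<exists>i\<in>J. \<not> \<bar>V n \<omega> i\<bar> \<le> R} \<le> e"
    and G: "continuous_on UNIV G" "\<And>x. \<bar>G x\<bar> \<le> B"
    and dep: "\<And>x y. (\<And>i. i \<in> J \<Longrightarrow> x i = y i) \<Longrightarrow> G x = G y"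
  shows "(\<lambda>n. \<integral>\<omega>. G (V n \<omega>) \<partial>M) \<longlonglongrightarrow> (\<integral>\<omega>. G (V' \<omega>) \<partial>M')"
proof (rule LIMSEQ_I)
  fix r :: real assume "0 < r"
  interpret M: prob_space M by fact
  interpret M': prob_space M' by fact
  have "B \<ge> 0" by (rule order_trans[OF abs_ge_zero G(2)])
  \<comment> \<open>Replacing \<open>G\<close> by \<open>Q\<close> costs at most
    \<open>e + (2 * B + e) * e\<close>, which has to fit into \<open>r / 3\<close>; the bound
    \<open>e \<le> 1\<close> simplifies the second term to \<open>(2 * B + 2) * e\<close>.\<close>
  define e where "e = min 1 (r / (3 * (2 * B + 3)))"
  have e: "0 < e" "e \<le> 1" "(2 * B + 2) * e + e \<le> r / 3"
  proof -
    show "0 < e" "e \<le> 1" using \<open>0 < r\<close> \<open>B \<ge> 0\<close> by (auto simp: e_def)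
    have "e \<le> r / 3 / (2 * B + 3)" by (simp add: e_def)
    then have "e * (2 * B + 3) \<le> r / 3"
      using \<open>B \<ge> 0\<close> by (subst (asm) pos_le_divide_eq) auto
    moreover have "(2 * B + 2) * e + e = e * (2 * B + 3)" by algebra
    ultimately show "(2 * B + 2) * e + e \<le> r / 3" by linarith
  qed
  obtain R1 where R1: "\<And>R n. R \<ge> R1 \<Longrightarrow> M.prob {\<omega> \<in> space M. \<exists>i\<in>J. \<not> \<bar>V n \<omega> i\<bar> \<le> R} \<le> e"
    using tight[OF e(1)] by blast
  obtain R2 where R2: "\<And>R. R \<ge> R2 \<Longrightarrow> M'.prob {\<omega> \<in> space M'. \<exists>i\<in>J. \<not> \<bar>V' \<omega> i\<bar> \<le> R} \<le> e"
    using M'.tight_real_family[where V=V', OF J meas' e(1)] by blast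
  define R where "R = max 1 (max R1 R2)"
  have "R > 0" by (simp add: R_def)
  obtain Q where Q: "Q \<in> trig_span J" "\<And>x. \<bar>Q x\<bar> \<le> B + e"
    "\<And>x. (\<And>i. i \<in> J \<Longrightarrow> \<bar>x i\<bar> \<le> R) \<Longrightarrow> \<bar>G x - Q x\<bar> \<le> e"
    using trig_approximation[OF J G dep e(1) \<open>R > 0\<close>] by blast
  have Qmeas: "(\<lambda>\<omega>. q (U \<omega>)) \<in> borel_measurable N"
    if "q \<in> trig_span J" "\<And>i. i \<in> J \<Longrightarrow> (\<lambda>\<omega>. U \<omega> i) \<in> borel_measurable N"
    for U :: "'b \<Rightarrow> 'i \<Rightarrow> real" and N q
    using that by (induction) (auto intro!: borel_measurable_add borel_measurable_times
        borel_measurable_sum measurable_compose[OF _ borel_measurable_cos]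
        simp: cos_def[symmetric])
  \<comment> \<open>Boundedness travels along with convergence because splitting the integral of a
    sum needs integrable summands.\<close>
  have Qconv: "((\<lambda>n. \<integral>\<omega>. q (V n \<omega>) \<partial>M) \<longlonglongrightarrow> (\<integral>\<omega>. q (V' \<omega>) \<partial>M')) \<and> (\<exists>b. \<forall>x. \<bar>q x\<bar> \<le> b)"
    if "q \<in> trig_span J" for q
    using that
  proof induction
    case (cos a \<theta> \<phi>)
    have "\<bar>a * cos t\<bar> \<le> \<bar>a\<bar>" for t
      using abs_cos_le_one[of t] by (simp add: abs_mult mult_left_le)
    then show ?case
      using tendsto_mult_left[OF conv[of \<theta> \<phi>], of a] by auto
  next
    case (add f g)
    then obtain b b' where b: "\<forall>x. \<bar>f x\<bar> \<le> b" "\<forall>x. \<bar>g x\<bar> \<le> b'" by blast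
    have "(\<integral>\<omega>. f (V n \<omega>) + g (V n \<omega>) \<partial>M) = (\<integral>\<omega>. f (V n \<omega>) \<partial>M) + (\<integral>\<omega>. g (V n \<omega>) \<partial>M)" for n
      by (rule Bochner_Integration.integral_add;
          rule M.integrable_bounded_real[OF Qmeas[OF _ meas]]; use add.hyps b in blast)
    moreover have "(\<integral>\<omega>. f (V' \<omega>) + g (V' \<omega>) \<partial>M') = (\<integral>\<omega>. f (V' \<omega>) \<partial>M') + (\<integral>\<omega>. g (V' \<omega>) \<partial>M')"
      by (rule Bochner_Integration.integral_add;
          rule M'.integrable_bounded_real[OF Qmeas[OF _ meas']]; use add.hyps b in blast)
    moreover have "\<bar>f x + g x\<bar> \<le> b + b'" for x
      using spec[OF b(1), of x] spec[OF b(2), of x] by linarith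
    ultimately show ?case
      using tendsto_add[OF conjunct1[OF add.IH(1)] conjunct1[OF add.IH(2)]]
      by (simp only:) blast
  qed
  have approx: "\<bar>(\<integral>\<omega>. G (U \<omega>) \<partial>N) - (\<integral>\<omega>. Q (U \<omega>) \<partial>N)\<bar> \<le> r / 3"
    if N: "prob_space N" and U: "\<And>i. i \<in> J \<Longrightarrow> (\<lambda>\<omega>. U \<omega> i) \<in> borel_measurable N"
      and P: "measure N {\<omega> \<in> space N. \<exists>i\<in>J. \<not> \<bar>U \<omega> i\<bar> \<le> R} \<le> e"
    for N :: "'b measure" and U
  proof -
    interpret N: prob_space N by fact
    let ?A = "{\<omega> \<in> space N. \<exists>i\<in>J. \<not> \<bar>U \<omega> i\<bar> \<le> R}"
    have "?A = (\<Union>i\<in>J. {\<omega> \<in> space N. R < \<bar>U \<omega> i\<bar>})" by (auto simp: not_le)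
    also have "\<dots> \<in> N.events" using J U by (intro sets.finite_UN) measurable
    finally have A: "?A \<in> N.events" .
    have "\<bar>(\<integral>\<omega>. G (U \<omega>) \<partial>N) - (\<integral>\<omega>. Q (U \<omega>) \<partial>N)\<bar> \<le> e + (2 * B + e) * measure N ?A"
    proof (rule N.expectation_diff_le[OF _ _ A])
      show "integrable N (\<lambda>\<omega>. G (U \<omega>))"
        by (rule N.integrable_bounded_real[OF measurable_finite_dependence[OF G(1) dep U] G(2)])
      show "integrable N (\<lambda>\<omega>. Q (U \<omega>))"
        by (rule N.integrable_bounded_real[OF Qmeas[OF Q(1) U] Q(2)])
      show "\<bar>G (U \<omega>) - Q (U \<omega>)\<bar> \<le> 2 * B + e" for \<omega>
        using G(2)[of "U \<omega>"] Q(2)[of "U \<omega>"] by linarith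
      show "\<bar>G (U \<omega>) - Q (U \<omega>)\<bar> \<le> e" if "\<omega> \<in> space N" "\<omega> \<notin> ?A" for \<omega>
        using that by (intro Q(3)) auto
    qed (use e in auto)
    also have "\<dots> \<le> e + (2 * B + 2) * e"
      using P e \<open>B \<ge> 0\<close> by (intro add_left_mono mult_mono) auto
    finally show ?thesis using e by linarith
  qed
  obtain n0 where n0: "\<And>n. n \<ge> n0 \<Longrightarrow> \<bar>(\<integral>\<omega>. Q (V n \<omega>) \<partial>M) - (\<integral>\<omega>. Q (V' \<omega>) \<partial>M')\<bar> < r / 3"
    using LIMSEQ_D[OF conjunct1[OF Qconv[OF Q(1)]], of "r / 3"] \<open>0 < r\<close> by auto
  show "\<exists>no. \<forall>n\<ge>no. norm ((\<integral>\<omega>. G (V n \<omega>) \<partial>M) - (\<integral>\<omega>. G (V' \<omega>) \<partial>M')) < r"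
  proof (intro exI allI impI)
    fix n assume "n \<ge> n0"
    moreover have "\<bar>(\<integral>\<omega>. G (V n \<omega>) \<partial>M) - (\<integral>\<omega>. Q (V n \<omega>) \<partial>M)\<bar> \<le> r / 3"
      by (rule approx[OF M meas R1]) (auto simp: R_def)
    moreover have "\<bar>(\<integral>\<omega>. G (V' \<omega>) \<partial>M') - (\<integral>\<omega>. Q (V' \<omega>) \<partial>M')\<bar> \<le> r / 3"
      by (rule approx[OF M' meas' R2]) (auto simp: R_def)
    ultimately show "norm ((\<integral>\<omega>. G (V n \<omega>) \<partial>M) - (\<integral>\<omega>. G (V' \<omega>) \<partial>M')) < r"
      using n0[of n] unfolding real_norm_def by linarith
  qed
qed

section \<open>Functionals on path space\<close>

lemma space_borel_of_paths: "space (borel_of path_topology) = paths"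
  by (simp add: borel_of_def topspace_path_topology space_measure_of_conv)

lemma open_paths_in_sets:
  assumes "open_paths U"
  shows "U \<in> sets (borel_of path_topology)"
proof -
  have "{U. open_paths U} \<subseteq> Pow (paths :: (real \<Rightarrow> 'a) set)"
    using open_paths_subset by auto
  then show ?thesis
    using assms by (simp add: borel_of_def topspace_path_topology openin_path_topology)
qed

lemma borel_measurable_continuous_path:
  assumes "continuous_map path_topology euclideanreal f"
  shows "f \<in> borel_measurable (borel_of path_topology)"
proof (rule borel_measurableI)
  fix S :: "real set" assume "open S"
  then have "open_paths {x \<in> paths. f x \<in> S}"
    using assms by (simp add: continuous_map_def topspace_path_topology openin_path_topology)
  moreover have "f -` S \<inter> space (borel_of path_topology) = {x \<in> paths. f x \<in> S}"
    by (auto simp: space_borel_of_paths)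
  ultimately show "f -` S \<inter> space (borel_of path_topology) \<in> sets (borel_of path_topology)"
    by (simp add: open_paths_in_sets)
qed

text \<open>The sup distance on \<open>{0..T}\<close> enters through an arbitrary upper bound
  \<open>\<delta>\<close>, so no supremum has to be formed.\<close>

definition path_lipschitz :: "real \<Rightarrow> real \<Rightarrow> ((real \<Rightarrow> 'a::metric_space) \<Rightarrow> real) \<Rightarrow> bool" where
  "path_lipschitz L T g \<longleftrightarrow> 0 \<le> L \<and> (\<forall>x\<in>paths. \<forall>y\<in>paths. \<forall>\<delta>\<ge>0.
     (\<forall>t\<in>{0..T}. dist (x t) (y t) \<le> \<delta>) \<longrightarrow> \<bar>g x - g y\<bar> \<le> L * \<delta>)"

lemma path_lipschitzD:
  assumes "path_lipschitz L T g" "x \<in> paths" "y \<in> paths" "0 \<le> \<delta>"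
    "\<And>t. t \<in> {0..T} \<Longrightarrow> dist (x t) (y t) \<le> \<delta>"
  shows "\<bar>g x - g y\<bar> \<le> L * \<delta>"
  using assms unfolding path_lipschitz_def by blast

lemma continuous_map_path_lipschitz:
  assumes g: "path_lipschitz L T g"
  shows "continuous_map path_topology euclideanreal g"
  unfolding continuous_map_def topspace_path_topology
proof (intro conjI allI impI)
  fix U :: "real set" assume "openin euclideanreal U"
  then have U: "open U" by simp
  have L: "L \<ge> 0" using g by (simp add: path_lipschitz_def)
  show "openin path_topology {x \<in> paths. g x \<in> U}"
    unfolding openin_path_topology
  proof (rule open_pathsI)
    fix f assume f: "f \<in> {x \<in> paths. g x \<in> U}"
    then obtain e where e: "e > 0" "\<And>y. dist y (g f) < e \<Longrightarrow> y \<in> U"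
      using U unfolding open_dist by blast
    \<comment> \<open>The denominator contains \<open>L + 1\<close> instead of \<open>L\<close> so
      that the case \<open>L = 0\<close> is covered.\<close>
    define \<delta> where "\<delta> = e / (2 * (L + 1))"
    have \<delta>: "\<delta> > 0" "L * \<delta> < e"
      using e(1) L mult_nonneg_nonneg[OF L less_imp_le[OF e(1)]]
      by (auto simp: \<delta>_def field_simps add_nonneg_pos)
    show "\<exists>K e. compact K \<and> K \<subseteq> {0..} \<and> 0 < e \<and>
        (\<forall>h\<in>paths. (\<forall>t\<in>K. dist (h t) (f t) < e) \<longrightarrow> h \<in> {x \<in> paths. g x \<in> U})"
    proof (intro exI conjI ballI impI)
      show "compact {0..T}" by simp
      show "{0..T} \<subseteq> {0..}" by auto
      show "0 < \<delta>" by fact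
      fix h assume h: "h \<in> paths" "\<forall>t\<in>{0..T}. dist (h t) (f t) < \<delta>"
      have "\<bar>g h - g f\<bar> \<le> L * \<delta>"
        using f h \<delta> by (intro path_lipschitzD[OF g]) (auto intro: less_imp_le)
      then show "h \<in> {x \<in> paths. g x \<in> U}"
        using h \<delta> by (auto intro!: e(2) simp: dist_real_def)
    qed
  qed auto
qed auto

text \<open>The inf-convolution of \<open>f\<close> with \<open>k\<close> times the sup norm on \<open>[0, k]\<close>.\<close>

definition lipschitz_envelope :: "((real \<Rightarrow> 'a::metric_space) \<Rightarrow> real) \<Rightarrow> nat \<Rightarrow> (real \<Rightarrow> 'a) \<Rightarrow> real"
  where "lipschitz_envelope f k x = Inf {f y + real k * \<delta> | y \<delta>.
    y \<in> paths \<and> 0 \<le> \<delta> \<and> (\<forall>t\<in>{0..real k}. dist (x t) (y t) \<le> \<delta>)}"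

context
  fixes f :: "(real \<Rightarrow> 'a::metric_space) \<Rightarrow> real" and B :: real
  assumes bounded: "\<And>x. x \<in> paths \<Longrightarrow> \<bar>f x\<bar> \<le> B"
begin

lemma lipschitz_envelope_le:
  assumes "y \<in> paths" "0 \<le> \<delta>" "\<And>t. t \<in> {0..real k} \<Longrightarrow> dist (x t) (y t) \<le> \<delta>"
  shows "lipschitz_envelope f k x \<le> f y + real k * \<delta>"
  unfolding lipschitz_envelope_def
proof (rule cInf_lower)
  show "bdd_below {f y + real k * \<delta> | y \<delta>.
      y \<in> paths \<and> 0 \<le> \<delta> \<and> (\<forall>t\<in>{0..real k}. dist (x t) (y t) \<le> \<delta>)}"
  proof (rule bdd_belowI, safe)
    fix y :: "real \<Rightarrow> 'a" and \<delta> :: real assume "y \<in> paths" "0 \<le> \<delta>"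
    then have "- B \<le> f y" "0 \<le> real k * \<delta>" using bounded[of y] by auto
    then show "- B \<le> f y + real k * \<delta>" by linarith
  qed
qed (use assms in blast)

lemma lipschitz_envelope_ge:
  assumes "x \<in> paths"
    and "\<And>y \<delta>. y \<in> paths \<Longrightarrow> 0 \<le> \<delta> \<Longrightarrow> (\<And>t. t \<in> {0..real k} \<Longrightarrow> dist (x t) (y t) \<le> \<delta>)
      \<Longrightarrow> c \<le> f y + real k * \<delta>"
  shows "c \<le> lipschitz_envelope f k x"
  unfolding lipschitz_envelope_def
proof (rule cInf_greatest)
  have "f x + real k * 0 \<in> {f y + real k * \<delta> | y \<delta>.
      y \<in> paths \<and> 0 \<le> \<delta> \<and> (\<forall>t\<in>{0..real k}. dist (x t) (y t) \<le> \<delta>)}"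
    using assms(1) by (auto intro!: exI[of _ x] exI[of _ 0])
  then show "{f y + real k * \<delta> | y \<delta>.
      y \<in> paths \<and> 0 \<le> \<delta> \<and> (\<forall>t\<in>{0..real k}. dist (x t) (y t) \<le> \<delta>)} \<noteq> {}" by blast
qed (use assms(2) in blast)

lemma lipschitz_envelope_le_self: "x \<in> paths \<Longrightarrow> lipschitz_envelope f k x \<le> f x"
  using lipschitz_envelope_le[of x 0 k x] by simp

lemma lipschitz_envelope_bounded:
  assumes "x \<in> paths"
  shows "\<bar>lipschitz_envelope f k x\<bar> \<le> B"
proof -
  have "- B \<le> lipschitz_envelope f k x"
  proof (rule lipschitz_envelope_ge[OF assms])
    fix y :: "real \<Rightarrow> 'a" and \<delta> :: real assume "y \<in> paths" "0 \<le> \<delta>"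
    then have "- B \<le> f y" "0 \<le> real k * \<delta>" using bounded[of y] by auto
    then show "- B \<le> f y + real k * \<delta>" by linarith
  qed
  with lipschitz_envelope_le_self[OF assms, of k] bounded[OF assms] show ?thesis
    by linarith
qed

text \<open>A radius \<open>\<delta>\<close> admissible for \<open>y\<close> around
  \<open>x'\<close> becomes \<open>\<delta> + \<eta>\<close> around \<open>x\<close>, at the extra
  price \<open>k * \<eta>\<close>; this holds for every competitor and hence for the
  infimum.\<close>

lemma path_lipschitz_envelope: "path_lipschitz (real k) (real k) (lipschitz_envelope f k)"
proof -
  have le: "lipschitz_envelope f k x - real k * \<eta> \<le> lipschitz_envelope f k x'"
    if "x \<in> paths" "x' \<in> paths" "0 \<le> \<eta>" "\<And>t. t \<in> {0..real k} \<Longrightarrow> dist (x t) (x' t) \<le> \<eta>"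
    for x x' \<eta>
  proof (rule lipschitz_envelope_ge[OF that(2)])
    fix y \<delta> assume y: "y \<in> paths" "0 \<le> \<delta>" "\<And>t. t \<in> {0..real k} \<Longrightarrow> dist (x' t) (y t) \<le> \<delta>"
    have "lipschitz_envelope f k x \<le> f y + real k * (\<delta> + \<eta>)"
    proof (rule lipschitz_envelope_le)
      fix t assume "t \<in> {0..real k}"
      then show "dist (x t) (y t) \<le> \<delta> + \<eta>"
        using dist_triangle[of "x t" "y t" "x' t"] y(3)[of t] that(4)[of t] by linarith
    qed (use y that in auto)
    then show "lipschitz_envelope f k x - real k * \<eta> \<le> f y + real k * \<delta>"
      by (simp add: algebra_simps)
  qed
  show ?thesis
    unfolding path_lipschitz_def
  proof (intro conjI ballI allI impI)
    fix x y :: "real \<Rightarrow> 'a" and \<delta> :: real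
    assume "x \<in> paths" "y \<in> paths" "0 \<le> \<delta>" "\<forall>t\<in>{0..real k}. dist (x t) (y t) \<le> \<delta>"
    then show "\<bar>lipschitz_envelope f k x - lipschitz_envelope f k y\<bar> \<le> real k * \<delta>"
      using le[of x y \<delta>] le[of y x \<delta>] by (auto simp: dist_commute abs_le_iff algebra_simps)
  qed simp
qed

text \<open>Once \<open>{0..k}\<close> contains \<open>K\<close>, competitors within
  \<open>e\<close> of \<open>x\<close> have values above \<open>f x - r / 2\<close> by continuity.
  All others pay at least \<open>k * e\<close>, which for large \<open>k\<close> exceeds
  \<open>2 * B\<close>, the largest possible gain in \<open>f\<close>.\<close>

lemma lipschitz_envelope_tendsto:
  assumes cont: "continuous_map path_topology euclideanreal f" and x: "x \<in> paths"
  shows "(\<lambda>k. lipschitz_envelope f k x) \<longlonglongrightarrow> f x"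
proof (rule LIMSEQ_I)
  fix r :: real assume "r > 0"
  have "openin path_topology {y \<in> topspace path_topology. f y \<in> {f x - r / 2<..}}"
    using cont unfolding continuous_map_def by (auto dest!: spec[of _ "{f x - r / 2<..}"])
  then have "open_paths {y \<in> paths. f x - r / 2 < f y}"
    by (simp add: topspace_path_topology openin_path_topology)
  then obtain K e where K: "compact K" "K \<subseteq> {0..}" "e > 0"
    "\<And>y. y \<in> paths \<Longrightarrow> (\<And>t. t \<in> K \<Longrightarrow> dist (y t) (x t) < e) \<Longrightarrow> f x - r / 2 < f y"
    using open_pathsD[of _ x] x \<open>r > 0\<close> by (smt (verit, ccfv_threshold) mem_Collect_eq half_gt_zero)
  obtain b where b: "\<And>t. t \<in> K \<Longrightarrow> t \<le> b"
    using compact_imp_bounded[OF K(1)] unfolding bounded_real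
    by (meson abs_le_D1)
  have B: "B \<ge> 0" using bounded[OF x] by linarith
  obtain N where N: "max b (2 * B / e) \<le> real N" using real_arch_simple by blast
  show "\<exists>no. \<forall>k\<ge>no. norm (lipschitz_envelope f k x - f x) < r"
  proof (intro exI allI impI)
    fix k assume "k \<ge> N"
    with N have k': "b \<le> real k" "2 * B / e \<le> real k"
      using of_nat_mono[of N k, where 'a=real] by auto
    then have k: "b \<le> real k" "2 * B \<le> real k * e"
      using K(3) by (auto simp: pos_divide_le_eq)
    have "f x - r / 2 \<le> lipschitz_envelope f k x"
    proof (rule lipschitz_envelope_ge[OF x])
      fix y \<delta> assume y: "y \<in> paths" "0 \<le> \<delta>" "\<And>t. t \<in> {0..real k} \<Longrightarrow> dist (x t) (y t) \<le> \<delta>"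
      show "f x - r / 2 \<le> f y + real k * \<delta>"
      proof (cases "\<delta> < e")
        case True
        have "f x - r / 2 < f y"
        proof (rule K(4)[OF y(1)])
          fix t assume "t \<in> K"
          then have "t \<in> {0..real k}" using b[of t] k K(2) by auto
          from y(3)[OF this] True show "dist (y t) (x t) < e" by (simp add: dist_commute)
        qed
        moreover have "0 \<le> real k * \<delta>" using y by simp
        ultimately show ?thesis by linarith
      next
        case False
        then have "real k * e \<le> real k * \<delta>" by (intro mult_left_mono) auto
        then show ?thesis
          using bounded[OF x] bounded[OF y(1)] k \<open>r > 0\<close> by linarith
      qed
    qed
    with lipschitz_envelope_le_self[OF x, of k] \<open>r > 0\<close>
    show "norm (lipschitz_envelope f k x - f x) < r" by simp
  qed
qed

end

theorem weakly_converges_on_lipschitzI: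
  fixes \<mu> :: "nat \<Rightarrow> (real \<Rightarrow> 'a::metric_space) measure"
  assumes \<mu>: "\<And>n. prob_space (\<mu> n)" "\<And>n. sets (\<mu> n) = sets (borel_of path_topology)"
    and \<nu>: "prob_space \<nu>" "sets \<nu> = sets (borel_of path_topology)"
    and conv: "\<And>g L T B. path_lipschitz L (real T) g \<Longrightarrow> (\<And>x. x \<in> paths \<Longrightarrow> \<bar>g x\<bar> \<le> B)
      \<Longrightarrow> (\<lambda>n. \<integral>w. g w \<partial>\<mu> n) \<longlonglongrightarrow> (\<integral>w. g w \<partial>\<nu>)"
  shows "weakly_converges_on path_topology \<mu> \<nu>"
proof -
  interpret \<nu>: prob_space \<nu> by fact
  have int: "integrable N g"
    if "prob_space N" "sets N = sets (borel_of path_topology)"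
      "continuous_map path_topology euclideanreal g" "\<And>x. x \<in> paths \<Longrightarrow> \<bar>g x\<bar> \<le> B"
    for g :: "(real \<Rightarrow> 'a) \<Rightarrow> real" and N B
  proof -
    interpret N: prob_space N by fact
    have "space N = paths"
      using sets_eq_imp_space_eq[OF that(2)] by (simp add: space_borel_of_paths)
    then show ?thesis
      using borel_measurable_continuous_path[OF that(3)] that(4)
      by (intro N.integrable_bounded_real[where B=B])
        (simp_all add: measurable_cong_sets[OF that(2) refl])
  qed
  have sp: "space \<nu> = paths" "space (\<mu> n) = paths" for n
    using sets_eq_imp_space_eq[OF \<nu>(2)] sets_eq_imp_space_eq[OF \<mu>(2)]
    by (simp_all add: space_borel_of_paths)
  \<comment> \<open>A single envelope suffices: \<open>k\<close> is chosen from \<open>\<nu>\<close>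
    alone, and since the envelope lies below \<open>f\<close>, its lower bound passes to
    \<open>f\<close> under every \<open>\<mu> n\<close>.\<close>
  have lower: "\<forall>\<^sub>F n in sequentially. r < (\<integral>w. f w \<partial>\<mu> n)"
    if f: "continuous_map path_topology euclideanreal f" "\<And>x. x \<in> paths \<Longrightarrow> \<bar>f x\<bar> \<le> B"
      and r: "r < (\<integral>w. f w \<partial>\<nu>)" for f B r
  proof -
    note env = path_lipschitz_envelope[OF f(2)] lipschitz_envelope_bounded[OF f(2)]
    note cont_env = continuous_map_path_lipschitz[OF env(1)]
    have "(\<lambda>k. \<integral>w. lipschitz_envelope f k w \<partial>\<nu>) \<longlonglongrightarrow> (\<integral>w. f w \<partial>\<nu>)"
    proof (rule integral_dominated_convergence[where w="\<lambda>_. B"])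
      show "f \<in> borel_measurable \<nu>"
        using int[OF \<nu> f] by (rule borel_measurable_integrable)
      show "lipschitz_envelope f k \<in> borel_measurable \<nu>" for k
        using int[OF \<nu> cont_env env(2)] by (rule borel_measurable_integrable)
      show "AE x in \<nu>. (\<lambda>k. lipschitz_envelope f k x) \<longlonglongrightarrow> f x"
        by (rule AE_I2) (use sp lipschitz_envelope_tendsto[OF f(2) f(1)] in auto)
      show "AE x in \<nu>. norm (lipschitz_envelope f k x) \<le> B" for k
        by (rule AE_I2) (use sp env(2) in auto)
    qed simp
    from order_tendstoD(1)[OF this r]
    obtain k where k: "r < (\<integral>w. lipschitz_envelope f k w \<partial>\<nu>)"
      by (auto simp: eventually_sequentially)
    have "(\<lambda>n. \<integral>w. lipschitz_envelope f k w \<partial>\<mu> n) \<longlonglongrightarrow> (\<integral>w. lipschitz_envelope f k w \<partial>\<nu>)"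
      by (rule conv[OF env(1) env(2)])
    from order_tendstoD(1)[OF this k]
    show ?thesis
    proof eventually_elim
      case (elim n)
      also have "(\<integral>w. lipschitz_envelope f k w \<partial>\<mu> n) \<le> (\<integral>w. f w \<partial>\<mu> n)"
        by (rule integral_mono[OF int[OF \<mu> cont_env env(2)] int[OF \<mu> f]])
          (use sp lipschitz_envelope_le_self[OF f(2)] in auto)
      finally show ?case .
    qed
  qed
  show ?thesis
    unfolding weakly_converges_on_def
  proof (intro allI impI)
    fix f :: "(real \<Rightarrow> 'a) \<Rightarrow> real"
    assume f: "continuous_map path_topology euclideanreal f \<and> bounded (f ` topspace path_topology)"
    then obtain B where B: "\<And>x. x \<in> paths \<Longrightarrow> \<bar>f x\<bar> \<le> B"
      unfolding bounded_iff topspace_path_topology by auto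
    have cont: "continuous_map path_topology euclideanreal f" using f by simp
    then have cont': "continuous_map path_topology euclideanreal (\<lambda>x. - f x)"
      by (intro continuous_intros)
    show "(\<lambda>n. \<integral>w. f w \<partial>\<mu> n) \<longlonglongrightarrow> (\<integral>w. f w \<partial>\<nu>)"
    proof (rule order_tendstoI)
      show "\<forall>\<^sub>F n in sequentially. r < (\<integral>w. f w \<partial>\<mu> n)" if "r < (\<integral>w. f w \<partial>\<nu>)" for r
        by (rule lower[OF cont B that])
      show "\<forall>\<^sub>F n in sequentially. (\<integral>w. f w \<partial>\<mu> n) < r" if "(\<integral>w. f w \<partial>\<nu>) < r" for r
      proof -
        have "\<forall>\<^sub>F n in sequentially. - r < (\<integral>w. - f w \<partial>\<mu> n)"
          by (rule lower[OF cont']) (use B that in auto)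
        then show ?thesis by simp
      qed
    qed
  qed
qed

section \<open>The walk and its martingale part\<close>

lemma sum_directions:
  "(\<Sum>z\<in>(directions :: (real ^ 'd) set). f z) = (\<Sum>i\<in>UNIV. f (axis i 1) + f (- axis i 1))"
proof -
  have neq: "axis i (1::real) \<noteq> - axis j 1" for i j :: 'd
  proof
    assume "axis i (1::real) = - axis j 1"
    then have "axis i (1::real) $ i = (- axis j 1) $ i" by simp
    then show False by (simp add: axis_def split: if_splits)
  qed
  have eq: "directions = range (\<lambda>i::'d. axis i (1::real)) \<union> range (\<lambda>i. - axis i 1)"
    by (auto simp: directions_def)
  have inj: "inj (\<lambda>i::'d. axis i (1::real))" "inj (\<lambda>i::'d. - axis i (1::real))"
    by (auto simp: inj_on_def axis_eq_axis)
  show ?thesis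
    unfolding eq using neq
    by (subst sum.union_disjoint) (auto simp: sum.reindex[OF inj(1)] sum.reindex[OF inj(2)] sum.distrib)
qed

lemma finite_directions: "finite (directions :: (real ^ 'd) set)"
  by (simp add: directions_def)

lemma card_directions: "card (directions :: (real ^ 'd) set) = 2 * CARD('d)"
  using sum_directions[where 'd='d and f="\<lambda>_. 1::nat"] by simp

lemma norm_square_vec: "(norm (u :: real ^ 'd))\<^sup>2 = (\<Sum>i\<in>UNIV. (u $ i)\<^sup>2)"
  by (simp add: norm_vec_def L2_set_def sum_nonneg)

lemma sum_directions_inner:
  fixes u :: "real ^ 'd"
  shows "(\<Sum>z\<in>directions. u \<bullet> z) = 0" and "(\<Sum>z\<in>directions. (u \<bullet> z)\<^sup>2) = 2 * (norm u)\<^sup>2"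
proof -
  show "(\<Sum>z\<in>directions. u \<bullet> z) = 0" by (simp add: sum_directions)
  show "(\<Sum>z\<in>directions. (u \<bullet> z)\<^sup>2) = 2 * (norm u)\<^sup>2"
    by (simp add: sum_directions inner_axis sum_distrib_left norm_square_vec)
qed

text \<open>Over the \<open>2 d\<close> directions the squares of one coordinate add up to 2, so
  \<open>1 / d\<close> is their mean under a fresh choice.\<close>

lemma sum_directions_square_centred:
  "(\<Sum>z\<in>(directions :: (real ^ 'd) set). (z $ i)\<^sup>2 - 1 / real CARD('d)) = 0"
  using sum_directions_inner(2)[of "axis i 1 :: real ^ 'd"]
  by (simp add: sum_subtractf card_directions norm_axis_1 inner_axis inner_commute[of "axis _ _"])

lemma directions_cases:
  assumes "z \<in> directions"
  obtains i where "z = axis i 1" | i where "z = - axis i 1"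
  using assms by (auto simp: directions_def)

lemma norm_direction: "z \<in> directions \<Longrightarrow> norm z = 1"
  by (erule directions_cases) (simp_all add: norm_axis_1)

lemma direction_square_le:
  assumes "z \<in> directions" shows "(z $ i)\<^sup>2 \<le> 1"
  using component_le_norm_cart[of z i] norm_direction[OF assms] by (simp add: abs_square_le_1)

text \<open>A direction has a single nonzero coordinate, hence no cross terms. This makes the second
  moments of the steps diagonal.\<close>

lemma inner_direction_square:
  fixes u :: "real ^ 'd"
  assumes "z \<in> directions"
  shows "(u \<bullet> z)\<^sup>2 = (\<Sum>i\<in>UNIV. (u $ i)\<^sup>2 * (z $ i)\<^sup>2)"
proof -
  obtain j where j: "z = axis j 1 \<or> z = - axis j 1"
    using assms by (auto elim: directions_cases)
  have "(u \<bullet> z)\<^sup>2 = (u $ j)\<^sup>2" using j by (auto simp: inner_axis)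
  moreover have "(u $ i)\<^sup>2 * (z $ i)\<^sup>2 = (if i = j then (u $ i)\<^sup>2 else 0)" for i
    using j by (auto simp: axis_def)
  ultimately show ?thesis by simp
qed

lemma sum_transition:
  fixes f :: "real ^ 'd \<Rightarrow> 'b::real_vector"
  assumes "x \<in> directions"
  shows "(\<Sum>z\<in>directions. transition q x z *\<^sub>R f z) =
    (1 - q) *\<^sub>R f x + (q / (2 * real CARD('d))) *\<^sub>R (\<Sum>z\<in>directions. f z)"
proof -
  have "(\<Sum>z\<in>directions. transition q x z *\<^sub>R f z) =
      (\<Sum>z\<in>directions. (if x = z then (1 - q) *\<^sub>R f z else 0)) +
      (\<Sum>z\<in>directions. (q / (2 * real CARD('d))) *\<^sub>R f z)"
    unfolding sum.distrib[symmetric]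
    by (rule sum.cong) (auto simp: transition_def scaleR_add_left)
  also have "(\<Sum>z\<in>directions. (if x = z then (1 - q) *\<^sub>R f z else 0)) = (1 - q) *\<^sub>R f x"
    using assms finite_directions by (subst sum.delta') auto
  finally show ?thesis by (simp add: scaleR_sum_right)
qed

locale conservative_walk =
  fixes M :: "'m measure" and p :: real and Y :: "nat \<Rightarrow> 'm \<Rightarrow> real ^ 'd"
  assumes p: "0 < p" "p < 1" and steps: "walk_steps M (\<lambda>_. p) Y"

sublocale conservative_walk \<subseteq> prob_space M
  using steps by (simp add: walk_steps_def)

context conservative_walk
begin

text \<open>Measurability with respect to the \<open>\<sigma>\<close>-algebra of the first \<open>n\<close> steps, which is finite.\<close>

definition dep :: "nat \<Rightarrow> ('m \<Rightarrow> 'b) \<Rightarrow> bool" where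
  "dep n h \<longleftrightarrow> (\<forall>\<omega>\<in>space M. \<forall>\<omega>'\<in>space M. (\<forall>k\<in>{1..n}. Y k \<omega> = Y k \<omega>') \<longrightarrow> h \<omega> = h \<omega>')"

lemma dep_const [intro, simp]: "dep n (\<lambda>_. c)"
  by (simp add: dep_def)

lemma dep_Y [intro]: "1 \<le> k \<Longrightarrow> k \<le> n \<Longrightarrow> dep n (Y k)"
  by (simp add: dep_def)

lemma dep_mono: "dep n f \<Longrightarrow> n \<le> m \<Longrightarrow> dep m f"
  unfolding dep_def by fastforce

lemma dep_compose: "dep n f \<Longrightarrow> dep n (\<lambda>\<omega>. F (f \<omega>))"
  unfolding dep_def by metis

lemma dep_compose2: "dep n f \<Longrightarrow> dep n g \<Longrightarrow> dep n (\<lambda>\<omega>. F (f \<omega>) (g \<omega>))"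
  unfolding dep_def by metis

lemmas dep_ops [intro] = dep_compose2[where F="(+)"] dep_compose2[where F="(-)"]
  dep_compose2[where F="(*)"] dep_compose2[where F="(*\<^sub>R)"] dep_compose2[where F="(\<bullet>)"]
  dep_compose2[where F="(\<and>)"]

lemma dep_sum [intro]: "(\<And>j. j \<in> J \<Longrightarrow> dep n (f j)) \<Longrightarrow> dep n (\<lambda>\<omega>. \<Sum>j\<in>J. f j \<omega>)"
  unfolding dep_def by (intro ballI impI sum.cong refl) blast

lemma Y_directions: "1 \<le> n \<Longrightarrow> \<omega> \<in> space M \<Longrightarrow> Y n \<omega> \<in> directions"
  using steps measurable_space[of "Y n" M "count_space directions" \<omega>]
  by (auto simp: walk_steps_def)

lemma events_Y: "1 \<le> n \<Longrightarrow> {\<omega> \<in> space M. Y n \<omega> = z} \<in> events"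
proof (cases "z \<in> directions")
  case True
  assume "1 \<le> n"
  then have "Y n \<in> M \<rightarrow>\<^sub>M count_space directions" using steps by (simp add: walk_steps_def)
  from measurable_sets[OF this, of "{z}"] True show ?thesis
    by (simp add: vimage_def Int_def conj_commute)
next
  case False
  assume "1 \<le> n"
  then have "{\<omega> \<in> space M. Y n \<omega> = z} = {}" using False Y_directions by auto
  then show ?thesis by (simp only: sets.empty_sets)
qed

lemma events_cylinder: "{\<omega> \<in> space M. \<forall>k\<in>{1..n}. Y k \<omega> = y k} \<in> events"
  by (intro sets.sets_Collect_finite_All events_Y) auto

section \<open>Expectations of functions of a finite history\<close>

abbreviation histories :: "nat \<Rightarrow> (nat \<Rightarrow> real ^ 'd) set" where
  "histories n \<equiv> PiE {1..n} (\<lambda>_. directions)"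

lemma finite_histories: "finite (histories n)"
  by (intro finite_PiE finite_directions) auto

text \<open>\<open>h\<close> is constant on each cylinder, so its value at a representative
  determines it. On an empty cylinder the representative is arbitrary, but there the indicator
  vanishes.\<close>

lemma dep_decompose:
  fixes h :: "'m \<Rightarrow> 'b::real_vector"
  assumes "dep n h"
  obtains h' where "\<And>\<omega>. \<omega> \<in> space M \<Longrightarrow>
    h \<omega> = (\<Sum>y\<in>histories n. indicator {\<omega> \<in> space M. \<forall>k\<in>{1..n}. Y k \<omega> = y k} \<omega> *\<^sub>R h' y)"
proof
  fix \<omega> assume w: "\<omega> \<in> space M"
  define h' where "h' y = h (SOME \<omega>. \<omega> \<in> space M \<and> (\<forall>k\<in>{1..n}. Y k \<omega> = y k))" for y
  define y0 where "y0 = restrict (\<lambda>k. Y k \<omega>) {1..n}"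
  have y0: "y0 \<in> histories n" using w Y_directions by (auto simp: y0_def)
  have ind: "indicator {\<omega> \<in> space M. \<forall>k\<in>{1..n}. Y k \<omega> = y k} \<omega> = (if y = y0 then 1 else (0::real))"
    if "y \<in> histories n" for y
  proof -
    have "(\<forall>k\<in>{1..n}. Y k \<omega> = y k) \<longleftrightarrow> y = y0"
      using that y0 by (auto simp: y0_def fun_eq_iff PiE_iff extensional_def)
    then show ?thesis using w by (simp add: indicator_def)
  qed
  have "(\<Sum>y\<in>histories n. indicator {\<omega> \<in> space M. \<forall>k\<in>{1..n}. Y k \<omega> = y k} \<omega> *\<^sub>R h' y) =
      (\<Sum>y\<in>histories n. if y = y0 then h' y else 0)"
    by (rule sum.cong) (simp_all add: ind del: One_nat_def)
  also have "\<dots> = h' y0"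
    using y0 finite_histories by (subst sum.delta) auto
  also have "\<dots> = h \<omega>"
  proof -
    let ?P = "\<lambda>\<omega>'. \<omega>' \<in> space M \<and> (\<forall>k\<in>{1..n}. Y k \<omega>' = y0 k)"
    have "?P \<omega>" using w by (simp add: y0_def)
    then have "?P (SOME \<omega>'. ?P \<omega>')" by (rule someI)
    then show ?thesis
      using assms w unfolding dep_def h'_def by (metis (no_types, lifting) y0_def restrict_apply')
  qed
  finally show "h \<omega> = (\<Sum>y\<in>histories n.
      indicator {\<omega> \<in> space M. \<forall>k\<in>{1..n}. Y k \<omega> = y k} \<omega> *\<^sub>R
      h (SOME \<omega>. \<omega> \<in> space M \<and> (\<forall>k\<in>{1..n}. Y k \<omega> = y k)))"
    by (simp add: h'_def)
qed

text \<open>Finitely many histories mean finitely many values, so integrability follows without any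
  bound on \<open>h\<close>.\<close>

lemma dep_integrable:
  fixes h :: "'m \<Rightarrow> 'b::{banach, second_countable_topology}"
  assumes "dep n h"
  shows "integrable M h"
proof -
  obtain h' where h': "\<And>\<omega>. \<omega> \<in> space M \<Longrightarrow>
      h \<omega> = (\<Sum>y\<in>histories n. indicator {\<omega> \<in> space M. \<forall>k\<in>{1..n}. Y k \<omega> = y k} \<omega> *\<^sub>R h' y)"
    using dep_decompose[OF assms] by blast
  have "integrable M (\<lambda>\<omega>. \<Sum>y\<in>histories n.
      indicator {\<omega> \<in> space M. \<forall>k\<in>{1..n}. Y k \<omega> = y k} \<omega> *\<^sub>R h' y)"
    using events_cylinder
    by (intro Bochner_Integration.integrable_sum integrable_scaleR_left integrable_real_indicator)
      (auto simp: emeasure_eq_measure)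
  then show ?thesis
    by (subst Bochner_Integration.integrable_cong[OF refl h']) auto
qed

lemma dep_events:
  assumes "dep n P"
  shows "{\<omega> \<in> space M. P \<omega>} \<in> events"
proof -
  have "dep n (\<lambda>\<omega>. if P \<omega> then 1 else 0 :: real)"
    using dep_compose[OF assms, of "\<lambda>b. if b then 1 else 0 :: real"] .
  then have "(\<lambda>\<omega>. if P \<omega> then 1 else 0 :: real) \<in> borel_measurable M"
    by (intro borel_measurable_integrable dep_integrable)
  from measurable_sets[OF this, of "{1}"] show ?thesis
    by (auto simp: vimage_def Int_def conj_commute cong: conj_cong split: if_splits)
qed

text \<open>The transition law is given on cylinders only; decomposing \<open>h\<close> over the
  histories extends it to every function of the past.\<close>

lemma markov_indicator:
  fixes h :: "'m \<Rightarrow> 'b::{banach, second_countable_topology}"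
  assumes "dep n h" "1 \<le> n" "z \<in> directions"
  shows "expectation (\<lambda>\<omega>. indicator {\<omega> \<in> space M. Y (Suc n) \<omega> = z} \<omega> *\<^sub>R h \<omega>) =
    expectation (\<lambda>\<omega>. transition (refresh_prob TYPE('d) (\<lambda>_. p) n) (Y n \<omega>) z *\<^sub>R h \<omega>)"
proof -
  let ?C = "\<lambda>y. {\<omega> \<in> space M. \<forall>k\<in>{1..n}. Y k \<omega> = y k}"
  let ?Z = "{\<omega> \<in> space M. Y (Suc n) \<omega> = z}"
  let ?t = "\<lambda>x. transition (refresh_prob TYPE('d) (\<lambda>_. p) n) x z"
  obtain h' where h': "\<And>\<omega>. \<omega> \<in> space M \<Longrightarrow> h \<omega> = (\<Sum>y\<in>histories n. indicator (?C y) \<omega> *\<^sub>R h' y)"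
    using dep_decompose[OF assms(1)] by blast
  have Z: "?Z \<in> events" by (rule events_Y) simp
  have C: "?C y \<in> events" for y by (rule events_cylinder)
  \<comment> \<open>The hypothesis on the steps concerns cylinders of positive probability; for null
    cylinders both sides are 0.\<close>
  have key: "prob (?Z \<inter> ?C y) = ?t (y n) * prob (?C y)" for y
  proof (cases "prob (?C y) = 0")
    case True
    have "prob (?Z \<inter> ?C y) \<le> prob (?C y)" using C by (intro finite_measure_mono) auto
    with True show ?thesis by (simp add: measure_le_0_iff)
  next
    case False
    then have "prob (?C y) > 0" by (simp add: zero_less_measure_iff)
    then have "cond_prob M (\<lambda>\<omega>. Y (Suc n) \<omega> = z) (\<lambda>\<omega>. \<forall>k\<in>{1..n}. Y k \<omega> = y k) = ?t (y n)"
      using steps assms unfolding walk_steps_def by blast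
    moreover have "{\<omega> \<in> space M. Y (Suc n) \<omega> = z \<and> (\<forall>k\<in>{1..n}. Y k \<omega> = y k)} = ?Z \<inter> ?C y"
      by auto
    ultimately show ?thesis using False unfolding cond_prob_def by (simp add: field_simps)
  qed
  have int: "integrable M (\<lambda>\<omega>. indicator A \<omega> *\<^sub>R c)" if "A \<in> events" for A and c :: 'b
    using that by (intro integrable_scaleR_left integrable_real_indicator)
      (auto simp: emeasure_eq_measure)
  have ZC: "?Z \<inter> ?C y \<in> events" for y using Z C by (rule sets.Int)
  have "expectation (\<lambda>\<omega>. indicator ?Z \<omega> *\<^sub>R h \<omega>) =
      expectation (\<lambda>\<omega>. \<Sum>y\<in>histories n. indicator (?Z \<inter> ?C y) \<omega> *\<^sub>R h' y)"
    by (rule Bochner_Integration.integral_cong)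
      (simp_all add: h' scaleR_sum_right indicator_inter_arith)
  also have "\<dots> = (\<Sum>y\<in>histories n. expectation (\<lambda>\<omega>. indicator (?Z \<inter> ?C y) \<omega> *\<^sub>R h' y))"
    by (rule Bochner_Integration.integral_sum) (rule int[OF ZC])
  also have "\<dots> = (\<Sum>y\<in>histories n. prob (?Z \<inter> ?C y) *\<^sub>R h' y)"
  proof (rule sum.cong[OF refl])
    fix y
    show "expectation (\<lambda>\<omega>. indicator (?Z \<inter> ?C y) \<omega> *\<^sub>R h' y) = prob (?Z \<inter> ?C y) *\<^sub>R h' y"
      using ZC[of y] by (subst integral_scaleR_left) (auto simp: emeasure_eq_measure)
  qed
  also have "\<dots> = (\<Sum>y\<in>histories n. prob (?C y) *\<^sub>R (?t (y n) *\<^sub>R h' y))"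
    by (simp only: key scaleR_scaleR mult.commute)
  also have "\<dots> = (\<Sum>y\<in>histories n. expectation (\<lambda>\<omega>. indicator (?C y) \<omega> *\<^sub>R (?t (y n) *\<^sub>R h' y)))"
  proof (rule sum.cong[OF refl])
    fix y
    show "prob (?C y) *\<^sub>R (?t (y n) *\<^sub>R h' y) =
        expectation (\<lambda>\<omega>. indicator (?C y) \<omega> *\<^sub>R (?t (y n) *\<^sub>R h' y))"
      using C[of y] by (subst integral_scaleR_left) (auto simp: emeasure_eq_measure)
  qed
  also have "\<dots> = expectation (\<lambda>\<omega>. \<Sum>y\<in>histories n. indicator (?C y) \<omega> *\<^sub>R (?t (y n) *\<^sub>R h' y))"
    by (rule Bochner_Integration.integral_sum[symmetric]) (rule int[OF C])
  also have "\<dots> = expectation (\<lambda>\<omega>. ?t (Y n \<omega>) *\<^sub>R h \<omega>)"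
  proof (rule Bochner_Integration.integral_cong[OF refl])
    fix \<omega> assume w: "\<omega> \<in> space M"
    have eq: "indicator (?C y) \<omega> *\<^sub>R (?t (y n) *\<^sub>R h' y) =
        ?t (Y n \<omega>) *\<^sub>R (indicator (?C y) \<omega> *\<^sub>R h' y)" for y
      using assms(2) by (cases "\<omega> \<in> ?C y") auto
    then show "(\<Sum>y\<in>histories n. indicator (?C y) \<omega> *\<^sub>R (?t (y n) *\<^sub>R h' y)) = ?t (Y n \<omega>) *\<^sub>R h \<omega>"
      by (simp only: h'[OF w] scaleR_sum_right)
  qed
  finally show ?thesis .
qed

text \<open>This stands in for conditioning on the first \<open>n\<close> steps:
  \<open>\<Phi>\<close> combines the function of the next step with an arbitrary function of the
  past.\<close>

lemma markov:
  fixes \<Phi> :: "'m \<Rightarrow> real ^ 'd \<Rightarrow> 'b::{banach, second_countable_topology}"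
  assumes dep: "\<And>z. dep n (\<lambda>\<omega>. \<Phi> \<omega> z)" and n: "1 \<le> n"
    and q: "q = refresh_prob TYPE('d) (\<lambda>_. p) n"
  shows "expectation (\<lambda>\<omega>. \<Phi> \<omega> (Y (Suc n) \<omega>)) = expectation (\<lambda>\<omega>. (1 - q) *\<^sub>R \<Phi> \<omega> (Y n \<omega>) +
    (q / (2 * real CARD('d))) *\<^sub>R (\<Sum>z\<in>directions. \<Phi> \<omega> z))"
proof -
  let ?Z = "\<lambda>z. {\<omega> \<in> space M. Y (Suc n) \<omega> = z}"
  have depZ: "dep (Suc n) (\<lambda>\<omega>. indicator (?Z z) \<omega> *\<^sub>R \<Phi> \<omega> z)" for z
  proof (rule dep_ops)
    show "dep (Suc n) (\<lambda>\<omega>. indicator (?Z z) \<omega>)"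
      unfolding dep_def by (auto simp: indicator_def)
    show "dep (Suc n) (\<lambda>\<omega>. \<Phi> \<omega> z)" using dep by (rule dep_mono) simp
  qed
  have dept: "dep n (\<lambda>\<omega>. transition q (Y n \<omega>) z *\<^sub>R \<Phi> \<omega> z)" for z
    using n by (intro dep_ops(4) dep dep_compose[where F="\<lambda>x. transition q x z"] dep_Y) auto
  have "expectation (\<lambda>\<omega>. \<Phi> \<omega> (Y (Suc n) \<omega>)) =
      expectation (\<lambda>\<omega>. \<Sum>z\<in>directions. indicator (?Z z) \<omega> *\<^sub>R \<Phi> \<omega> z)"
  proof (rule Bochner_Integration.integral_cong[OF refl])
    fix \<omega> assume w: "\<omega> \<in> space M"
    have "(\<Sum>z\<in>directions. indicator (?Z z) \<omega> *\<^sub>R \<Phi> \<omega> z) =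
        (\<Sum>z\<in>directions. if Y (Suc n) \<omega> = z then \<Phi> \<omega> z else 0)"
      using w by (intro sum.cong) (auto simp: indicator_def)
    also have "\<dots> = \<Phi> \<omega> (Y (Suc n) \<omega>)"
      using finite_directions Y_directions[OF _ w, of "Suc n"] by (subst sum.delta') auto
    finally show "\<Phi> \<omega> (Y (Suc n) \<omega>) = (\<Sum>z\<in>directions. indicator (?Z z) \<omega> *\<^sub>R \<Phi> \<omega> z)" by simp
  qed
  also have "\<dots> = (\<Sum>z\<in>directions. expectation (\<lambda>\<omega>. indicator (?Z z) \<omega> *\<^sub>R \<Phi> \<omega> z))"
    by (rule Bochner_Integration.integral_sum) (rule dep_integrable[OF depZ])
  also have "\<dots> = (\<Sum>z\<in>directions. expectation (\<lambda>\<omega>. transition q (Y n \<omega>) z *\<^sub>R \<Phi> \<omega> z))"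
    unfolding q by (intro sum.cong refl markov_indicator dep n)
  also have "\<dots> = expectation (\<lambda>\<omega>. \<Sum>z\<in>directions. transition q (Y n \<omega>) z *\<^sub>R \<Phi> \<omega> z)"
    by (rule Bochner_Integration.integral_sum[symmetric]) (rule dep_integrable[OF dept])
  also have "\<dots> = expectation (\<lambda>\<omega>. (1 - q) *\<^sub>R \<Phi> \<omega> (Y n \<omega>) +
    (q / (2 * real CARD('d))) *\<^sub>R (\<Sum>z\<in>directions. \<Phi> \<omega> z))"
    by (rule Bochner_Integration.integral_cong[OF refl]) (rule sum_transition[OF Y_directions[OF n]])
  finally show ?thesis .
qed

text \<open>From time \<open>2\<close> on the refresh probability is \<open>p\<close> in every dimension.\<close>

definition X :: "nat \<Rightarrow> 'm \<Rightarrow> real ^ 'd" where "X k = Y (k + 2)"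

lemma X_directions: "\<omega> \<in> space M \<Longrightarrow> X k \<omega> \<in> directions"
  unfolding X_def by (rule Y_directions) auto

lemma dep_X [intro]: "j \<le> k \<Longrightarrow> dep (k + 2) (X j)"
  unfolding X_def by (rule dep_Y) auto

lemma markov_X:
  fixes \<Phi> :: "'m \<Rightarrow> real ^ 'd \<Rightarrow> 'b::{banach, second_countable_topology}"
  assumes "\<And>z. dep (k + 2) (\<lambda>\<omega>. \<Phi> \<omega> z)"
  shows "expectation (\<lambda>\<omega>. \<Phi> \<omega> (X (Suc k) \<omega>)) = expectation (\<lambda>\<omega>. (1 - p) *\<^sub>R \<Phi> \<omega> (X k \<omega>) +
    (p / (2 * real CARD('d))) *\<^sub>R (\<Sum>z\<in>directions. \<Phi> \<omega> z))"
proof -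
  have "p = refresh_prob TYPE('d) (\<lambda>_. p) (k + 2)" by (simp add: refresh_prob_def)
  from markov[where \<Phi>=\<Phi>, OF assms _ this] show ?thesis by (simp add: X_def)
qed

text \<open>The uniform law of the first step makes the centred square vanish in mean, and one
  transition only multiplies this mean by a factor.\<close>

lemma expectation_X_0_square: "expectation (\<lambda>\<omega>. (X 0 \<omega> $ i)\<^sup>2 - 1 / real CARD('d)) = 0"
proof -
  let ?a = "\<lambda>z::real^'d. (z $ i)\<^sup>2 - 1 / real CARD('d)"
  have avg: "(\<Sum>z\<in>directions. ?a z) = 0" by (rule sum_directions_square_centred)

  have "expectation (\<lambda>\<omega>. ?a (Y 1 \<omega>)) =
      expectation (\<lambda>\<omega>. \<Sum>z\<in>directions. ?a z * indicator {\<omega> \<in> space M. Y 1 \<omega> = z} \<omega>)"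
  proof (rule Bochner_Integration.integral_cong[OF refl])
    fix \<omega> assume w: "\<omega> \<in> space M"
    have "(\<Sum>z\<in>directions. ?a z * indicator {\<omega> \<in> space M. Y 1 \<omega> = z} \<omega>) =
        (\<Sum>z\<in>directions. if Y 1 \<omega> = z then ?a z else 0)"
      using w by (intro sum.cong) (auto simp: indicator_def)
    also have "\<dots> = ?a (Y 1 \<omega>)"
      using finite_directions Y_directions[OF _ w, of 1] by (subst sum.delta') auto
    finally show "?a (Y 1 \<omega>) = (\<Sum>z\<in>directions. ?a z * indicator {\<omega> \<in> space M. Y 1 \<omega> = z} \<omega>)"
      by simp
  qed
  also have "\<dots> = (\<Sum>z\<in>directions. ?a z * prob {\<omega> \<in> space M. Y 1 \<omega> = z})"
    using events_Y[of 1]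
    by (subst Bochner_Integration.integral_sum) (auto simp: emeasure_eq_measure)
  also have "\<dots> = (\<Sum>z\<in>directions. ?a z * (1 / (2 * real CARD('d))))"
    using steps by (intro sum.cong refl) (simp add: walk_steps_def)
  also have "\<dots> = 0" unfolding sum_distrib_right[symmetric] avg by simp
  finally have 1: "expectation (\<lambda>\<omega>. ?a (Y 1 \<omega>)) = 0" .
  \<comment> \<open>\<open>q\<close> is \<open>p\<close> for d = 1 and 1 for d \<ge> 2; the
    computation treats both cases at once.\<close>
  define q where "q = refresh_prob TYPE('d) (\<lambda>_. p) 1"
  have "expectation (\<lambda>\<omega>. ?a (Y (Suc 1) \<omega>)) = expectation (\<lambda>\<omega>. (1 - q) *\<^sub>R ?a (Y 1 \<omega>) +
      (q / (2 * real CARD('d))) *\<^sub>R (\<Sum>z\<in>directions. ?a z))"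
    by (rule markov[where \<Phi>="\<lambda>\<omega> z. ?a z"]) (auto simp: q_def)
  also have "\<dots> = (1 - q) * expectation (\<lambda>\<omega>. ?a (Y 1 \<omega>))"
    unfolding avg by simp
  finally show ?thesis using 1 by (simp add: X_def numeral_2_eq_2)
qed

text \<open>
  The conditional mean of \<open>X (Suc k)\<close> is \<open>(1 - p) *\<^sub>R X k\<close>; the factor \<open>1 / p\<close> makes the sum of the
  differences \<open>D\<close> follow the walk.
\<close>

definition D :: "nat \<Rightarrow> 'm \<Rightarrow> real ^ 'd" where
  "D k \<omega> = (1 / p) *\<^sub>R (X (Suc k) \<omega> - (1 - p) *\<^sub>R X k \<omega>)"

definition N :: "nat \<Rightarrow> 'm \<Rightarrow> real ^ 'd" where "N k \<omega> = (\<Sum>j<k. D j \<omega>)"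

text \<open>\<open>D j\<close> reaches up to \<open>X (Suc j)\<close>, that is
  \<open>Y (j + 3)\<close>. Hence \<open>N k\<close> is a function of the first \<open>k + 2\<close>
  steps, the index used throughout.\<close>

lemma dep_D [intro]: "j < k \<Longrightarrow> dep (k + 2) (D j)"
  unfolding D_def by (intro dep_ops dep_const dep_X) auto

lemma dep_N [intro]: "j \<le> k \<Longrightarrow> dep (k + 2) (N j)"
  unfolding N_def by (intro dep_sum dep_D) auto

lemma norm_D:
  assumes "\<omega> \<in> space M" shows "norm (D k \<omega>) \<le> 2 / p"
proof -
  have "norm (X (Suc k) \<omega> - (1 - p) *\<^sub>R X k \<omega>) \<le> norm (X (Suc k) \<omega>) + norm ((1 - p) *\<^sub>R X k \<omega>)"
    by (rule norm_triangle_ineq4)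
  also have "\<dots> \<le> 2" using p by (simp add: norm_direction[OF X_directions[OF assms]])
  finally show ?thesis using p by (simp add: D_def divide_right_mono)
qed

text \<open>Since \<open>D k\<close> equals \<open>X k\<close> plus \<open>1 / p\<close> times
  \<open>X (Suc k) - X k\<close>, the sum telescopes: \<open>N k\<close> is the walk with its
  indices shifted plus boundary terms. The two boundary differences contribute \<open>2\<close> and
  \<open>2 / p\<close>.\<close>

lemma walk_N_diff:
  assumes w: "\<omega> \<in> space M" shows "norm (walk Y k \<omega> - N k \<omega>) \<le> 2 + 2 / p"
proof -
  have N: "N k \<omega> = (\<Sum>j<k. X j \<omega>) + (1 / p) *\<^sub>R (X k \<omega> - X 0 \<omega>)"
  proof (induction k)
    case (Suc k)
    have "D k \<omega> = X k \<omega> + (1 / p) *\<^sub>R (X (Suc k) \<omega> - X k \<omega>)"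
      using p by (simp add: D_def algebra_simps)
    then show ?case using Suc by (simp add: N_def algebra_simps)
  qed (simp add: N_def)
  have W: "(\<Sum>j<k. X j \<omega>) = walk Y k \<omega> + Y (Suc k) \<omega> - Y 1 \<omega>"
    by (induction k) (simp_all add: walk_def X_def)
  have "walk Y k \<omega> - N k \<omega> = (Y 1 \<omega> - Y (Suc k) \<omega>) - (1 / p) *\<^sub>R (X k \<omega> - X 0 \<omega>)"
    unfolding N W by simp
  also have "norm \<dots> \<le> norm (Y 1 \<omega> - Y (Suc k) \<omega>) + norm ((1 / p) *\<^sub>R (X k \<omega> - X 0 \<omega>))"
    by (rule norm_triangle_ineq4)
  also have "\<dots> = norm (Y 1 \<omega> - Y (Suc k) \<omega>) + (1 / p) * norm (X k \<omega> - X 0 \<omega>)"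
    using p by simp
  also have "\<dots> \<le> 2 + (1 / p) * 2"
  proof (intro add_mono mult_left_mono)
    show "norm (Y 1 \<omega> - Y (Suc k) \<omega>) \<le> 2"
      using norm_triangle_ineq4[of "Y 1 \<omega>" "Y (Suc k) \<omega>"]
      by (simp add: norm_direction[OF Y_directions[OF _ w]])
    show "norm (X k \<omega> - X 0 \<omega>) \<le> 2"
      using norm_triangle_ineq4[of "X k \<omega>" "X 0 \<omega>"]
      by (simp add: norm_direction[OF X_directions[OF w]])
  qed (use p in auto)
  finally show ?thesis by simp
qed

text \<open>A fresh direction has mean zero, so only the stay probability contributes to the
  conditional mean of the next step, and \<open>D\<close> subtracts exactly this. The values of
  \<open>h\<close> are general because complex exponentials and real powers of the stopped process
  are both inserted later.\<close>

lemma martingale_difference: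
  fixes h :: "'m \<Rightarrow> 'b::{banach, second_countable_topology}"
  assumes "dep (k + 2) h"
  shows "expectation (\<lambda>\<omega>. (u \<bullet> D k \<omega>) *\<^sub>R h \<omega>) = 0"
proof -
  let ?f = "\<lambda>\<omega> z. (u \<bullet> ((1 / p) *\<^sub>R (z - (1 - p) *\<^sub>R X k \<omega>))) *\<^sub>R h \<omega>"
  have "expectation (\<lambda>\<omega>. (u \<bullet> D k \<omega>) *\<^sub>R h \<omega>) = expectation (\<lambda>\<omega>. ?f \<omega> (X (Suc k) \<omega>))"
    by (simp add: D_def)
  also have "\<dots> = expectation (\<lambda>\<omega>. (1 - p) *\<^sub>R ?f \<omega> (X k \<omega>) +
      (p / (2 * real CARD('d))) *\<^sub>R (\<Sum>z\<in>directions. ?f \<omega> z))"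
    by (rule markov_X) (intro dep_ops dep_const dep_X assms order_refl)
  also have "\<dots> = expectation (\<lambda>\<omega>. 0)"
  proof (rule Bochner_Integration.integral_cong[OF refl])
    fix \<omega>
    define x where "x = u \<bullet> X k \<omega>"
    have "(\<Sum>z\<in>directions. u \<bullet> ((1 / p) *\<^sub>R (z - (1 - p) *\<^sub>R X k \<omega>))) =
        (\<Sum>z\<in>directions. (1 / p) * (u \<bullet> z)) - (\<Sum>z\<in>(directions::(real^'d) set). (1 / p) * ((1 - p) * x))"
      unfolding sum_subtractf[symmetric]
      by (rule sum.cong) (simp_all add: x_def inner_diff_right right_diff_distrib)
    also have "\<dots> = - (2 * real CARD('d) / p) * ((1 - p) * x)"
      by (simp add: sum_divide_distrib[symmetric] sum_directions_inner(1) card_directions)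
    finally have s: "(\<Sum>z\<in>directions. u \<bullet> ((1 / p) *\<^sub>R (z - (1 - p) *\<^sub>R X k \<omega>))) =
        - (2 * real CARD('d) / p) * ((1 - p) * x)" .
    have "u \<bullet> ((1 / p) *\<^sub>R (X k \<omega> - (1 - p) *\<^sub>R X k \<omega>)) = x"
      using p by (simp add: x_def inner_diff_right field_simps)
    then show "(1 - p) *\<^sub>R ?f \<omega> (X k \<omega>) + (p / (2 * real CARD('d))) *\<^sub>R (\<Sum>z\<in>directions. ?f \<omega> z) = 0"
      unfolding scaleR_sum_left[symmetric] s
      using p by (simp add: scaleR_add_left[symmetric])
  qed
  finally show ?thesis by simp
qed

text \<open>A refresh averages the centred square to zero, so only the weight \<open>1 - p\<close>
  of repeating the step survives.\<close>

lemma square_centred: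
  fixes h :: "'m \<Rightarrow> 'b::{banach, second_countable_topology}"
  assumes "dep (k + 2) h"
  shows "expectation (\<lambda>\<omega>. ((X (Suc k) \<omega> $ i)\<^sup>2 - 1 / real CARD('d)) *\<^sub>R h \<omega>) =
    (1 - p) *\<^sub>R expectation (\<lambda>\<omega>. ((X k \<omega> $ i)\<^sup>2 - 1 / real CARD('d)) *\<^sub>R h \<omega>)"
proof -
  let ?a = "\<lambda>z::real^'d. (z $ i)\<^sup>2 - 1 / real CARD('d)"
  have avg: "(\<Sum>z\<in>directions. ?a z) = 0" by (rule sum_directions_square_centred)
  have "expectation (\<lambda>\<omega>. ?a (X (Suc k) \<omega>) *\<^sub>R h \<omega>) =
      expectation (\<lambda>\<omega>. (1 - p) *\<^sub>R (?a (X k \<omega>) *\<^sub>R h \<omega>) +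
      (p / (2 * real CARD('d))) *\<^sub>R (\<Sum>z\<in>directions. ?a z *\<^sub>R h \<omega>))"
    by (rule markov_X[where \<Phi>="\<lambda>\<omega> z. ?a z *\<^sub>R h \<omega>"]) (intro dep_ops dep_const assms)
  also have "\<dots> = expectation (\<lambda>\<omega>. (1 - p) *\<^sub>R (?a (X k \<omega>) *\<^sub>R h \<omega>))"
    unfolding scaleR_sum_left[symmetric] avg by simp
  finally show ?thesis unfolding integral_scaleR_right .
qed

text \<open>The cross term of the square vanishes because the directions sum to zero. The result is
  arranged as the asymptotic variance plus the centred squares, the quantities that
  \<open>square_centred\<close> contracts.\<close>

lemma quadratic_variation:
  fixes h :: "'m \<Rightarrow> 'b::{banach, second_countable_topology}"
  assumes h: "dep (k + 2) h"
  shows "expectation (\<lambda>\<omega>. (u \<bullet> D k \<omega>)\<^sup>2 *\<^sub>R h \<omega>) =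
    (((2 - p) / (p * real CARD('d))) * (norm u)\<^sup>2) *\<^sub>R expectation h +
    ((1 - p) / p) *\<^sub>R (\<Sum>i\<in>UNIV. (u $ i)\<^sup>2 *\<^sub>R
      expectation (\<lambda>\<omega>. ((X k \<omega> $ i)\<^sup>2 - 1 / real CARD('d)) *\<^sub>R h \<omega>))"
proof -
  let ?d = "real CARD('d)"
  let ?g = "\<lambda>\<omega> z. (u \<bullet> ((1 / p) *\<^sub>R (z - (1 - p) *\<^sub>R X k \<omega>)))\<^sup>2"
  have sq: "(norm u)\<^sup>2 = (\<Sum>i\<in>UNIV. (u $ i)\<^sup>2)" by (rule norm_square_vec)
  have depa: "dep (k + 2) (\<lambda>\<omega>. ((X k \<omega> $ i)\<^sup>2 - 1 / ?d) *\<^sub>R h \<omega>)" for i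
    by (intro dep_ops(4) h dep_compose[where F="\<lambda>x. (x $ i)\<^sup>2 - 1 / ?d"] dep_X order_refl)
  have "expectation (\<lambda>\<omega>. (u \<bullet> D k \<omega>)\<^sup>2 *\<^sub>R h \<omega>) = expectation (\<lambda>\<omega>. ?g \<omega> (X (Suc k) \<omega>) *\<^sub>R h \<omega>)"
    by (simp add: D_def)
  also have "\<dots> = expectation (\<lambda>\<omega>. (1 - p) *\<^sub>R (?g \<omega> (X k \<omega>) *\<^sub>R h \<omega>) +
      (p / (2 * ?d)) *\<^sub>R (\<Sum>z\<in>directions. ?g \<omega> z *\<^sub>R h \<omega>))"
    by (rule markov_X) (intro dep_ops(4) dep_compose[where F="\<lambda>x. x\<^sup>2"] dep_ops dep_const dep_X h order_refl)
  also have "\<dots> = expectation (\<lambda>\<omega>. (((2 - p) / (p * real CARD('d))) * (norm u)\<^sup>2) *\<^sub>R h \<omega> +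
    ((1 - p) / p) *\<^sub>R (\<Sum>i\<in>UNIV. (u $ i)\<^sup>2 *\<^sub>R (((X k \<omega> $ i)\<^sup>2 - 1 / ?d) *\<^sub>R h \<omega>)))"
  proof (rule Bochner_Integration.integral_cong[OF refl])
    fix \<omega> assume w: "\<omega> \<in> space M"
    define x where "x = u \<bullet> X k \<omega>"
    have x2: "x\<^sup>2 = (\<Sum>i\<in>UNIV. (u $ i)\<^sup>2 * (X k \<omega> $ i)\<^sup>2)"
      unfolding x_def by (rule inner_direction_square[OF X_directions[OF w]])
    have "(\<Sum>z\<in>directions. ?g \<omega> z) =
        (\<Sum>z\<in>directions. (1 / p)\<^sup>2 * (u \<bullet> z)\<^sup>2) - (\<Sum>z\<in>directions. (2 * (1 / p)\<^sup>2 * ((1 - p) * x)) * (u \<bullet> z))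
        + (\<Sum>z\<in>(directions::(real^'d) set). (1 / p)\<^sup>2 * ((1 - p) * x)\<^sup>2)"
      unfolding sum_subtractf[symmetric] sum.distrib[symmetric]
    proof (rule sum.cong[OF refl])
      fix z
      have "u \<bullet> ((1 / p) *\<^sub>R (z - (1 - p) *\<^sub>R X k \<omega>)) = (1 / p) * (u \<bullet> z - (1 - p) * x)"
        by (simp add: x_def inner_diff_right)
      then show "?g \<omega> z = (1 / p)\<^sup>2 * (u \<bullet> z)\<^sup>2 - (2 * (1 / p)\<^sup>2 * ((1 - p) * x)) * (u \<bullet> z)
          + (1 / p)\<^sup>2 * ((1 - p) * x)\<^sup>2"
        by (simp only: power_mult_distrib power2_diff) (simp only: algebra_simps)
    qed
    also have "\<dots> = (1 / p)\<^sup>2 * (2 * (norm u)\<^sup>2 + 2 * ?d * ((1 - p) * x)\<^sup>2)"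
      unfolding sum_distrib_left[symmetric] sum_directions_inner
      by (simp add: card_directions algebra_simps)
    finally have s: "(\<Sum>z\<in>directions. ?g \<omega> z) =
        (1 / p)\<^sup>2 * (2 * (norm u)\<^sup>2 + 2 * ?d * ((1 - p) * x)\<^sup>2)" .
    have g: "?g \<omega> (X k \<omega>) = x\<^sup>2"
      using p by (simp add: x_def inner_diff_right field_simps)
    have v: "(\<Sum>i\<in>UNIV. (u $ i)\<^sup>2 * ((X k \<omega> $ i)\<^sup>2 - 1 / ?d)) = x\<^sup>2 - (norm u)\<^sup>2 / ?d"
      unfolding x2 sq by (simp add: right_diff_distrib sum_subtractf sum_divide_distrib)
    \<comment> \<open>The coefficient of \<open>x^2\<close> is
      \<open>(1 - p) + (1 - p)^2 / p = (1 - p) / p\<close>, and the fresh directions add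
      \<open>norm u ^ 2 / (p * d)\<close>. Writing \<open>x^2\<close> as its mean
      \<open>norm u ^ 2 / d\<close> plus the deviation yields the factor
      \<open>(2 - p) / (p * d)\<close>.\<close>
    have "(1 - p) * x\<^sup>2 + (p / (2 * ?d)) * ((1 / p)\<^sup>2 * (2 * (norm u)\<^sup>2 + 2 * ?d * ((1 - p) * x)\<^sup>2)) =
        ((2 - p) / (p * real CARD('d))) * (norm u)\<^sup>2 + ((1 - p) / p) * (x\<^sup>2 - (norm u)\<^sup>2 / ?d)"
    proof -
      have "(p / (2 * ?d)) * ((1 / p)\<^sup>2 * (2 * (norm u)\<^sup>2 + 2 * ?d * ((1 - p) * x)\<^sup>2)) =
          (norm u)\<^sup>2 / (p * ?d) + (1 - p)\<^sup>2 * x\<^sup>2 / p"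
        using p by (simp add: field_simps power2_eq_square)
      moreover have "(1 - p) * x\<^sup>2 + (1 - p)\<^sup>2 * x\<^sup>2 / p = ((1 - p) / p) * x\<^sup>2"
        using p by (simp add: field_simps power2_eq_square)
      moreover have "((2 - p) / (p * real CARD('d))) * (norm u)\<^sup>2 - ((1 - p) / p) * ((norm u)\<^sup>2 / ?d) =
          (norm u)\<^sup>2 / (p * ?d)"
        using p by (simp add: field_simps)
      ultimately show ?thesis by (simp add: right_diff_distrib)
    qed
    then show "(1 - p) *\<^sub>R (?g \<omega> (X k \<omega>) *\<^sub>R h \<omega>) + (p / (2 * ?d)) *\<^sub>R (\<Sum>z\<in>directions. ?g \<omega> z *\<^sub>R h \<omega>) =
        (((2 - p) / (p * real CARD('d))) * (norm u)\<^sup>2) *\<^sub>R h \<omega> +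
        ((1 - p) / p) *\<^sub>R (\<Sum>i\<in>UNIV. (u $ i)\<^sup>2 *\<^sub>R (((X k \<omega> $ i)\<^sup>2 - 1 / ?d) *\<^sub>R h \<omega>))"
      unfolding scaleR_scaleR scaleR_sum_left[symmetric] s g v scaleR_add_left[symmetric] by simp
  qed
  also have "\<dots> = expectation (\<lambda>\<omega>. (((2 - p) / (p * real CARD('d))) * (norm u)\<^sup>2) *\<^sub>R h \<omega>) +
    expectation (\<lambda>\<omega>. ((1 - p) / p) *\<^sub>R (\<Sum>i\<in>UNIV. (u $ i)\<^sup>2 *\<^sub>R (((X k \<omega> $ i)\<^sup>2 - 1 / ?d) *\<^sub>R h \<omega>)))"
    by (rule Bochner_Integration.integral_add)
      (intro dep_integrable[where n="k + 2"] dep_ops(4) dep_const dep_sum depa h)+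
  also have "\<dots> = (((2 - p) / (p * real CARD('d))) * (norm u)\<^sup>2) *\<^sub>R expectation h +
    ((1 - p) / p) *\<^sub>R (\<Sum>i\<in>UNIV. expectation (\<lambda>\<omega>. (u $ i)\<^sup>2 *\<^sub>R (((X k \<omega> $ i)\<^sup>2 - 1 / ?d) *\<^sub>R h \<omega>)))"
  proof -
    have "expectation (\<lambda>\<omega>. \<Sum>i\<in>UNIV. (u $ i)\<^sup>2 *\<^sub>R (((X k \<omega> $ i)\<^sup>2 - 1 / ?d) *\<^sub>R h \<omega>)) =
        (\<Sum>i\<in>UNIV. expectation (\<lambda>\<omega>. (u $ i)\<^sup>2 *\<^sub>R (((X k \<omega> $ i)\<^sup>2 - 1 / ?d) *\<^sub>R h \<omega>)))"
      by (rule Bochner_Integration.integral_sum)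
        (intro dep_integrable[where n="k + 2"] dep_ops(4)[OF dep_const] depa)
    then show ?thesis by (simp only: integral_scaleR_right)
  qed
  finally show ?thesis by (simp only: integral_scaleR_right)
qed

end

section \<open>Characteristic functions of the martingale part\<close>

lemma exp_minus_approx:
  assumes "0 \<le> (s::real)"
  shows "\<bar>exp (- s) - (1 - s)\<bar> \<le> s\<^sup>2"
proof -
  have "exp (- s) = 1 / exp s" by (simp add: exp_minus divide_inverse)
  also have "\<dots> \<le> 1 / (1 + s)"
    using assms by (intro divide_left_mono) (auto simp: add_pos_nonneg)
  also have "\<dots> \<le> 1 - s + s\<^sup>2"
  proof -
    have "(1 - s + s\<^sup>2) * (1 + s) = 1 + s ^ 3"
      by (simp add: algebra_simps power2_eq_square power3_eq_cube)
    then show ?thesis using assms by (simp add: pos_divide_le_eq)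
  qed
  finally show ?thesis using exp_ge_add_one_self[of "- s"] by simp
qed

lemma cis_approx_0: "cmod (cis t - 1) \<le> \<bar>t\<bar>"
  using iexp_approx1[of t 0] by (simp add: cis_conv_exp)

lemma cis_approx_2: "cmod (cis t - (1 + \<i> * t - t\<^sup>2 / 2)) \<le> \<bar>t\<bar> ^ 3"
proof -
  have "(\<Sum>k\<le>2. (\<i> * complex_of_real t) ^ k / fact k) = 1 + \<i> * t - t\<^sup>2 / 2"
    by (simp add: numeral_2_eq_2 power_mult_distrib)
  then have "cmod (cis t - (1 + \<i> * t - t\<^sup>2 / 2)) \<le> \<bar>t\<bar> ^ Suc 2 / fact (Suc 2)"
    using iexp_approx1[of t 2] by (simp add: cis_conv_exp)
  also have "\<dots> \<le> \<bar>t\<bar> ^ 3 / 1"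
    by (rule frac_le) (simp_all add: eval_nat_numeral)
  finally show ?thesis by simp
qed

context conservative_walk
begin

lemma dep_norm_expectation_le:
  fixes h :: "'m \<Rightarrow> 'b::{banach, second_countable_topology}"
  assumes "dep n h" "\<And>\<omega>. \<omega> \<in> space M \<Longrightarrow> norm (h \<omega>) \<le> c"
  shows "norm (expectation h) \<le> c"
proof -
  have "norm (expectation h) \<le> expectation (\<lambda>\<omega>. norm (h \<omega>))"
    by (rule integral_norm_bound)
  also have "\<dots> \<le> expectation (\<lambda>\<omega>. c)"
    using assms by (intro integral_mono dep_integrable[OF dep_compose[OF assms(1)]]) auto
  finally show ?thesis by (simp add: prob_space)
qed

text \<open>Expand the new factor of \<open>Z (Suc k)\<close> to second order. The linear term
  vanishes by the martingale property; the quadratic one gives the factor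
  \<open>1 - v / 2 * norm (\<theta> k) ^ 2\<close> and a remainder containing the correlations
  \<open>b k i\<close> of centred squares with \<open>Z k\<close>. These are of order
  \<open>\<kappa>\<close> uniformly in \<open>k\<close>, so the remainder is of order
  \<open>\<kappa> ^ 3\<close>, like the Taylor error.\<close>

lemma characteristic_function_step:
  fixes Z :: "nat \<Rightarrow> 'm \<Rightarrow> complex" and \<theta> :: "nat \<Rightarrow> real ^ 'd"
  assumes \<kappa>: "0 \<le> \<kappa>" "\<kappa> \<le> 1" "\<And>k. norm (\<theta> k) \<le> \<kappa>"
  defines "Z \<equiv> \<lambda>k \<omega>. cis (\<Sum>j<k. \<theta> j \<bullet> D j \<omega>)"
  defines "v \<equiv> (2 - p) / (p * real CARD('d))"
  shows "cmod (expectation (Z (Suc k)) - (1 - v / 2 * (norm (\<theta> k))\<^sup>2) * expectation (Z k))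
    \<le> (2 / p ^ 3 + (2 / p) ^ 3) * \<kappa> ^ 3"
proof -
  let ?d = "real CARD('d)"
  let ?a = "\<lambda>k i \<omega>. (X k \<omega> $ i)\<^sup>2 - 1 / ?d"
  define b where "b k i = expectation (\<lambda>\<omega>. ?a k i \<omega> *\<^sub>R Z k \<omega>)" for k i
  have depZ: "dep (k + 2) (Z j)" if "j \<le> k" for j k
    unfolding Z_def using that
    by (intro dep_compose[where F=cis] dep_sum dep_ops(5) dep_const dep_D) auto
  have depa: "dep (k + 2) (?a k i)" for k i
    by (intro dep_compose[where F="\<lambda>x. (x $ i)\<^sup>2 - 1 / ?d"] dep_X order_refl)
  have normZ: "cmod (Z k \<omega>) = 1" for k \<omega> by (simp add: Z_def)
  have abs_a: "\<bar>?a k i \<omega>\<bar> \<le> 1" if "\<omega> \<in> space M" for k i \<omega>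
  proof -
    have "0 \<le> 1 / ?d" "1 / ?d \<le> 1" by simp_all
    moreover have "0 \<le> (X k \<omega> $ i)\<^sup>2" "(X k \<omega> $ i)\<^sup>2 \<le> 1"
      using direction_square_le[OF X_directions[OF that]] by simp_all
    ultimately show ?thesis unfolding abs_le_iff by linarith
  qed
  have t_le: "\<bar>\<theta> k \<bullet> D k \<omega>\<bar> \<le> \<kappa> * (2 / p)" if "\<omega> \<in> space M" for k \<omega>
    using Cauchy_Schwarz_ineq2[of "\<theta> k" "D k \<omega>"] mult_mono[OF \<kappa>(3) norm_D[OF that] \<kappa>(1) norm_ge_zero]
    by (rule order_trans)
  have ZSuc: "Z (Suc k) \<omega> = Z k \<omega> * cis (\<theta> k \<bullet> D k \<omega>)" for k \<omega>
    by (simp add: Z_def cis_mult)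
  \<comment> \<open>The bound is the fixed point of
    \<open>b = (1 - p) * b + 2 * \<kappa> / p\<close>: the correlation contracts by
    \<open>1 - p\<close>, and exchanging \<open>Z k\<close> for \<open>Z (Suc k)\<close> adds at
    most \<open>2 * \<kappa> / p\<close>.\<close>
  have b_le: "cmod (b k i) \<le> 2 * \<kappa> / p\<^sup>2" for k i
  proof (induction k)
    case 0
    have "b 0 i = expectation (?a 0 i) *\<^sub>R 1"
      unfolding b_def Z_def
      by (simp del: scaleR_one add: integral_scaleR_left[OF dep_integrable[OF depa]])
    then show ?case using expectation_X_0_square \<kappa>(1) by simp
  next
    case (Suc k)
    have "b (Suc k) i = expectation (\<lambda>\<omega>. ?a (Suc k) i \<omega> *\<^sub>R Z k \<omega> +
        ?a (Suc k) i \<omega> *\<^sub>R (Z (Suc k) \<omega> - Z k \<omega>))"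
      by (simp add: b_def scaleR_add_right[symmetric])
    also have "\<dots> = expectation (\<lambda>\<omega>. ?a (Suc k) i \<omega> *\<^sub>R Z k \<omega>) +
        expectation (\<lambda>\<omega>. ?a (Suc k) i \<omega> *\<^sub>R (Z (Suc k) \<omega> - Z k \<omega>))"
      by (intro Bochner_Integration.integral_add dep_integrable[where n="Suc k + 2"]
          dep_ops(4)[OF depa] dep_ops(2) depZ) auto
    also have "expectation (\<lambda>\<omega>. ?a (Suc k) i \<omega> *\<^sub>R Z k \<omega>) = (1 - p) *\<^sub>R b k i"
      unfolding b_def by (intro square_centred depZ) simp
    finally have eq: "b (Suc k) i = (1 - p) *\<^sub>R b k i +
        expectation (\<lambda>\<omega>. ?a (Suc k) i \<omega> *\<^sub>R (Z (Suc k) \<omega> - Z k \<omega>))" .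
    have "cmod (b (Suc k) i) \<le> cmod ((1 - p) *\<^sub>R b k i) +
        cmod (expectation (\<lambda>\<omega>. ?a (Suc k) i \<omega> *\<^sub>R (Z (Suc k) \<omega> - Z k \<omega>)))"
      unfolding eq by (rule norm_triangle_ineq)
    also have "\<dots> \<le> (1 - p) * (2 * \<kappa> / p\<^sup>2) + \<kappa> * (2 / p)"
    proof (rule add_mono)
      show "cmod ((1 - p) *\<^sub>R b k i) \<le> (1 - p) * (2 * \<kappa> / p\<^sup>2)"
        using Suc p by (simp only: norm_scaleR) (intro mult_mono, auto)
      show "cmod (expectation (\<lambda>\<omega>. ?a (Suc k) i \<omega> *\<^sub>R (Z (Suc k) \<omega> - Z k \<omega>))) \<le> \<kappa> * (2 / p)"
      proof (rule dep_norm_expectation_le)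
        show "dep (Suc k + 2) (\<lambda>\<omega>. ?a (Suc k) i \<omega> *\<^sub>R (Z (Suc k) \<omega> - Z k \<omega>))"
          by (intro dep_ops(4)[OF depa] dep_ops(2) depZ) auto
        fix \<omega> assume w: "\<omega> \<in> space M"
        have "Z (Suc k) \<omega> - Z k \<omega> = Z k \<omega> * (cis (\<theta> k \<bullet> D k \<omega>) - 1)"
          by (simp add: ZSuc algebra_simps)
        then have "cmod (Z (Suc k) \<omega> - Z k \<omega>) \<le> \<kappa> * (2 / p)"
          using cis_approx_0[of "\<theta> k \<bullet> D k \<omega>"] t_le[OF w, of k] by (simp add: norm_mult normZ)
        then show "cmod (?a (Suc k) i \<omega> *\<^sub>R (Z (Suc k) \<omega> - Z k \<omega>)) \<le> \<kappa> * (2 / p)"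
          using abs_a[OF w, of "Suc k" i]
          by (simp only: norm_scaleR real_norm_def) (metis mult_mono mult_1 norm_ge_zero zero_le_one)
      qed
    qed
    also have "\<dots> = 2 * \<kappa> / p\<^sup>2"
      using p by (simp add: field_simps power2_eq_square)
    finally show ?case .
  qed
  let ?t = "\<lambda>\<omega>. \<theta> k \<bullet> D k \<omega>"
  let ?R = "\<lambda>\<omega>. Z k \<omega> * (cis (?t \<omega>) - (1 + \<i> * ?t \<omega> - (?t \<omega>)\<^sup>2 / 2))"
  have dept: "dep (Suc k + 2) ?t" by (intro dep_ops(5) dep_const dep_D) simp
  have depZ': "dep (Suc k + 2) (Z k)" by (rule depZ) simp
  have depR: "dep (Suc k + 2) ?R"
    by (rule dep_compose2[OF depZ' dept, where F="\<lambda>z t. z * (cis t - (1 + \<i> * t - t\<^sup>2 / 2))"])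
  have int: "integrable M (Z k)" "integrable M (\<lambda>\<omega>. \<i> * (?t \<omega> *\<^sub>R Z k \<omega>))"
    "integrable M (\<lambda>\<omega>. (1 / 2) *\<^sub>R ((?t \<omega>)\<^sup>2 *\<^sub>R Z k \<omega>))" "integrable M ?R"
    by (rule dep_integrable[OF depZ'],
        rule dep_integrable[OF dep_compose2[OF dept depZ', where F="\<lambda>t z. \<i> * (t *\<^sub>R z)"]],
        rule dep_integrable[OF dep_compose2[OF dept depZ', where F="\<lambda>t z. (1 / 2) *\<^sub>R (t\<^sup>2 *\<^sub>R z)"]],
        rule dep_integrable[OF depR])
  have "expectation (Z (Suc k)) = expectation (\<lambda>\<omega>. (Z k \<omega> + \<i> * (?t \<omega> *\<^sub>R Z k \<omega>))
      - (1 / 2) *\<^sub>R ((?t \<omega>)\<^sup>2 *\<^sub>R Z k \<omega>) + ?R \<omega>)"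
    by (rule Bochner_Integration.integral_cong[OF refl])
      (simp add: ZSuc scaleR_conv_of_real algebra_simps)
  also have "\<dots> = expectation (Z k) + \<i> * expectation (\<lambda>\<omega>. ?t \<omega> *\<^sub>R Z k \<omega>)
      - (1 / 2) *\<^sub>R expectation (\<lambda>\<omega>. (?t \<omega>)\<^sup>2 *\<^sub>R Z k \<omega>) + expectation ?R"
    by (simp only: Bochner_Integration.integral_add Bochner_Integration.integral_diff
        Bochner_Integration.integrable_add Bochner_Integration.integrable_diff
        integral_mult_right_zero integral_scaleR_right int)
  also have "expectation (\<lambda>\<omega>. ?t \<omega> *\<^sub>R Z k \<omega>) = 0"
    by (intro martingale_difference depZ) simp
  also have "expectation (\<lambda>\<omega>. (?t \<omega>)\<^sup>2 *\<^sub>R Z k \<omega>) = (v * (norm (\<theta> k))\<^sup>2) *\<^sub>R expectation (Z k) +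
      ((1 - p) / p) *\<^sub>R (\<Sum>i\<in>UNIV. (\<theta> k $ i)\<^sup>2 *\<^sub>R b k i)"
    unfolding b_def v_def by (intro quadratic_variation depZ) simp
  finally have eq: "expectation (Z (Suc k)) = expectation (Z k) + \<i> * 0 - (1 / 2) *\<^sub>R
      ((v * (norm (\<theta> k))\<^sup>2) *\<^sub>R expectation (Z k) +
      ((1 - p) / p) *\<^sub>R (\<Sum>i\<in>UNIV. (\<theta> k $ i)\<^sup>2 *\<^sub>R b k i)) + expectation ?R" .
  have "z + \<i> * 0 - (1 / 2) *\<^sub>R ((v * n) *\<^sub>R z + (\<beta> / p) *\<^sub>R q) + r - (1 - v / 2 * n) * z =
      r - (\<beta> / (2 * p)) *\<^sub>R q" for z q r :: complex and n \<beta> :: real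
    using p by (simp add: scaleR_conv_of_real field_simps)
  note alg = this
  have "expectation (Z (Suc k)) - (1 - v / 2 * (norm (\<theta> k))\<^sup>2) * expectation (Z k) =
      expectation ?R - ((1 - p) / (2 * p)) *\<^sub>R (\<Sum>i\<in>UNIV. (\<theta> k $ i)\<^sup>2 *\<^sub>R b k i)"
    unfolding eq by (rule alg)
  then have "cmod (expectation (Z (Suc k)) - (1 - v / 2 * (norm (\<theta> k))\<^sup>2) * expectation (Z k)) =
      cmod (expectation ?R - ((1 - p) / (2 * p)) *\<^sub>R (\<Sum>i\<in>UNIV. (\<theta> k $ i)\<^sup>2 *\<^sub>R b k i))"
    by (rule arg_cong)
  also have "\<dots> \<le> cmod (expectation ?R) + cmod (((1 - p) / (2 * p)) *\<^sub>R (\<Sum>i\<in>UNIV. (\<theta> k $ i)\<^sup>2 *\<^sub>R b k i))"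
    by (rule norm_triangle_ineq4)
  \<comment> \<open>The first summand is the Taylor remainder with
    \<open>\<bar>\<theta> k \<bullet> D k\<bar> \<le> 2 * \<kappa> / p\<close>. The second uses that
    the squared coordinates of \<open>\<theta> k\<close> sum to at most
    \<open>\<kappa>^2\<close>.\<close>
  also have "\<dots> \<le> (\<kappa> * (2 / p)) ^ 3 + (1 / p) * (\<kappa>\<^sup>2 * (2 * \<kappa> / p\<^sup>2))"
  proof (rule add_mono)
    show "cmod (expectation ?R) \<le> (\<kappa> * (2 / p)) ^ 3"
    proof (rule dep_norm_expectation_le)
      show "dep (Suc k + 2) ?R" by (rule depR)
      fix \<omega> assume w: "\<omega> \<in> space M"
      have "cmod (?R \<omega>) = cmod (cis (?t \<omega>) - (1 + \<i> * ?t \<omega> - (?t \<omega>)\<^sup>2 / 2))"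
        by (simp only: norm_mult normZ mult_1)
      also have "\<dots> \<le> \<bar>?t \<omega>\<bar> ^ 3" by (rule cis_approx_2)
      also have "\<dots> \<le> (\<kappa> * (2 / p)) ^ 3" by (rule power_mono[OF t_le[OF w]]) simp
      finally show "cmod (?R \<omega>) \<le> (\<kappa> * (2 / p)) ^ 3" .
    qed
    have "cmod (\<Sum>i\<in>UNIV. (\<theta> k $ i)\<^sup>2 *\<^sub>R b k i) \<le> (\<Sum>i\<in>UNIV. (\<theta> k $ i)\<^sup>2 * (2 * \<kappa> / p\<^sup>2))"
    proof (rule sum_norm_le)
      fix i
      have "cmod ((\<theta> k $ i)\<^sup>2 *\<^sub>R b k i) = (\<theta> k $ i)\<^sup>2 * cmod (b k i)" by simp
      also have "\<dots> \<le> (\<theta> k $ i)\<^sup>2 * (2 * \<kappa> / p\<^sup>2)" by (rule mult_left_mono[OF b_le]) simp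
      finally show "cmod ((\<theta> k $ i)\<^sup>2 *\<^sub>R b k i) \<le> (\<theta> k $ i)\<^sup>2 * (2 * \<kappa> / p\<^sup>2)" .
    qed
    also have "\<dots> = (norm (\<theta> k))\<^sup>2 * (2 * \<kappa> / p\<^sup>2)"
      by (simp only: norm_square_vec sum_distrib_right)
    also have "\<dots> \<le> \<kappa>\<^sup>2 * (2 * \<kappa> / p\<^sup>2)"
      using \<kappa> by (intro mult_right_mono power_mono) auto
    finally have "cmod (\<Sum>i\<in>UNIV. (\<theta> k $ i)\<^sup>2 *\<^sub>R b k i) \<le> \<kappa>\<^sup>2 * (2 * \<kappa> / p\<^sup>2)" .
    moreover have "\<bar>(1 - p) / (2 * p)\<bar> \<le> 1 / p" using p by (simp add: field_simps)
    ultimately show "cmod (((1 - p) / (2 * p)) *\<^sub>R (\<Sum>i\<in>UNIV. (\<theta> k $ i)\<^sup>2 *\<^sub>R b k i)) \<le>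
        (1 / p) * (\<kappa>\<^sup>2 * (2 * \<kappa> / p\<^sup>2))"
      unfolding norm_scaleR using p by (intro mult_mono) auto
  qed
  also have "\<dots> = (2 / p ^ 3 + (2 / p) ^ 3) * \<kappa> ^ 3"
    using p by (simp add: field_simps power2_eq_square power3_eq_cube)
  finally show ?thesis by simp
qed

text \<open>Replace the step factors by exponentials one at a time. The errors add up without
  growing, because the exponential factors are at most 1 and the characteristic functions have
  modulus at most 1. With \<open>\<kappa>\<close> of order \<open>1 / sqrt n\<close> and
  \<open>K\<close> of order \<open>n\<close>, the total is of order
  \<open>1 / sqrt n\<close>.\<close>

lemma characteristic_function_approx:
  fixes \<theta> :: "nat \<Rightarrow> real ^ 'd"
  defines "v \<equiv> (2 - p) / (p * real CARD('d))"
  assumes \<kappa>: "0 \<le> \<kappa>" "\<kappa> \<le> 1" "\<And>k. norm (\<theta> k) \<le> \<kappa>"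
  shows "cmod (expectation (\<lambda>\<omega>. cis (\<Sum>k<K. \<theta> k \<bullet> D k \<omega>)) - exp (- (v / 2 * (\<Sum>k<K. (norm (\<theta> k))\<^sup>2))))
    \<le> (2 / p ^ 3 + (2 / p) ^ 3 + v\<^sup>2) * \<kappa> ^ 3 * real K"
proof (induction K)
  case 0
  then show ?case by (simp add: prob_space)
next
  case (Suc k)
  define s where "s = v / 2 * (norm (\<theta> k))\<^sup>2"
  define e where "e k = expectation (\<lambda>\<omega>. cis (\<Sum>j<k. \<theta> j \<bullet> D j \<omega>))" for k
  define E where "E k = exp (- (v / 2 * (\<Sum>j<k. (norm (\<theta> j))\<^sup>2)))" for k
  have v: "v \<ge> 0" using p by (simp add: v_def)
  have s: "0 \<le> s" using v by (simp add: s_def)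
  have "s \<le> v * \<kappa>\<^sup>2"
  proof -
    have "(norm (\<theta> k))\<^sup>2 \<le> \<kappa>\<^sup>2" using \<kappa> by (intro power_mono) auto
    then have "v / 2 * (norm (\<theta> k))\<^sup>2 \<le> v * \<kappa>\<^sup>2" using v by (intro mult_mono) auto
    then show ?thesis by (simp add: s_def)
  qed
  then have "s\<^sup>2 \<le> (v * \<kappa>\<^sup>2)\<^sup>2" using s by (rule power_mono)
  also have "\<dots> = v\<^sup>2 * (\<kappa> ^ 3 * \<kappa>)" by (simp add: power_mult_distrib power2_eq_square power3_eq_cube)
  \<comment> \<open>\<open>\<kappa> \<le> 1\<close> lowers the fourth power to the third, so that
    all errors have the same form.\<close>
  also have "\<dots> \<le> v\<^sup>2 * (\<kappa> ^ 3 * 1)" using \<kappa> by (intro mult_left_mono) auto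
  finally have s2: "s\<^sup>2 \<le> v\<^sup>2 * \<kappa> ^ 3" by simp
  have E: "E (Suc k) = exp (- s) * E k"
    by (simp add: E_def s_def exp_add[symmetric] algebra_simps)
  have e1: "cmod (e k) \<le> 1"
    unfolding e_def
    by (rule dep_norm_expectation_le[where n="k + 2"])
      (intro dep_compose[where F=cis] dep_sum dep_ops(5) dep_const dep_D, auto)
  have "e (Suc k) - E (Suc k) = (e (Suc k) - (1 - s) * e k) + (1 - s - exp (- s)) * e k
      + exp (- s) * (e k - E k)"
    by (simp add: E algebra_simps)
  also have "cmod \<dots> \<le> cmod (e (Suc k) - (1 - s) * e k) + cmod ((1 - s - exp (- s)) * e k)
      + cmod (exp (- s) * (e k - E k))"
    by (intro norm_triangle_mono order_refl)
  also have "\<dots> \<le> (2 / p ^ 3 + (2 / p) ^ 3) * \<kappa> ^ 3 + v\<^sup>2 * \<kappa> ^ 3 +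
      (2 / p ^ 3 + (2 / p) ^ 3 + v\<^sup>2) * \<kappa> ^ 3 * real k"
  proof (intro add_mono)
    show "cmod (e (Suc k) - (1 - s) * e k) \<le> (2 / p ^ 3 + (2 / p) ^ 3) * \<kappa> ^ 3"
      using characteristic_function_step[OF \<kappa>, where k=k] unfolding e_def s_def v_def by simp
    have "cmod ((1 - s - exp (- s)) * e k) = \<bar>exp (- s) - (1 - s)\<bar> * cmod (e k)"
    proof -
      have "(1 - s - exp (- s)) * e k = complex_of_real (1 - s - exp (- s)) * e k" by simp
      then show ?thesis by (simp only: norm_mult norm_of_real abs_minus_commute)
    qed
    also have "\<dots> \<le> s\<^sup>2 * 1" using exp_minus_approx[OF s] e1 by (intro mult_mono) auto
    finally show "cmod ((1 - s - exp (- s)) * e k) \<le> v\<^sup>2 * \<kappa> ^ 3" using s2 by simp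
    have "cmod (exp (- s) * (e k - E k)) = exp (- s) * cmod (e k - E k)"
      by (simp only: norm_mult norm_of_real) simp
    also have "\<dots> \<le> 1 * cmod (e k - E k)" using s by (intro mult_right_mono) auto
    finally show "cmod (exp (- s) * (e k - E k)) \<le>
        (2 / p ^ 3 + (2 / p) ^ 3 + v\<^sup>2) * \<kappa> ^ 3 * real k"
      using Suc.IH unfolding e_def E_def by simp
  qed
  also have "\<dots> = (2 / p ^ 3 + (2 / p) ^ 3 + v\<^sup>2) * \<kappa> ^ 3 * real (Suc k)"
  proof -
    have "A * x + B * x + (A + B) * x * y = (A + B) * x * (1 + y)" for A B x y :: real
      by (simp add: algebra_simps)
    then show ?thesis by (simp only: of_nat_Suc)
  qed
  finally show ?case unfolding e_def E_def .
qed

section \<open>A maximal inequality\<close>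

text \<open>
  The martingale is stopped when it leaves \<open>(- l, l)\<close>; the stopped process has the same fourth moment
  bound, and its final value records whether the level was reached.
\<close>

lemma maximal_inequality:
  assumes u: "norm u \<le> 1" and l: "0 < l"
  shows "prob {\<omega> \<in> space M. \<exists>k\<le>K. l \<le> \<bar>u \<bullet> (N (a + k) \<omega> - N a \<omega>)\<bar>} \<le>
    4 * (2 / p) ^ 4 * (real K)\<^sup>2 / l ^ 4"
proof -
  define c where "c = 2 / p"
  have c: "c > 0" using p by (simp add: c_def)
  let ?x = "\<lambda>k \<omega>. u \<bullet> D (a + k) \<omega>"
  define T where "T k \<omega> = rec_nat 0 (\<lambda>k t. if l \<le> \<bar>t\<bar> then t else t + ?x k \<omega>) k" for k \<omega>
  have T0: "T 0 \<omega> = 0" for \<omega> by (simp add: T_def)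
  have TSuc: "T (Suc k) \<omega> = (if l \<le> \<bar>T k \<omega>\<bar> then T k \<omega> else T k \<omega> + ?x k \<omega>)" for k \<omega>
    by (simp add: T_def)
  \<comment> \<open>The indicator that the process still runs. It is a function of
    \<open>T k\<close>, so it may multiply a martingale difference without destroying the mean
    zero.\<close>
  define g where "g k \<omega> = (if l \<le> \<bar>T k \<omega>\<bar> then 0 else 1 :: real)" for k \<omega>
  have x_le: "\<bar>?x k \<omega>\<bar> \<le> c" if "\<omega> \<in> space M" for k \<omega>
  proof -
    have "\<bar>?x k \<omega>\<bar> \<le> norm u * norm (D (a + k) \<omega>)" by (rule Cauchy_Schwarz_ineq2)
    also have "\<dots> \<le> 1 * c" using u norm_D[OF that] by (intro mult_mono) (auto simp: c_def)
    finally show ?thesis by simp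
  qed
  have depx: "dep (a + Suc k + 2) (?x k)" for k
    by (intro dep_ops(5) dep_const dep_D) simp
  have depT: "dep (a + k + 2) (T k)" for k
  proof (induction k)
    case (Suc k)
    have "dep (a + Suc k + 2) (T k)" using Suc by (rule dep_mono) simp
    from dep_compose2[OF this depx, where F="\<lambda>t x. if l \<le> \<bar>t\<bar> then t else t + x"]
    show ?case unfolding TSuc .
  qed (simp add: T0)
  have depT': "dep (a + Suc k + 2) (T k)" for k using depT by (rule dep_mono) simp
  have mart: "expectation (\<lambda>\<omega>. ?x k \<omega> * (g k \<omega> * T k \<omega> ^ r)) = 0" for k r
  proof -
    have "dep (a + k + 2) (\<lambda>\<omega>. g k \<omega> * T k \<omega> ^ r)"
      unfolding g_def by (rule dep_compose[OF depT, where F="\<lambda>t. (if l \<le> \<bar>t\<bar> then 0 else 1) * t ^ r"])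
    from martingale_difference[OF this, of u] show ?thesis by simp
  qed
  have int_mart: "integrable M (\<lambda>\<omega>. ?x k \<omega> * (g k \<omega> * T k \<omega> ^ r))" for k r
    unfolding g_def
    by (rule dep_integrable[OF dep_compose2[OF depx depT',
          where F="\<lambda>x t. x * ((if l \<le> \<bar>t\<bar> then 0 else 1) * t ^ r)"]])
  have int_T: "integrable M (\<lambda>\<omega>. T k \<omega> ^ r)" for k r
    by (rule dep_integrable[OF dep_compose[OF depT]])
  have second: "expectation (\<lambda>\<omega>. T k \<omega> ^ 2) \<le> c\<^sup>2 * real k" for k
  proof (induction k)
    case (Suc k)
    have "expectation (\<lambda>\<omega>. T (Suc k) \<omega> ^ 2) \<le>
        expectation (\<lambda>\<omega>. T k \<omega> ^ 2 + 2 * (?x k \<omega> * (g k \<omega> * T k \<omega> ^ 1)) + c\<^sup>2)"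
    proof (rule integral_mono)
      fix \<omega> assume w: "\<omega> \<in> space M"
      have "(?x k \<omega>)\<^sup>2 \<le> c\<^sup>2" using x_le[OF w, of k] c by (metis abs_le_square_iff abs_of_pos)
      then show "T (Suc k) \<omega> ^ 2 \<le> T k \<omega> ^ 2 + 2 * (?x k \<omega> * (g k \<omega> * T k \<omega> ^ 1)) + c\<^sup>2"
        unfolding TSuc g_def by (simp add: power2_sum algebra_simps)
    qed (intro int_T Bochner_Integration.integrable_add integrable_mult_right int_mart
        integrable_const)+
    also have "\<dots> = expectation (\<lambda>\<omega>. T k \<omega> ^ 2) + 2 * expectation (\<lambda>\<omega>. ?x k \<omega> * (g k \<omega> * T k \<omega> ^ 1)) + c\<^sup>2"
      using int_T[of k 2] int_mart[of k 1] by (simp add: prob_space)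
    finally show ?case using Suc mart[of k 1] by (simp add: algebra_simps)
  qed (simp add: T0)
  \<comment> \<open>The constant 4 closes the induction: one step adds at most
    \<open>8 * c ^ 4 * k + 3 * c ^ 4\<close>, and
    \<open>4 * k^2 + 8 * k + 3 \<le> 4 * (k + 1)^2\<close>.\<close>
  have fourth: "expectation (\<lambda>\<omega>. T k \<omega> ^ 4) \<le> 4 * c ^ 4 * (real k)\<^sup>2" for k
  proof (induction k)
    case (Suc k)
    have "expectation (\<lambda>\<omega>. T (Suc k) \<omega> ^ 4) \<le>
        expectation (\<lambda>\<omega>. T k \<omega> ^ 4 + 4 * (?x k \<omega> * (g k \<omega> * T k \<omega> ^ 3)) + 8 * c\<^sup>2 * T k \<omega> ^ 2 + 3 * c ^ 4)"
    proof (rule integral_mono)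
      fix \<omega> assume w: "\<omega> \<in> space M"
      define t x where "t = T k \<omega>" and "x = ?x k \<omega>"
      have x2: "x\<^sup>2 \<le> c\<^sup>2"
        using x_le[OF w, of k] c unfolding x_def by (metis abs_le_square_iff abs_of_pos)
      then have x4: "x ^ 4 \<le> c ^ 4"
        using power_mono[OF x2, of 2] by (simp add: power_mult[symmetric])
      have tx: "t\<^sup>2 * x\<^sup>2 \<le> c\<^sup>2 * t\<^sup>2" using mult_left_mono[OF x2, of "t\<^sup>2"] by (simp add: mult.commute)
      have "(t + x) ^ 4 = t ^ 4 + 4 * (x * t ^ 3) + 6 * (t\<^sup>2 * x\<^sup>2) + 4 * (t * x ^ 3) + x ^ 4"
        by (simp add: power4_eq_xxxx power2_eq_square power3_eq_cube algebra_simps)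
      \<comment> \<open>The term cubic in the increment has no vanishing mean; it is split between
        its two neighbours, which turns the coefficients 6 and 1 into 8 and 3.\<close>
      moreover have "4 * (t * x ^ 3) \<le> 2 * (t\<^sup>2 * x\<^sup>2) + 2 * x ^ 4"
      proof -
        have "0 \<le> 2 * (t * x - x\<^sup>2)\<^sup>2" by simp
        also have "\<dots> = 2 * (t\<^sup>2 * x\<^sup>2) + 2 * x ^ 4 - 4 * (t * x ^ 3)"
          by (simp add: power4_eq_xxxx power2_eq_square power3_eq_cube algebra_simps)
        finally show ?thesis by simp
      qed
      ultimately have "(t + x) ^ 4 \<le> t ^ 4 + 4 * (x * t ^ 3) + 8 * c\<^sup>2 * t\<^sup>2 + 3 * c ^ 4"
        using tx x4 by linarith
      moreover have "0 \<le> 8 * c\<^sup>2 * t\<^sup>2 + 3 * c ^ 4" by simp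
      ultimately show "T (Suc k) \<omega> ^ 4 \<le> T k \<omega> ^ 4 + 4 * (?x k \<omega> * (g k \<omega> * T k \<omega> ^ 3)) +
          8 * c\<^sup>2 * T k \<omega> ^ 2 + 3 * c ^ 4"
        unfolding TSuc g_def t_def[symmetric] x_def[symmetric] by simp
    qed (intro int_T Bochner_Integration.integrable_add integrable_mult_right int_mart
        integrable_const)+
    also have "\<dots> = expectation (\<lambda>\<omega>. T k \<omega> ^ 4) + 4 * expectation (\<lambda>\<omega>. ?x k \<omega> * (g k \<omega> * T k \<omega> ^ 3))
        + 8 * c\<^sup>2 * expectation (\<lambda>\<omega>. T k \<omega> ^ 2) + 3 * c ^ 4"
      using int_T[of k 2] int_T[of k 4] int_mart[of k 3] by (simp add: prob_space)
    also have "\<dots> \<le> 4 * c ^ 4 * (real k)\<^sup>2 + 0 + 8 * c\<^sup>2 * (c\<^sup>2 * real k) + 3 * c ^ 4"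
      using Suc mart[of k 3] second[of k] by (intro add_mono mult_left_mono) auto
    also have "\<dots> = c ^ 4 * (4 * (real k)\<^sup>2 + 8 * real k + 3)"
      by (simp add: algebra_simps power4_eq_xxxx power2_eq_square)
    also have "\<dots> \<le> c ^ 4 * (4 * (real (Suc k))\<^sup>2)"
      by (intro mult_left_mono) (simp_all add: power2_eq_square algebra_simps)
    finally show ?case by (simp add: algebra_simps)
  qed (simp add: T0)
  have reached: "l \<le> \<bar>T K \<omega>\<bar>" if "\<exists>k\<le>K. l \<le> \<bar>u \<bullet> (N (a + k) \<omega> - N a \<omega>)\<bar>" for \<omega>
  proof -
    \<comment> \<open>Invariant: either the process has stopped at or beyond the level, or it still
      agrees with the projected increment of \<open>N\<close> and no earlier value has reached the
      level.\<close>
    have "l \<le> \<bar>T k \<omega>\<bar> \<or> (T k \<omega> = u \<bullet> (N (a + k) \<omega> - N a \<omega>) \<and>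
        (\<forall>j\<le>k. \<bar>u \<bullet> (N (a + j) \<omega> - N a \<omega>)\<bar> < l))" for k
    proof (induction k)
      case 0
      then show ?case using l by (simp add: T0)
    next
      case (Suc k)
      have "N (a + Suc k) \<omega> = N (a + k) \<omega> + D (a + k) \<omega>" by (simp add: N_def)
      then show ?case using Suc
        by (auto simp: TSuc le_Suc_eq inner_diff_right inner_add_right not_le)
    qed
    from this[of K] that show ?thesis by (auto simp: not_le[symmetric])
  qed
  have "prob {\<omega> \<in> space M. \<exists>k\<le>K. l \<le> \<bar>u \<bullet> (N (a + k) \<omega> - N a \<omega>)\<bar>} \<le>
      prob {\<omega> \<in> space M. l ^ 4 \<le> T K \<omega> ^ 4}"
  proof (rule finite_measure_mono)
    show "{\<omega> \<in> space M. l ^ 4 \<le> T K \<omega> ^ 4} \<in> events"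
      by (rule dep_events[OF dep_compose[OF depT, where F="\<lambda>t. l ^ 4 \<le> t ^ 4"]])
    have "l ^ 4 \<le> T K \<omega> ^ 4" if "l \<le> \<bar>T K \<omega>\<bar>" for \<omega>
      using power_mono[OF that, of 4] l by simp
    then show "{\<omega> \<in> space M. \<exists>k\<le>K. l \<le> \<bar>u \<bullet> (N (a + k) \<omega> - N a \<omega>)\<bar>} \<subseteq>
        {\<omega> \<in> space M. l ^ 4 \<le> T K \<omega> ^ 4}"
      using reached by blast
  qed
  also have "\<dots> \<le> expectation (\<lambda>\<omega>. T K \<omega> ^ 4) / l ^ 4"
    by (rule integral_Markov_inequality_measure[where A="{}"]) (use int_T l in auto)
  also have "\<dots> \<le> 4 * c ^ 4 * (real K)\<^sup>2 / l ^ 4"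
    using fourth l by (intro divide_right_mono) auto
  finally show ?thesis by (simp add: c_def)
qed

text \<open>If the norm reaches \<open>l\<close>, some coordinate reaches \<open>l / d\<close>. The
  union over coordinates contributes one factor \<open>d\<close>, the lowered level another
  \<open>d ^ 4\<close>.\<close>

lemma maximal_inequality_norm:
  assumes l: "0 < l"
  shows "prob {\<omega> \<in> space M. \<exists>k\<le>K. l \<le> norm (N (a + k) \<omega> - N a \<omega>)} \<le>
    4 * (2 / p) ^ 4 * real CARD('d) ^ 5 * (real K)\<^sup>2 / l ^ 4"
proof -
  let ?d = "real CARD('d)"
  let ?A = "\<lambda>i. {\<omega> \<in> space M. \<exists>k\<le>K. l / ?d \<le> \<bar>axis i 1 \<bullet> (N (a + k) \<omega> - N a \<omega>)\<bar>}"
  have A: "?A i \<in> events" for i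
  proof (rule dep_events)
    show "dep (a + K + 2) (\<lambda>\<omega>. \<exists>k\<le>K. l / ?d \<le> \<bar>axis i 1 \<bullet> (N (a + k) \<omega> - N a \<omega>)\<bar>)"
    proof -
      have "dep (a + K + 2) (\<lambda>\<omega>. l / ?d \<le> \<bar>axis i 1 \<bullet> (N (a + k) \<omega> - N a \<omega>)\<bar>)" if "k \<le> K" for k
        using that
        by (intro dep_compose2[OF dep_N dep_N, where F="\<lambda>x y. l / ?d \<le> \<bar>axis i 1 \<bullet> (x - y)\<bar>"]) auto
      then show ?thesis unfolding dep_def by (intro ballI impI) (simp, metis)
    qed
  qed
  have "prob {\<omega> \<in> space M. \<exists>k\<le>K. l \<le> norm (N (a + k) \<omega> - N a \<omega>)} \<le> prob (\<Union>i\<in>UNIV. ?A i)"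
  proof (rule finite_measure_mono)
    show "(\<Union>i\<in>UNIV. ?A i) \<in> events" by (rule sets.finite_UN[OF finite A])
    have "\<exists>i. l / ?d \<le> \<bar>axis i 1 \<bullet> y\<bar>" if "l \<le> norm y" for y :: "real ^ 'd"
    proof (rule ccontr)
      assume "\<not> ?thesis"
      then have "\<bar>y $ i\<bar> < l / ?d" for i
        by (simp add: not_le inner_commute[of "axis _ _"] inner_axis)
      then have "(\<Sum>i\<in>UNIV. \<bar>y $ i\<bar>) < (\<Sum>i\<in>(UNIV::'d set). l / ?d)"
        by (intro sum_strict_mono) auto
      then show False using norm_le_l1_cart[of y] that by simp
    qed
    then show "{\<omega> \<in> space M. \<exists>k\<le>K. l \<le> norm (N (a + k) \<omega> - N a \<omega>)} \<subseteq> (\<Union>i\<in>UNIV. ?A i)"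
      by blast
  qed
  also have "\<dots> \<le> (\<Sum>i\<in>UNIV. prob (?A i))"
    by (rule finite_measure_subadditive_finite[OF finite]) (use A in blast)
  also have "\<dots> \<le> (\<Sum>i\<in>(UNIV::'d set). 4 * (2 / p) ^ 4 * (real K)\<^sup>2 / (l / ?d) ^ 4)"
    using l by (intro sum_mono maximal_inequality) (auto simp: norm_axis_1)
  also have "\<dots> = 4 * (2 / p) ^ 4 * ?d ^ 5 * (real K)\<^sup>2 / l ^ 4"
    using l by (simp add: power_divide field_simps eval_nat_numeral)
  finally show ?thesis .
qed

end

section \<open>Polygonal paths\<close>

text \<open>Both ends are included: at the right end the floor jumps, yet the formulas of the two
  adjacent cells agree there. Later arguments may therefore use either cell at a vertex.\<close>

lemma linear_interpolation_on:
  assumes "real k \<le> t" "t \<le> real k + 1"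
  shows "linear_interpolation s t = (1 - (t - real k)) *\<^sub>R s k + (t - real k) *\<^sub>R s (Suc k)"
proof (cases "t < real k + 1")
  case True
  then have "\<lfloor>t\<rfloor> = int k" using assms by (simp add: floor_unique)
  then show ?thesis by (simp add: linear_interpolation_def frac_def)
next
  case False
  with assms have t: "t = real (Suc k)" by simp
  have "\<lfloor>real (Suc k)\<rfloor> = int (Suc k)" by (rule floor_of_nat)
  then have "linear_interpolation s (real (Suc k)) = s (Suc k)"
    by (simp add: linear_interpolation_def frac_def del: of_nat_Suc)
  then show ?thesis unfolding t by simp
qed

lemma real_in_unit_interval:
  assumes "0 \<le> (t::real)"
  obtains k where "real k \<le> t" "t \<le> real k + 1"
  using that[of "nat \<lfloor>t\<rfloor>"] assms by linarith



lemma continuous_on_linear_interpolation: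
  fixes s :: "nat \<Rightarrow> 'a::real_normed_vector"
  shows "continuous_on {0..} (linear_interpolation s)"
proof -
  have initial: "continuous_on {0..real K} (linear_interpolation s)" for K
  proof (induction K)
    case (Suc K)
    have "continuous_on {real K..real (Suc K)}
        (\<lambda>t. (1 - (t - real K)) *\<^sub>R s K + (t - real K) *\<^sub>R s (Suc K))"
      by (intro continuous_intros)
    then have "continuous_on {real K..real (Suc K)} (linear_interpolation s)"
      by (rule continuous_on_eq) (rule linear_interpolation_on[symmetric], auto)
    then have "continuous_on ({0..real K} \<union> {real K..real (Suc K)}) (linear_interpolation s)"
      using Suc by (intro continuous_on_closed_Un) auto
    moreover have "{0..real K} \<union> {real K..real (Suc K)} = {0..real (Suc K)}" by auto
    ultimately show ?case by simp
  qed simp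
  show ?thesis
    unfolding continuous_on_eq_continuous_within
  proof
    fix t :: real assume t: "t \<in> {0..}"
    obtain K where K: "t < real K" using reals_Archimedean2 by blast
    have "at t within {0..} = at t within {0..real K}"
      by (rule at_within_nhd[of _ "{..<real K}"]) (use K in auto)
    moreover have "continuous (at t within {0..real K}) (linear_interpolation s)"
      using initial[of K] t K unfolding continuous_on_eq_continuous_within by auto
    ultimately show "continuous (at t within {0..}) (linear_interpolation s)" by simp
  qed
qed

lemma convex_combination_dist_le:
  fixes a b :: "'a::real_normed_vector"
  assumes "norm (a - a') \<le> \<delta>" "norm (b - b') \<le> \<delta>" "0 \<le> l" "l \<le> 1"
  shows "norm (((1 - l) *\<^sub>R a + l *\<^sub>R b) - ((1 - l) *\<^sub>R a' + l *\<^sub>R b')) \<le> \<delta>"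
proof -
  have "((1 - l) *\<^sub>R a + l *\<^sub>R b) - ((1 - l) *\<^sub>R a' + l *\<^sub>R b') =
      (1 - l) *\<^sub>R (a - a') + l *\<^sub>R (b - b')"
    by (simp add: algebra_simps)
  also have "norm \<dots> \<le> (1 - l) * norm (a - a') + l * norm (b - b')"
    using assms by (intro order_trans[OF norm_triangle_ineq]) simp
  also have "\<dots> \<le> (1 - l) * \<delta> + l * \<delta>"
    using assms by (intro add_mono mult_left_mono) auto
  finally show ?thesis by (simp add: algebra_simps)
qed

text \<open>At \<open>t = K\<close> the chosen cell may be the one starting at \<open>K\<close>,
  which involves the vertex \<open>Suc K\<close>.\<close>

lemma dist_linear_interpolation_le:
  fixes s s' :: "nat \<Rightarrow> 'a::real_normed_vector"
  assumes t: "0 \<le> t" "t \<le> real K" and le: "\<And>k. k \<le> Suc K \<Longrightarrow> norm (s k - s' k) \<le> \<delta>"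
  shows "dist (linear_interpolation s t) (linear_interpolation s' t) \<le> \<delta>"
proof -
  obtain k where k: "real k \<le> t" "t \<le> real k + 1" by (rule real_in_unit_interval[OF t(1)])
  with t have "k \<le> K" by linarith
  then show ?thesis
    unfolding dist_norm linear_interpolation_on[OF k]
    using k by (intro convex_combination_dist_le le) auto
qed

text \<open>The vertex \<open>s k\<close> sits at time \<open>k / m\<close>, for
  \<open>m > 0\<close>. The restriction makes the function the extensional representative demanded
  by \<open>paths\<close>.\<close>

definition polygon :: "nat \<Rightarrow> (nat \<Rightarrow> 'a::real_normed_vector) \<Rightarrow> real \<Rightarrow> 'a" where
  "polygon m s = restrict (\<lambda>t. linear_interpolation s (real m * t)) {0..}"

lemma polygon_in_paths: "polygon m s \<in> paths"
proof -
  have "continuous_on {0..} (\<lambda>t. linear_interpolation s (real m * t))"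
    by (rule continuous_on_compose2[OF continuous_on_linear_interpolation])
      (auto intro!: continuous_intros)
  then have "continuous_on {0..} (polygon m s)"
    by (rule continuous_on_eq) (simp add: polygon_def)
  then show ?thesis by (simp add: paths_def polygon_def)
qed

lemma path_lipschitz_polygon:
  assumes g: "path_lipschitz L (real T) g" and "0 \<le> \<delta>"
    and "\<And>k. k \<le> Suc (m * T) \<Longrightarrow> norm (s k - s' k) \<le> \<delta>"
  shows "\<bar>g (polygon m s) - g (polygon m s')\<bar> \<le> L * \<delta>"
proof (rule path_lipschitzD[OF g polygon_in_paths polygon_in_paths \<open>0 \<le> \<delta>\<close>])
  fix t assume t: "t \<in> {0..real T}"
  then have "real m * t \<le> real m * real T" by (intro mult_left_mono) auto
  then show "dist (polygon m s t) (polygon m s' t) \<le> \<delta>"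
    using t assms(3) unfolding polygon_def
    by (auto intro!: dist_linear_interpolation_le[where K="m * T"])
qed

lemma dist_polygon_le:
  assumes m: "0 < m" and t: "real k / real m \<le> t" "t \<le> real (Suc k) / real m"
    and le: "\<And>r. real k / real m \<le> r \<Longrightarrow> r \<le> real (Suc k) / real m \<Longrightarrow> norm (x r - x (real k / real m)) \<le> \<eta>"
  shows "dist (polygon m (\<lambda>k. x (real k / real m)) t) (x t) \<le> 2 * \<eta>"
proof -
  let ?s = "\<lambda>k. x (real k / real m)"
  have "0 \<le> real k / real m" by simp
  then have t0: "0 \<le> t" using t by linarith
  have k: "real k \<le> real m * t" "real m * t \<le> real k + 1"
    using m t by (auto simp: field_simps)
  let ?l = "real m * t - real k"
  have "polygon m ?s t = linear_interpolation ?s (real m * t)"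
    using t0 by (simp add: polygon_def)
  also have "\<dots> = ?s k + ?l *\<^sub>R (?s (Suc k) - ?s k)"
    unfolding linear_interpolation_on[OF k] by (simp only: algebra_simps scaleR_one)
  finally have "polygon m ?s t = ?s k + ?l *\<^sub>R (?s (Suc k) - ?s k)" .
  then have "norm (polygon m ?s t - ?s k) = ?l * norm (?s (Suc k) - ?s k)"
    using k by simp
  also have "\<dots> \<le> 1 * \<eta>"
    using k le[of "real (Suc k) / real m"] m by (intro mult_mono) (auto simp: divide_right_mono)
  finally have "dist (polygon m ?s t) (?s k) \<le> \<eta>" by (simp add: dist_norm)
  moreover have "dist (x t) (?s k) \<le> \<eta>" using le[OF t] by (simp add: dist_norm)
  ultimately show ?thesis using dist_triangle2[of "polygon m ?s t" "x t" "?s k"] by linarith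
qed

lemma polygon_grid:
  assumes m: "0 < m" and t: "t \<in> {0..real T}"
  obtains k where "k < Suc (m * T)" "real k / real m \<le> t" "t \<le> real (Suc k) / real m"
proof -
  obtain k where k: "real k \<le> real m * t" "real m * t \<le> real k + 1"
  proof (rule real_in_unit_interval)
    show "0 \<le> real m * t" using t by simp
  qed
  have "real m * t \<le> real m * real T" using t by (intro mult_left_mono) auto
  then have "real k \<le> real (m * T)" using k(1) by (simp only: of_nat_mult)
  then have "k < Suc (m * T)" by (simp only: of_nat_le_iff less_Suc_eq_le)
  then show ?thesis using that[of k] k m by (simp add: field_simps)
qed

lemma polygon_tendsto:
  fixes x :: "real \<Rightarrow> 'a::real_normed_vector"
  assumes g: "path_lipschitz L (real T) g" and x: "x \<in> paths"
  shows "(\<lambda>m. g (polygon (Suc m) (\<lambda>k. x (real k / real (Suc m))))) \<longlonglongrightarrow> g x"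
proof (rule LIMSEQ_I)
  fix r :: real assume r: "0 < r"
  have L: "L \<ge> 0" using g by (simp add: path_lipschitz_def)
  define \<eta> where "\<eta> = r / (4 * (L + 1))"
  have \<eta>: "\<eta> > 0" using r L by (simp add: \<eta>_def)
  \<comment> \<open>The grid cell of a time in \<open>{0..T}\<close> may extend beyond
    \<open>T\<close> by at most 1; the larger interval leaves room for it.\<close>
  have "continuous_on {0..real T + 2} x"
    using x by (auto simp: paths_def intro: continuous_on_subset)
  then have "uniformly_continuous_on {0..real T + 2} x"
    by (rule compact_uniformly_continuous) simp
  then obtain \<delta> where \<delta>: "\<delta> > 0" "\<And>t t'. t \<in> {0..real T + 2} \<Longrightarrow> t' \<in> {0..real T + 2} \<Longrightarrow>
      dist t' t < \<delta> \<Longrightarrow> dist (x t') (x t) < \<eta>"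
    using \<eta> unfolding uniformly_continuous_on_def by metis
  obtain m0 where m0: "1 / real (Suc m0) < \<delta>" by (rule nat_approx_posE[OF \<delta>(1)])
  show "\<exists>no. \<forall>m\<ge>no. norm (g (polygon (Suc m) (\<lambda>k. x (real k / real (Suc m)))) - g x) < r"
  proof (intro exI allI impI)
    fix m assume "m \<ge> m0"
    define n where "n = Suc m"
    have n: "0 < n" "1 / real n < \<delta>"
    proof -
      have "1 / real n \<le> 1 / real (Suc m0)"
        using \<open>m \<ge> m0\<close> unfolding n_def by (intro divide_left_mono) auto
      with m0 show "1 / real n < \<delta>" by simp
    qed (simp add: n_def)
    have "\<bar>g (polygon n (\<lambda>k. x (real k / real n))) - g x\<bar> \<le> L * (2 * \<eta>)"
    proof (rule path_lipschitzD[OF g polygon_in_paths x])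
      fix t assume t: "t \<in> {0..real T}"
      obtain k where k: "k < Suc (n * T)" "real k / real n \<le> t" "t \<le> real (Suc k) / real n"
        by (rule polygon_grid[OF n(1) t])
      have step: "real (Suc k) / real n = real k / real n + 1 / real n"
        by (simp add: add_divide_distrib)
      have le1: "1 / real n \<le> 1" using n(1) by simp
      show "dist (polygon n (\<lambda>k. x (real k / real n)) t) (x t) \<le> 2 * \<eta>"
      proof (rule dist_polygon_le[OF n(1) k(2,3)])
        fix r assume r: "real k / real n \<le> r" "r \<le> real (Suc k) / real n"
        have "0 \<le> real k / real n" by simp
        then have "r \<in> {0..real T + 2}" "real k / real n \<in> {0..real T + 2}"
          "dist r (real k / real n) < \<delta>"
          using r k(2,3) t step n(2) le1 unfolding dist_real_def atLeastAtMost_iff by linarith+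
        then show "norm (x r - x (real k / real n)) \<le> \<eta>"
          using \<delta>(2)[of "real k / real n" r] by (simp add: dist_norm)
      qed
    qed (use \<eta> in auto)
    also have "\<dots> < r"
    proof -
      have "L * (2 * \<eta>) \<le> (L + 1) * (2 * \<eta>)" using \<eta> by (intro mult_right_mono) auto
      also have "\<dots> = r / 2" using L by (simp add: \<eta>_def field_simps)
      finally show ?thesis using r by simp
    qed
    finally show "norm (g (polygon (Suc m) (\<lambda>k. x (real k / real (Suc m)))) - g x) < r"
      by (simp add: n_def)
  qed
qed

text \<open>
  The index \<open>(j, i)\<close> stands for the \<open>i\<close>-th coordinate of the \<open>j\<close>-th increment over the grid of
  points \<open>k / m\<close>.
\<close>

definition partial_sums :: "(nat \<times> 'd \<Rightarrow> real) \<Rightarrow> nat \<Rightarrow> real ^ 'd" where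
  "partial_sums v k = (\<Sum>j<k. \<chi> i. v (j, i))"

definition grid_increments :: "nat \<Rightarrow> (real \<Rightarrow> real ^ 'd) \<Rightarrow> nat \<times> 'd \<Rightarrow> real" where
  "grid_increments m x = (\<lambda>(j, i). (x (real (Suc j) / real m) - x (real j / real m)) $ i)"

lemma partial_sums_grid_increments:
  assumes "x 0 = 0"
  shows "partial_sums (grid_increments m x) k = x (real k / real m)"
proof (induction k)
  case (Suc k)
  have "(\<chi> i. grid_increments m x (k, i)) = x (real (Suc k) / real m) - x (real k / real m)"
    by (simp only: vec_eq_iff vec_lambda_beta grid_increments_def prod.case simp_thms)
  moreover have "partial_sums (grid_increments m x) (Suc k) =
      partial_sums (grid_increments m x) k + (\<chi> i. grid_increments m x (k, i))"
    by (simp only: partial_sums_def sum.lessThan_Suc)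
  ultimately show ?case unfolding Suc by simp
qed (simp add: partial_sums_def assms)

lemma norm_partial_sums_diff:
  fixes v v' :: "nat \<times> 'd::finite \<Rightarrow> real"
  assumes "k \<le> n"
  shows "norm (partial_sums v k - partial_sums v' k) \<le> (\<Sum>z\<in>{..<n} \<times> UNIV. \<bar>v z - v' z\<bar>)"
proof -
  have "partial_sums v k - partial_sums v' k = (\<Sum>j<k. \<chi> i. v (j, i) - v' (j, i))"
    unfolding partial_sums_def sum_subtractf[symmetric]
    by (rule sum.cong) (auto simp: vec_eq_iff)
  also have "norm \<dots> \<le> (\<Sum>j<k. norm (\<chi> i. v (j, i) - v' (j, i)))"
    by (rule norm_sum)
  also have "\<dots> \<le> (\<Sum>j<k. \<Sum>i\<in>UNIV. \<bar>v (j, i) - v' (j, i)\<bar>)"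
    by (rule sum_mono) (rule order_trans[OF norm_le_l1_cart], simp)
  also have "\<dots> = (\<Sum>z\<in>{..<k} \<times> UNIV. \<bar>v z - v' z\<bar>)"
    by (simp add: sum.cartesian_product)
  also have "\<dots> \<le> (\<Sum>z\<in>{..<n} \<times> UNIV. \<bar>v z - v' z\<bar>)"
    using assms by (intro sum_mono2) auto
  finally show ?thesis .
qed

lemma path_lipschitz_partial_sums:
  fixes v v' :: "nat \<times> 'd::finite \<Rightarrow> real"
  assumes g: "path_lipschitz L (real T) g"
  shows "\<bar>g (polygon m (partial_sums v)) - g (polygon m (partial_sums v'))\<bar> \<le>
    L * (\<Sum>z\<in>{..<Suc (m * T)} \<times> UNIV. \<bar>v z - v' z\<bar>)"
  by (rule path_lipschitz_polygon[OF g]) (auto intro: sum_nonneg norm_partial_sums_diff)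

text \<open>The change of the functional is dominated by finitely many coordinate differences, hence
  it is continuous even in the product topology over all indices.\<close>

lemma continuous_on_polygon_functional:
  fixes g :: "(real \<Rightarrow> real ^ 'd) \<Rightarrow> real"
  assumes g: "path_lipschitz L (real T) g"
  shows "continuous_on UNIV (\<lambda>v. g (polygon m (partial_sums v)))"
  unfolding continuous_on_eq_continuous_within
proof (intro ballI)
  fix v0 :: "nat \<times> 'd \<Rightarrow> real"
  let ?S = "\<lambda>v. L * (\<Sum>z\<in>{..<Suc (m * T)} \<times> UNIV. \<bar>v z - v0 z\<bar>)"
  have "continuous_on UNIV ?S" by (intro continuous_intros continuous_on_product_coordinates)
  then have "(?S \<longlongrightarrow> ?S v0) (at v0)" unfolding continuous_on_def by blast
  moreover have "?S v0 = 0" by simp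
  ultimately have "(?S \<longlongrightarrow> 0) (at v0)" by (simp only:)
  then have "((\<lambda>v. g (polygon m (partial_sums v)) - g (polygon m (partial_sums v0))) \<longlongrightarrow> 0) (at v0)"
    by (rule Lim_null_comparison[rotated])
      (use path_lipschitz_partial_sums[OF g] in \<open>auto intro!: always_eventually\<close>)
  then show "continuous (at v0 within UNIV) (\<lambda>v. g (polygon m (partial_sums v)))"
    unfolding continuous_within by (rule LIM_zero_cancel)
qed

lemma polygon_functional_dependence:
  fixes v v' :: "nat \<times> 'd::finite \<Rightarrow> real"
  assumes g: "path_lipschitz L (real T) g"
    and "\<And>z. z \<in> {..<Suc (m * T)} \<times> UNIV \<Longrightarrow> v z = v' z"
  shows "g (polygon m (partial_sums v)) = g (polygon m (partial_sums v'))"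
  using path_lipschitz_partial_sums[OF g, of m v v'] assms(2) by simp

section \<open>Increments of Brownian motion\<close>

lemma cis_sum: "finite A \<Longrightarrow> cis (\<Sum>a\<in>A. f a) = (\<Prod>a\<in>A. cis (f a))"
  by (induction rule: finite_induct) (simp_all add: cis_mult[symmetric])

lemma integrable_normal_density_cis:
  assumes "0 < \<sigma>"
  shows "integrable lborel (\<lambda>x. normal_density 0 \<sigma> x *\<^sub>R cis (u * x))"
proof (rule Bochner_Integration.integrable_bound)
  show "integrable lborel (normal_density 0 \<sigma>)" using assms by simp
  show "AE x in lborel. norm (normal_density 0 \<sigma> x *\<^sub>R cis (u * x)) \<le> norm (normal_density 0 \<sigma> x)"
    by simp
  show "(\<lambda>x. normal_density 0 \<sigma> x *\<^sub>R cis (u * x)) \<in> borel_measurable lborel"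
    unfolding cis_conv_exp by measurable
qed

lemma char_normal_density:
  assumes s: "0 < \<sigma>"
  shows "(\<integral>x. normal_density 0 \<sigma> x *\<^sub>R cis (u * x) \<partial>lborel) = exp (- (\<sigma>\<^sup>2 * u\<^sup>2 / 2))"
proof -
  have "(\<integral>x. normal_density 0 \<sigma> x *\<^sub>R cis (u * x) \<partial>lborel) =
      \<bar>\<sigma>\<bar> *\<^sub>R (\<integral>x. normal_density 0 \<sigma> (0 + \<sigma> * x) *\<^sub>R cis (u * (0 + \<sigma> * x)) \<partial>lborel)"
    using s by (intro lborel_integral_real_affine) auto
  also have "\<dots> = (\<integral>x. std_normal_density x *\<^sub>R iexp ((u * \<sigma>) * x) \<partial>lborel)"
  proof -
    have "\<sigma> * normal_density 0 \<sigma> (\<sigma> * x) = std_normal_density x" for x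
      using s by (simp add: normal_density_def real_sqrt_mult power_mult_distrib)
    then have "\<bar>\<sigma>\<bar> *\<^sub>R (normal_density 0 \<sigma> (0 + \<sigma> * x) *\<^sub>R cis (u * (0 + \<sigma> * x))) =
        std_normal_density x *\<^sub>R iexp ((u * \<sigma>) * x)" for x
      using s by (simp add: cis_conv_exp mult.assoc)
    then show ?thesis by (simp only: integral_scaleR_right[symmetric])
  qed
  also have "\<dots> = char std_normal_distribution (u * \<sigma>)"
    unfolding char_def by (subst integral_density) auto
  also have "\<dots> = exp (- (\<sigma>\<^sup>2 * u\<^sup>2 / 2))"
    unfolding char_std_normal_distribution by (simp add: power_mult_distrib mult.commute)
  finally show ?thesis .
qed

text \<open>Lebesgue measure on the vector space is the image of a product measure over
  \<open>Basis\<close>, and the integrand factorises over the coordinates.\<close>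

lemma char_normal_density_vec:
  fixes u :: "real ^ 'd"
  assumes s: "0 < \<sigma>"
  shows "(\<integral>x. (\<Prod>i\<in>UNIV. normal_density 0 \<sigma> (x $ i)) *\<^sub>R cis (u \<bullet> x) \<partial>lborel) =
    exp (- (\<sigma>\<^sup>2 * (norm u)\<^sup>2 / 2))"
proof -
  interpret product_sigma_finite "\<lambda>_::real ^ 'd. lborel :: real measure" by standard
  let ?h = "\<lambda>b y. normal_density 0 \<sigma> y *\<^sub>R cis ((u \<bullet> b) * y)"
  have Basis: "(Basis :: (real ^ 'd) set) = range (\<lambda>i. axis i 1)"
    by (auto simp: Basis_vec_def)
  have inj: "inj (\<lambda>i::'d. axis i (1::real))" by (auto simp: inj_on_def axis_eq_axis)
  have integrand: "(\<Prod>i\<in>UNIV. normal_density 0 \<sigma> (x $ i)) *\<^sub>R cis (u \<bullet> x) = (\<Prod>b\<in>Basis. ?h b (x \<bullet> b))"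
    for x :: "real ^ 'd"
  proof -
    have "(\<Prod>b\<in>Basis. ?h b (x \<bullet> b)) =
        (\<Prod>b\<in>Basis. of_real (normal_density 0 \<sigma> (x \<bullet> b))) * (\<Prod>b\<in>Basis. cis ((u \<bullet> b) * (x \<bullet> b)))"
      unfolding scaleR_conv_of_real by (rule prod.distrib)
    also have "(\<Prod>b\<in>Basis. cis ((u \<bullet> b) * (x \<bullet> b))) = cis (u \<bullet> x)"
      unfolding euclidean_inner[of u x] by (rule cis_sum[symmetric]) simp
    also have "(\<Prod>b\<in>Basis. complex_of_real (normal_density 0 \<sigma> (x \<bullet> b))) =
        of_real (\<Prod>i\<in>UNIV. normal_density 0 \<sigma> (x $ i))"
      unfolding Basis of_real_prod by (simp add: prod.reindex[OF inj] inner_axis)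
    finally show ?thesis by (simp add: scaleR_conv_of_real)
  qed
  have "(\<integral>x. (\<Prod>i\<in>UNIV. normal_density 0 \<sigma> (x $ i)) *\<^sub>R cis (u \<bullet> x) \<partial>lborel) =
      (\<integral>x. (\<Prod>b\<in>Basis. ?h b (x \<bullet> b)) \<partial>(lborel :: (real ^ 'd) measure))"
    by (simp only: integrand)
  also have "\<dots> = (\<integral>f. (\<Prod>b\<in>Basis. ?h b ((\<Sum>b'\<in>Basis. f b' *\<^sub>R b') \<bullet> b)) \<partial>(\<Pi>\<^sub>M b\<in>Basis. lborel))"
    unfolding lborel_eq[where 'a="real ^ 'd"]
    by (rule integral_distr) (auto simp: cis_conv_exp)
  also have "\<dots> = (\<integral>f. (\<Prod>b\<in>Basis. ?h b (f b)) \<partial>(\<Pi>\<^sub>M b\<in>(Basis :: (real ^ 'd) set). lborel))"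
  proof -
    have "(\<Sum>b'\<in>Basis. f b' *\<^sub>R b') \<bullet> b = f b" if "b \<in> Basis" for b :: "real ^ 'd" and f
      using that by (simp add: inner_sum_left inner_Basis if_distrib sum.delta cong: if_cong)
    then show ?thesis by (intro Bochner_Integration.integral_cong refl prod.cong) simp
  qed
  also have "\<dots> = (\<Prod>b\<in>Basis. \<integral>y. ?h b y \<partial>lborel)"
    by (rule product_integral_prod) (auto intro: integrable_normal_density_cis[OF s])
  also have "\<dots> = (\<Prod>b\<in>Basis. complex_of_real (exp (- (\<sigma>\<^sup>2 * (u \<bullet> b)\<^sup>2 / 2))))"
    by (simp only: char_normal_density[OF s])
  also have "\<dots> = of_real (exp (\<Sum>b\<in>Basis. - (\<sigma>\<^sup>2 * (u \<bullet> b)\<^sup>2 / 2)))"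
    by (simp only: exp_sum[OF finite_Basis] of_real_prod)
  also have "(\<Sum>b\<in>Basis. - (\<sigma>\<^sup>2 * (u \<bullet> b)\<^sup>2 / 2)) = - (\<sigma>\<^sup>2 * (norm u)\<^sup>2 / 2)"
  proof -
    have "(norm u)\<^sup>2 = (\<Sum>b\<in>Basis. (u \<bullet> b)\<^sup>2)"
      unfolding power2_norm_eq_inner euclidean_inner[of u u] by (simp only: power2_eq_square)
    then show ?thesis
      by (simp add: sum_negf sum_distrib_left sum_divide_distrib)
  qed
  finally show ?thesis .
qed

lemma brownian_increments_char:
  fixes B :: "real \<Rightarrow> 'm \<Rightarrow> real ^ 'd"
  assumes B: "standard_brownian_motion M B" and m: "0 < m"
  shows "(\<integral>\<omega>. cis (\<Sum>j<n. \<theta> j \<bullet> (B (real (Suc j) / real m) \<omega> - B (real j / real m) \<omega>)) \<partial>M) =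
    exp (- ((\<Sum>j<n. (norm (\<theta> j))\<^sup>2) / (2 * real m)))"
proof -
  interpret prob_space M using B by (simp add: standard_brownian_motion_def)
  let ?V = "\<lambda>j \<omega>. B (real (Suc j) / real m) \<omega> - B (real j / real m) \<omega>"
  have indep: "indep_vars (\<lambda>_. borel) ?V {..<n}"
  proof -
    have all: "\<forall>(t :: nat \<Rightarrow> real) k. 0 \<le> t 0 \<and> (\<forall>i<k. t i < t (Suc i)) \<longrightarrow>
        indep_vars (\<lambda>_. borel) (\<lambda>i \<omega>. B (t (Suc i)) \<omega> - B (t i) \<omega>) {..<k}"
      using B unfolding standard_brownian_motion_def by (elim conjE)
    have "0 \<le> real 0 / real m \<and> (\<forall>i<n. real i / real m < real (Suc i) / real m)"
      using m by (simp add: divide_strict_right_mono)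
    with spec[OF spec[OF all, of "\<lambda>j. real j / real m"], of n] show ?thesis by (rule mp)
  qed
  have "(\<integral>\<omega>. cis (\<Sum>j<n. \<theta> j \<bullet> ?V j \<omega>) \<partial>M) = (\<integral>\<omega>. (\<Prod>j<n. cis (\<theta> j \<bullet> ?V j \<omega>)) \<partial>M)"
    by (simp only: cis_sum[OF finite_lessThan])
  also have "\<dots> = (\<Prod>j<n. \<integral>\<omega>. cis (\<theta> j \<bullet> ?V j \<omega>) \<partial>M)"
  proof (rule indep_vars_lebesgue_integral)
    have meas: "(\<lambda>y. cis (\<theta> j \<bullet> y)) \<in> borel_measurable borel" for j
      unfolding cis_conv_exp by measurable
    show "indep_vars (\<lambda>_. borel) (\<lambda>j \<omega>. cis (\<theta> j \<bullet> ?V j \<omega>)) {..<n}"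
      by (rule indep_vars_compose2[OF indep]) (rule meas)
    show "integrable M (\<lambda>\<omega>. cis (\<theta> j \<bullet> ?V j \<omega>))" if "j \<in> {..<n}" for j
    proof (rule integrable_const_bound[where B=1])
      have "?V j \<in> borel_measurable M" using indep that by (auto simp: indep_vars_def)
      then show "(\<lambda>\<omega>. cis (\<theta> j \<bullet> ?V j \<omega>)) \<in> borel_measurable M"
        by (rule measurable_compose[OF _ meas])
    qed simp
  qed simp
  also have "\<dots> = (\<Prod>j<n. complex_of_real (exp (- ((norm (\<theta> j))\<^sup>2 / (2 * real m)))))"
  proof (rule prod.cong[OF refl])
    fix j
    let ?f = "\<lambda>x::real ^ 'd. \<Prod>i\<in>UNIV. normal_density 0 (sqrt (1 / real m)) (x $ i)"
    have step: "real (Suc j) / real m - real j / real m = 1 / real m"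
      by (simp add: add_divide_distrib)
    have grid: "0 \<le> real j / real m \<and> real j / real m < real (Suc j) / real m"
      using m by (simp add: divide_strict_right_mono)
    have d: "distributed M lborel (?V j) (\<lambda>x. ennreal (?f x))"
    proof -
      have "\<forall>s t. 0 \<le> s \<and> s < t \<longrightarrow> distributed M lborel (\<lambda>\<omega>. B t \<omega> - B s \<omega>)
          (\<lambda>x. ennreal (\<Prod>i\<in>UNIV. normal_density 0 (sqrt (t - s)) (x $ i)))"
        using B unfolding standard_brownian_motion_def by (elim conjE)
      from this[rule_format, of "real j / real m" "real (Suc j) / real m"] step grid
      show ?thesis by (simp only: simp_thms)
    qed
    have V: "?V j \<in> M \<rightarrow>\<^sub>M lborel" using d by (simp add: distributed_def)
    have "(\<integral>\<omega>. cis (\<theta> j \<bullet> ?V j \<omega>) \<partial>M) = (\<integral>x. cis (\<theta> j \<bullet> x) \<partial>distr M lborel (?V j))"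
      by (rule integral_distr[OF V, symmetric]) (simp add: cis_conv_exp)
    also have "\<dots> = (\<integral>x. cis (\<theta> j \<bullet> x) \<partial>density lborel (\<lambda>x. ennreal (?f x)))"
      using d by (simp add: distributed_def)
    also have "\<dots> = (\<integral>x. ?f x *\<^sub>R cis (\<theta> j \<bullet> x) \<partial>lborel)"
      by (rule integral_density) (auto simp: cis_conv_exp intro!: prod_nonneg)
    also have "\<dots> = exp (- ((sqrt (1 / real m))\<^sup>2 * (norm (\<theta> j))\<^sup>2 / 2))"
      using m by (intro char_normal_density_vec) simp
    finally show "(\<integral>\<omega>. cis (\<theta> j \<bullet> ?V j \<omega>) \<partial>M) = complex_of_real (exp (- ((norm (\<theta> j))\<^sup>2 / (2 * real m))))"
      using m by (simp add: field_simps)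
  qed
  also have "\<dots> = of_real (exp (\<Sum>j<n. - ((norm (\<theta> j))\<^sup>2 / (2 * real m))))"
    by (simp only: exp_sum[OF finite_lessThan] of_real_prod)
  also have "(\<Sum>j<n. - ((norm (\<theta> j))\<^sup>2 / (2 * real m))) = - ((\<Sum>j<n. (norm (\<theta> j))\<^sup>2) / (2 * real m))"
    by (simp add: sum_negf sum_divide_distrib)
  finally show ?thesis .
qed

section \<open>Convergence of the rescaled walk\<close>

text \<open>The phase comes out as the factor \<open>cis \<phi>\<close>, so limits of characteristic
  functions settle all generators of \<open>trig_span\<close>.\<close>

lemma (in prob_space) expectation_cos_cis:
  assumes "f \<in> borel_measurable M"
  shows "expectation (\<lambda>\<omega>. cos (f \<omega> + \<phi>)) = Re (cis \<phi> * expectation (\<lambda>\<omega>. cis (f \<omega>)))"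
proof -
  have "integrable M (\<lambda>\<omega>. cis (f \<omega>))"
    by (rule integrable_const_bound[where B=1]) (use assms in \<open>auto simp: cis_conv_exp\<close>)
  then have int: "integrable M (\<lambda>\<omega>. cis \<phi> * cis (f \<omega>))" by simp
  have "cos (f \<omega> + \<phi>) = Re (cis \<phi> * cis (f \<omega>))" for \<omega>
    by (simp add: cis_mult add.commute)
  then have "expectation (\<lambda>\<omega>. cos (f \<omega> + \<phi>)) = expectation (\<lambda>\<omega>. Re (cis \<phi> * cis (f \<omega>)))"
    by simp
  also have "\<dots> = Re (expectation (\<lambda>\<omega>. cis \<phi> * cis (f \<omega>)))" using int by (rule integral_Re)
  finally show ?thesis by simp
qed

lemma linear_interpolation_scaleR:
  "c *\<^sub>R linear_interpolation s t = linear_interpolation (\<lambda>k. c *\<^sub>R s k) t"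
  by (simp add: linear_interpolation_def scaleR_add_right mult.commute)

lemma restrict_rescaled_walk:
  fixes Y :: "nat \<Rightarrow> 'm \<Rightarrow> real ^ 'd"
  shows "restrict (\<lambda>t. rescaled_walk p Y n t \<omega>) {0..} =
    polygon n (\<lambda>k. (sqrt (real CARD('d) * (p / (2 - p))) / sqrt (real n)) *\<^sub>R walk Y k \<omega>)"
  unfolding polygon_def rescaled_walk_def linear_interpolation_scaleR[symmetric]
  by (simp add: divide_inverse)

section \<open>Integer block boundaries \<open>n * j div m\<close> for the grid times
  \<open>j / m\<close>\<close>

lemma div_grid_bounds:
  fixes n m j :: nat
  assumes "0 < m"
  shows "real (n * j div m) \<le> real n * (real j / real m)"
    and "real n * (real j / real m) - 1 \<le> real (n * j div m)"
proof -
  have "real (n * j div m) = of_int \<lfloor>real (n * j) / real m\<rfloor>"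
    by (simp add: floor_divide_of_nat_eq del: of_nat_mult)
  moreover have "real (n * j) / real m = real n * (real j / real m)" by simp
  ultimately show "real (n * j div m) \<le> real n * (real j / real m)"
    "real n * (real j / real m) - 1 \<le> real (n * j div m)"
    by linarith+
qed

lemma grid_ratio_tendsto:
  assumes m: "0 < m"
  shows "(\<lambda>n. real (n * j div m) / real n) \<longlonglongrightarrow> real j / real m"
proof (rule tendsto_sandwich)
  show "\<forall>\<^sub>F n in sequentially. real j / real m - 1 / real n \<le> real (n * j div m) / real n"
    using eventually_gt_at_top[of 0]
  proof eventually_elim
    case (elim n)
    have "real j / real m - 1 / real n = (real n * (real j / real m) - 1) / real n"
      using elim by (simp add: field_simps)
    also have "\<dots> \<le> real (n * j div m) / real n"
      by (intro divide_right_mono div_grid_bounds m) simp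
    finally show ?case .
  qed
  show "\<forall>\<^sub>F n in sequentially. real (n * j div m) / real n \<le> real j / real m"
    using eventually_gt_at_top[of 0]
  proof eventually_elim
    case (elim n)
    have "real (n * j div m) / real n \<le> (real n * (real j / real m)) / real n"
      by (intro divide_right_mono div_grid_bounds m) simp
    then show ?case using elim by simp
  qed
  show "(\<lambda>n. real j / real m - 1 / real n) \<longlonglongrightarrow> real j / real m"
    using tendsto_diff[OF tendsto_const lim_1_over_n, of "real j / real m"] by simp
qed simp

lemma grid_mono: "j \<le> k \<Longrightarrow> n * j div m \<le> n * k div (m::nat)"
  by (intro div_le_mono mult_le_mono2)

lemma grid_step:
  assumes "0 < (m::nat)"
  shows "n * Suc j div m \<le> n * j div m + n div m + 1"
proof -
  have "n * Suc j < (n * j div m + n div m + 2) * m"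
  proof -
    have "n * j < (n * j div m + 1) * m" "n < (n div m + 1) * m"
      using assms by (simp_all add: dividend_less_div_times)
    then show ?thesis by (simp add: algebra_simps)
  qed
  then have "n * Suc j div m < n * j div m + n div m + 2"
    by (simp add: less_mult_imp_div_less)
  then show ?thesis by simp
qed

lemma sum_blocks:
  fixes f :: "nat \<Rightarrow> 'a::comm_monoid_add" and a :: "nat \<Rightarrow> nat"
  assumes "a 0 = 0" "\<And>j. a j \<le> a (Suc j)"
  shows "(\<Sum>k<a r. f k) = (\<Sum>j<r. \<Sum>k\<in>{a j..<a (Suc j)}. f k)"
proof (induction r)
  case (Suc r)
  have "{..<a (Suc r)} = {..<a r} \<union> {a r..<a (Suc r)}" using assms(2)[of r] by auto
  then have "(\<Sum>k<a (Suc r). f k) = (\<Sum>k<a r. f k) + (\<Sum>k\<in>{a r..<a (Suc r)}. f k)"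
    by (simp add: sum.union_disjoint ivl_disj_int)
  then show ?case using Suc by simp
qed (simp add: assms)

context conservative_walk
begin

definition scale :: real where "scale = sqrt (real CARD('d) * (p / (2 - p)))"

abbreviation rescaled_path :: "nat \<Rightarrow> 'm \<Rightarrow> real \<Rightarrow> real ^ 'd" where
  "rescaled_path n \<omega> \<equiv> restrict (\<lambda>t. rescaled_walk p Y n t \<omega>) {0..}"

lemma scale_pos: "0 < scale"
  using p by (simp add: scale_def)

text \<open>The asymptotic variance of the martingale per step is normalised to 1 by the scaling of
  the walk.\<close>

lemma variance_scale: "(2 - p) / (p * real CARD('d)) * scale\<^sup>2 = 1"
  using p by (simp add: scale_def real_sqrt_pow2 divide_nonneg_pos field_simps)

lemma rescaled_path_eq: "rescaled_path n \<omega> = polygon n (\<lambda>k. (scale / sqrt (real n)) *\<^sub>R walk Y k \<omega>)"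
  by (simp add: restrict_rescaled_walk scale_def)

lemma rescaled_path_in_paths: "rescaled_path n \<omega> \<in> paths"
  unfolding rescaled_path_eq by (rule polygon_in_paths)

text \<open>
  The preimage of an open set is a countable union of cylinder sets, since a neighbourhood only
  constrains the path on a compact set.
\<close>

lemma dep_path_measurable:
  fixes \<Phi> :: "'m \<Rightarrow> real \<Rightarrow> 'b::metric_space"
  assumes paths: "\<And>\<omega>. \<omega> \<in> space M \<Longrightarrow> \<Phi> \<omega> \<in> paths"
    and dep: "\<And>T. \<exists>n. \<forall>t\<in>{0..T}. dep n (\<lambda>\<omega>. \<Phi> \<omega> t)"
  shows "\<Phi> \<in> M \<rightarrow>\<^sub>M borel_of path_topology"
  unfolding borel_of_def
proof (rule measurable_measure_of)
  show "{U :: (real \<Rightarrow> 'b) set. openin path_topology U} \<subseteq> Pow (topspace path_topology)"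
    using openin_subset by auto
  show "\<Phi> \<in> space M \<rightarrow> topspace path_topology"
    using paths by (simp add: topspace_path_topology)
  fix U :: "(real \<Rightarrow> 'b) set" assume "U \<in> {U. openin path_topology U}"
  then have U: "open_paths U" by (simp add: openin_path_topology)
  \<comment> \<open>\<open>P n\<close> holds at a sample point when the first \<open>n\<close> steps
    already force membership in the preimage; this is the largest part of the preimage determined by
    those steps.\<close>
  define P where "P n \<omega> \<longleftrightarrow> (\<forall>\<omega>'\<in>space M. (\<forall>k\<in>{1..n}. Y k \<omega> = Y k \<omega>') \<longrightarrow> \<Phi> \<omega>' \<in> U)" for n \<omega>
  have "dep n (P n)" for n unfolding dep_def P_def by (intro ballI impI) simp
  then have "(\<Union>n. {\<omega> \<in> space M. P n \<omega>}) \<in> events"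
    by (intro sets.countable_UN) (auto intro: dep_events)
  moreover have "\<Phi> -` U \<inter> space M = (\<Union>n. {\<omega> \<in> space M. P n \<omega>})"
  proof (intro subset_antisym subsetI)
    fix \<omega> assume "\<omega> \<in> \<Phi> -` U \<inter> space M"
    then have w: "\<omega> \<in> space M" "\<Phi> \<omega> \<in> U" by auto
    obtain K e where K: "compact K" "K \<subseteq> {0..}" "e > 0"
      "\<And>g. g \<in> paths \<Longrightarrow> (\<And>t. t \<in> K \<Longrightarrow> dist (g t) (\<Phi> \<omega> t) < e) \<Longrightarrow> g \<in> U"
      using open_pathsD[OF U w(2)] by metis
    obtain T where T: "\<And>t. t \<in> K \<Longrightarrow> t \<le> T"
      using compact_imp_bounded[OF K(1)] unfolding bounded_real by (meson abs_le_D1)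
    obtain n where n: "\<forall>t\<in>{0..T}. dep n (\<lambda>\<omega>. \<Phi> \<omega> t)" using dep by blast
    have "P n \<omega>"
      unfolding P_def
    proof (intro ballI impI)
      fix \<omega>' assume w': "\<omega>' \<in> space M" "\<forall>k\<in>{1..n}. Y k \<omega> = Y k \<omega>'"
      show "\<Phi> \<omega>' \<in> U"
      proof (rule K(4)[OF paths[OF w'(1)]])
        fix t assume "t \<in> K"
        then have "t \<in> {0..T}" using T K(2) by auto
        then have "\<Phi> \<omega> t = \<Phi> \<omega>' t" using n w w' unfolding dep_def by blast
        then show "dist (\<Phi> \<omega>' t) (\<Phi> \<omega> t) < e" using K(3) by simp
      qed
    qed
    then show "\<omega> \<in> (\<Union>n. {\<omega> \<in> space M. P n \<omega>})" using w by blast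
  next
    fix \<omega> assume "\<omega> \<in> (\<Union>n. {\<omega> \<in> space M. P n \<omega>})"
    then show "\<omega> \<in> \<Phi> -` U \<inter> space M" unfolding P_def by blast
  qed
  ultimately show "\<Phi> -` U \<inter> space M \<in> events" by simp
qed

lemma rescaled_path_measurable: "rescaled_path n \<in> M \<rightarrow>\<^sub>M borel_of path_topology"
proof (rule dep_path_measurable)
  fix T :: real
  \<comment> \<open>One step more than the integer part, because interpolation looks at the next
    vertex.\<close>
  have "dep (Suc (nat \<lfloor>real n * T\<rfloor>)) (\<lambda>\<omega>. rescaled_path n \<omega> t)" if t: "t \<in> {0..T}" for t
  proof -
    let ?k = "nat \<lfloor>real n * t\<rfloor>"
    have "real n * t \<le> real n * T" using t by (intro mult_left_mono) auto
    then have k: "?k \<le> nat \<lfloor>real n * T\<rfloor>" by (intro nat_mono floor_mono)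
    have "dep (Suc (nat \<lfloor>real n * T\<rfloor>)) (walk Y j)" if "j \<le> Suc ?k" for j
      unfolding walk_def using that k by (intro dep_sum dep_Y) auto
    then have "dep (Suc (nat \<lfloor>real n * T\<rfloor>))
        (\<lambda>\<omega>. linear_interpolation (\<lambda>k. (scale / sqrt (real n)) *\<^sub>R walk Y k \<omega>) (real n * t))"
      unfolding linear_interpolation_def by (intro dep_ops dep_const) auto
    then show ?thesis using t by (simp add: rescaled_path_eq polygon_def)
  qed
  then show "\<exists>k. \<forall>t\<in>{0..T}. dep k (\<lambda>\<omega>. rescaled_path n \<omega> t)" by blast
qed (rule rescaled_path_in_paths)

lemma prob_space_Law: "prob_space (Law M (rescaled_walk p Y n))"
  unfolding Law_def by (rule prob_space_distr[OF rescaled_path_measurable])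

lemma integral_Law:
  fixes g :: "(real \<Rightarrow> real ^ 'd) \<Rightarrow> real"
  assumes "g \<in> borel_measurable (borel_of path_topology)"
  shows "(\<integral>w. g w \<partial>Law M (rescaled_walk p Y n)) = expectation (\<lambda>\<omega>. g (rescaled_path n \<omega>))"
  unfolding Law_def by (rule integral_distr[OF rescaled_path_measurable assms])

text \<open>The discrete counterpart of \<open>grid_increments\<close>, indexed by the same pairs so
  that both are fed into the same polygon functional.\<close>

definition martingale_increments :: "nat \<Rightarrow> nat \<Rightarrow> 'm \<Rightarrow> nat \<times> 'd \<Rightarrow> real" where
  "martingale_increments m n \<omega> = (\<lambda>(j, i).
    ((scale / sqrt (real n)) *\<^sub>R (N (n * Suc j div m) \<omega> - N (n * j div m) \<omega>)) $ i)"

lemma partial_sums_martingale_increments: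
  "partial_sums (martingale_increments m n \<omega>) k = (scale / sqrt (real n)) *\<^sub>R N (n * k div m) \<omega>"
proof (induction k)
  case (Suc k)
  have "(\<chi> i. martingale_increments m n \<omega> (k, i)) =
      (scale / sqrt (real n)) *\<^sub>R (N (n * Suc k div m) \<omega> - N (n * k div m) \<omega>)"
    by (simp only: vec_eq_iff vec_lambda_beta martingale_increments_def prod.case simp_thms)
  moreover have "partial_sums (martingale_increments m n \<omega>) (Suc k) =
      partial_sums (martingale_increments m n \<omega>) k + (\<chi> i. martingale_increments m n \<omega> (k, i))"
    by (simp only: partial_sums_def sum.lessThan_Suc)
  ultimately show ?case unfolding Suc by (simp add: scaleR_diff_right)
qed (simp add: partial_sums_def N_def)

lemma dep_martingale_increments:
  "\<exists>k. dep k (\<lambda>\<omega>. martingale_increments m n \<omega> z)"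
proof -
  obtain j i where z: "z = (j, i)" by (rule prod.exhaust)
  let ?K = "n * Suc j div m + n * j div m"
  have "dep (?K + 2) (\<lambda>\<omega>. ((scale / sqrt (real n)) *\<^sub>R (N (n * Suc j div m) \<omega> - N (n * j div m) \<omega>)) $ i)"
    by (intro dep_compose[where F="\<lambda>x. x $ i"] dep_ops dep_const dep_N) auto
  then show ?thesis unfolding z martingale_increments_def prod.case by blast
qed

lemma martingale_increments_measurable:
  "(\<lambda>\<omega>. martingale_increments m n \<omega> z) \<in> borel_measurable M"
  using dep_martingale_increments[of m n z] dep_integrable by blast



text \<open>Both paths are compared with the rescaled \<open>N\<close> at the left end of the block
  containing \<open>t\<close>. Each comparison costs the oscillation \<open>l\<close>, and replacing
  the walk by \<open>N\<close> costs \<open>2 + 2 / p\<close>.\<close>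

lemma rescaled_path_polygon_dist:
  assumes m: "0 < m" and n: "0 < n" and w: "\<omega> \<in> space M" and t: "t \<in> {0..real T}" and l: "0 \<le> l"
    and osc: "\<And>k j. k < Suc (m * T) \<Longrightarrow> j \<le> n div m + 2 \<Longrightarrow>
      norm (N (n * k div m + j) \<omega> - N (n * k div m) \<omega>) \<le> l"
  shows "dist (rescaled_path n \<omega> t) (polygon m (partial_sums (martingale_increments m n \<omega>)) t)
    \<le> (scale / sqrt (real n)) * (2 * l + (2 + 2 / p))"
proof -
  define c where "c = scale / sqrt (real n)"
  have c: "0 \<le> c" using scale_pos by (simp add: c_def)
  obtain k where k: "k < Suc (m * T)" "real k / real m \<le> t" "t \<le> real (Suc k) / real m"
    by (rule polygon_grid[OF m t])
  let ?a = "n * k div m" and ?b = "n * Suc k div m"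
  obtain i where i: "real i \<le> real n * t" "real n * t < real i + 1"
  proof
    show "real (nat \<lfloor>real n * t\<rfloor>) \<le> real n * t" "real n * t < real (nat \<lfloor>real n * t\<rfloor>) + 1"
      using t by simp_all
  qed
  have "real ?a \<le> real n * (real k / real m)" by (rule div_grid_bounds(1)[OF m])
  also have "\<dots> \<le> real n * t" using k by (intro mult_left_mono) auto
  finally have "real ?a < real (Suc i)" using i by simp
  then have ai: "?a \<le> i" by simp
  have i_le: "real i \<le> real n * (real (Suc k) / real m)"
    using k by (intro order_trans[OF i(1)] mult_left_mono) auto
  have ib': "i \<le> ?b"
  proof (rule ccontr)
    assume "\<not> ?thesis"
    then have "Suc ?b \<le> i" by simp
    moreover have "n * Suc k < Suc ?b * m" using m by (simp add: dividend_less_div_times)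
    ultimately have "n * Suc k < i * m" by (meson less_le_trans mult_le_mono1)
    then have "real (n * Suc k) < real (i * m)" by (simp only: of_nat_less_iff)
    then have "real n * (real (Suc k) / real m) < real i" using m by (simp add: field_simps)
    with i_le show False by linarith
  qed
  have near: "norm (c *\<^sub>R walk Y j \<omega> - c *\<^sub>R N ?a \<omega>) \<le> c * (l + (2 + 2 / p))"
    if "?a \<le> j" "j \<le> Suc i" for j
  proof -
    \<comment> \<open>A block has at most \<open>n div m + 1\<close> steps; the vertex
      \<open>Suc i\<close> can lie one step beyond its right end.\<close>
    have "j - ?a \<le> n div m + 2" using that ib' grid_step[OF m, of n k] by linarith
    then have "norm (N j \<omega> - N ?a \<omega>) \<le> l" using osc[OF k(1), of "j - ?a"] that by simp
    moreover have "norm (walk Y j \<omega> - N j \<omega>) \<le> 2 + 2 / p" by (rule walk_N_diff[OF w])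
    ultimately have "norm (walk Y j \<omega> - N ?a \<omega>) \<le> l + (2 + 2 / p)"
      using norm_triangle_ineq[of "walk Y j \<omega> - N j \<omega>" "N j \<omega> - N ?a \<omega>"] by simp
    then show ?thesis
      using c by (simp only: scaleR_diff_right[symmetric] norm_scaleR abs_of_nonneg) (rule mult_left_mono)
  qed
  have combine: "norm ((1 - r) *\<^sub>R x + r *\<^sub>R y - z) \<le> \<delta>"
    if "norm (x - z) \<le> \<delta>" "norm (y - z) \<le> \<delta>" "0 \<le> r" "r \<le> 1" for x y z :: "real ^ 'd" and r \<delta> :: real
    using convex_combination_dist_le[OF that] by (simp add: algebra_simps)
  have t0: "0 \<le> t" using t by simp
  have "rescaled_path n \<omega> t = linear_interpolation (\<lambda>k. c *\<^sub>R walk Y k \<omega>) (real n * t)"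
    using t0 unfolding rescaled_path_eq polygon_def c_def by simp
  also have "\<dots> = (1 - (real n * t - real i)) *\<^sub>R (c *\<^sub>R walk Y i \<omega>) +
      (real n * t - real i) *\<^sub>R (c *\<^sub>R walk Y (Suc i) \<omega>)"
    using i by (intro linear_interpolation_on) auto
  finally have path: "norm (rescaled_path n \<omega> t - c *\<^sub>R N ?a \<omega>) \<le> c * (l + (2 + 2 / p))"
    using near[of i] near[of "Suc i"] ai i by (simp only:) (intro combine, auto)
  have kt: "real k \<le> real m * t" "real m * t \<le> real k + 1"
    using m k by (auto simp: field_simps)
  have "polygon m (partial_sums (martingale_increments m n \<omega>)) t =
      linear_interpolation (partial_sums (martingale_increments m n \<omega>)) (real m * t)"
    using t0 unfolding polygon_def by simp
  also have "\<dots> = (1 - (real m * t - real k)) *\<^sub>R (c *\<^sub>R N ?a \<omega>) +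
      (real m * t - real k) *\<^sub>R (c *\<^sub>R N ?b \<omega>)"
    unfolding linear_interpolation_on[OF kt] partial_sums_martingale_increments c_def ..
  finally have poly: "norm (polygon m (partial_sums (martingale_increments m n \<omega>)) t - c *\<^sub>R N ?a \<omega>)
      \<le> c * l"
  proof -
    assume eq: "polygon m (partial_sums (martingale_increments m n \<omega>)) t = (1 - (real m * t - real k)) *\<^sub>R (c *\<^sub>R N ?a \<omega>) +
      (real m * t - real k) *\<^sub>R (c *\<^sub>R N ?b \<omega>)"
    have ab: "?a \<le> ?b" by (rule grid_mono) simp
    have "?b - ?a \<le> n div m + 2" using grid_step[OF m, of n k] by linarith
    then have "norm (N ?b \<omega> - N ?a \<omega>) \<le> l" using osc[OF k(1), of "?b - ?a"] ab by simp
    then have "norm (c *\<^sub>R N ?b \<omega> - c *\<^sub>R N ?a \<omega>) \<le> c * l"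
      using c by (simp only: scaleR_diff_right[symmetric] norm_scaleR abs_of_nonneg) (rule mult_left_mono)
    then show ?thesis unfolding eq using kt c l by (intro combine) auto
  qed
  have "dist (rescaled_path n \<omega> t) (polygon m (partial_sums (martingale_increments m n \<omega>)) t) \<le>
      c * (l + (2 + 2 / p)) + c * l"
    using dist_triangle2[of "rescaled_path n \<omega> t"
        "polygon m (partial_sums (martingale_increments m n \<omega>)) t" "c *\<^sub>R N ?a \<omega>"] path poly
    unfolding dist_norm by linarith
  then show ?thesis by (simp add: c_def algebra_simps)
qed

end

lemma inverse_sqrt_tendsto: "(\<lambda>n. 1 / sqrt (real n)) \<longlonglongrightarrow> 0"
  using tendsto_real_sqrt[OF lim_1_over_n] by (simp add: real_sqrt_divide)

context conservative_walk
begin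

lemma N_diff:
  assumes "a \<le> b" shows "N b \<omega> - N a \<omega> = (\<Sum>l\<in>{a..<b}. D l \<omega>)"
proof -
  have "{..<b} = {..<a} \<union> {a..<b}" using assms by auto
  then have "N b \<omega> = N a \<omega> + (\<Sum>l\<in>{a..<b}. D l \<omega>)"
    by (simp add: N_def sum.union_disjoint ivl_disj_int)
  then show ?thesis by simp
qed

text \<open>A linear combination of block increments is a single sum of
  \<open>\<eta> n l \<bullet> D l\<close> with vectors \<open>\<eta> n l\<close> constant on blocks,
  so the one-step approximation gives the joint characteristic function directly, without splitting
  the blocks.\<close>

lemma martingale_increments_char_tendsto:
  assumes m: "0 < m"
  shows "(\<lambda>n. expectation (\<lambda>\<omega>. cis (\<Sum>z\<in>{..<r} \<times> UNIV. \<theta> z * martingale_increments m n \<omega> z)))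
    \<longlonglongrightarrow> exp (- ((\<Sum>j<r. (norm (\<chi> i. \<theta> (j, i)))\<^sup>2) / (2 * real m)))"
proof -
  define t where "t j = (\<chi> i. \<theta> (j, i))" for j
  \<comment> \<open>Extension by 0 beyond block \<open>r\<close> gives the bound on
    \<open>\<eta>\<close> for every index, as the approximation lemma requires.\<close>
  define \<tau> where "\<tau> j = (if j < r then t j else 0)" for j
  define K where "K = scale * (\<Sum>j<r. norm (t j))"
  define a where "a n j = n * j div m" for n j
  \<comment> \<open>The block containing \<open>l\<close>. The least index is right even when some
    blocks are empty, as happens for \<open>n < m\<close>.\<close>
  define blk where "blk n l = (LEAST j. l < a n (Suc j))" for n l
  define \<eta> where "\<eta> n l = (scale / sqrt (real n)) *\<^sub>R \<tau> (blk n l)" for n l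
  define v where "v = (2 - p) / (p * real CARD('d))"
  define C where "C = 2 / p ^ 3 + (2 / p) ^ 3 + v\<^sup>2"
  have C: "C \<ge> 0" using p by (simp add: C_def)
  have K: "K \<ge> 0" using scale_pos by (simp add: K_def sum_nonneg)
  have a0: "a n 0 = 0" for n by (simp add: a_def)
  have a_mono: "a n j \<le> a n (Suc j)" for n j unfolding a_def by (intro grid_mono) simp
  have blk: "blk n l = j" if "l \<in> {a n j..<a n (Suc j)}" for n l j
    unfolding blk_def
  proof (rule Least_equality)
    show "l < a n (Suc j)" using that by simp
    fix k assume "l < a n (Suc k)"
    show "j \<le> k"
    proof (rule ccontr)
      assume "\<not> j \<le> k"
      then have "a n (Suc k) \<le> a n j" unfolding a_def by (intro grid_mono) simp
      with \<open>l < a n (Suc k)\<close> that show False by simp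
    qed
  qed
  have \<tau>_le: "norm (\<tau> j) \<le> (\<Sum>j<r. norm (t j))" for j
    using member_le_sum[of j "{..<r}" "\<lambda>j. norm (t j)"] by (auto simp: \<tau>_def sum_nonneg)
  have \<eta>_le: "norm (\<eta> n l) \<le> K * (1 / sqrt (real n))" for n l
    using mult_left_mono[OF \<tau>_le[of "blk n l"], of "scale / sqrt (real n)"] scale_pos
    by (simp add: \<eta>_def K_def)
  have sum_eq: "(\<Sum>z\<in>{..<r} \<times> UNIV. \<theta> z * martingale_increments m n \<omega> z) = (\<Sum>l<a n r. \<eta> n l \<bullet> D l \<omega>)"
    for n \<omega>
  proof -
    have "(\<Sum>z\<in>{..<r} \<times> UNIV. \<theta> z * martingale_increments m n \<omega> z) =
        (\<Sum>j<r. \<Sum>i\<in>UNIV. \<theta> (j, i) * martingale_increments m n \<omega> (j, i))"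
      by (simp add: sum.cartesian_product)
    also have "\<dots> = (\<Sum>j<r. \<Sum>l\<in>{a n j..<a n (Suc j)}. \<eta> n l \<bullet> D l \<omega>)"
    proof (rule sum.cong[OF refl])
      fix j assume j: "j \<in> {..<r}"
      have "(\<Sum>i\<in>UNIV. \<theta> (j, i) * martingale_increments m n \<omega> (j, i)) =
          t j \<bullet> ((scale / sqrt (real n)) *\<^sub>R (N (a n (Suc j)) \<omega> - N (a n j) \<omega>))"
        by (simp add: t_def inner_vec_def martingale_increments_def a_def)
      also have "\<dots> = (\<Sum>l\<in>{a n j..<a n (Suc j)}. ((scale / sqrt (real n)) *\<^sub>R t j) \<bullet> D l \<omega>)"
        unfolding N_diff[OF a_mono] by (simp add: inner_sum_right sum_distrib_left)
      also have "\<dots> = (\<Sum>l\<in>{a n j..<a n (Suc j)}. \<eta> n l \<bullet> D l \<omega>)"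
        using j blk by (intro sum.cong refl) (simp add: \<eta>_def \<tau>_def)
      finally show "(\<Sum>i\<in>UNIV. \<theta> (j, i) * martingale_increments m n \<omega> (j, i)) =
          (\<Sum>l\<in>{a n j..<a n (Suc j)}. \<eta> n l \<bullet> D l \<omega>)" .
    qed
    also have "\<dots> = (\<Sum>l<a n r. \<eta> n l \<bullet> D l \<omega>)"
      by (rule sum_blocks[symmetric]) (rule a0, rule a_mono)
    finally show ?thesis .
  qed
  have sq_eq: "v / 2 * (\<Sum>l<a n r. (norm (\<eta> n l))\<^sup>2) =
      (\<Sum>j<r. (real (a n (Suc j)) / real n - real (a n j) / real n) * (norm (t j))\<^sup>2) / 2" for n
  proof -
    have "(\<Sum>l<a n r. (norm (\<eta> n l))\<^sup>2) = (\<Sum>j<r. \<Sum>l\<in>{a n j..<a n (Suc j)}. (norm (\<eta> n l))\<^sup>2)"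
      by (rule sum_blocks) (rule a0, rule a_mono)
    also have "\<dots> = (\<Sum>j<r. \<Sum>l\<in>{a n j..<a n (Suc j)}. scale\<^sup>2 / real n * (norm (t j))\<^sup>2)"
    proof (intro sum.cong refl)
      fix j l assume "j \<in> {..<r}" "l \<in> {a n j..<a n (Suc j)}"
      then show "(norm (\<eta> n l))\<^sup>2 = scale\<^sup>2 / real n * (norm (t j))\<^sup>2"
        using blk[of l n j] by (simp add: \<eta>_def \<tau>_def power_mult_distrib power_divide)
    qed
    also have "\<dots> = scale\<^sup>2 * (\<Sum>j<r. (real (a n (Suc j)) / real n - real (a n j) / real n) * (norm (t j))\<^sup>2)"
      unfolding sum_distrib_left
    proof (rule sum.cong[OF refl])
      fix j
      have "real (a n (Suc j) - a n j) = real (a n (Suc j)) - real (a n j)"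
        by (rule of_nat_diff[OF a_mono])
      then show "(\<Sum>l\<in>{a n j..<a n (Suc j)}. scale\<^sup>2 / real n * (norm (t j))\<^sup>2) =
          scale\<^sup>2 * ((real (a n (Suc j)) / real n - real (a n j) / real n) * (norm (t j))\<^sup>2)"
        by (simp add: diff_divide_distrib[symmetric])
    qed
    finally have eq: "(\<Sum>l<a n r. (norm (\<eta> n l))\<^sup>2) =
        scale\<^sup>2 * (\<Sum>j<r. (real (a n (Suc j)) / real n - real (a n j) / real n) * (norm (t j))\<^sup>2)" .
    have "v * scale\<^sup>2 = 1" unfolding v_def by (rule variance_scale)
    then have "v / 2 * (scale\<^sup>2 * s) = s / 2" for s
      by (metis (no_types, opaque_lifting) mult.assoc mult.commute mult_1 times_divide_eq_left)
    then show ?thesis unfolding eq .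
  qed
  let ?E = "\<lambda>n. expectation (\<lambda>\<omega>. cis (\<Sum>l<a n r. \<eta> n l \<bullet> D l \<omega>))"
  let ?x = "\<lambda>n. (\<Sum>j<r. (real (a n (Suc j)) / real n - real (a n j) / real n) * (norm (t j))\<^sup>2) / 2"
  have "(\<lambda>n. ?E n - complex_of_real (exp (- ?x n))) \<longlonglongrightarrow> 0"
  proof (rule Lim_null_comparison)
    have "(\<lambda>n. K * (1 / sqrt (real n))) \<longlonglongrightarrow> K * 0"
      by (intro tendsto_mult tendsto_const inverse_sqrt_tendsto)
    then have "\<forall>\<^sub>F n in sequentially. K * (1 / sqrt (real n)) < 1"
      by (intro order_tendstoD(2)) auto
    then show "\<forall>\<^sub>F n in sequentially. norm (?E n - complex_of_real (exp (- ?x n))) \<le>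
        (C * K ^ 3 * real r) * (1 / sqrt (real n))"
      using eventually_gt_at_top[of 0]
    proof eventually_elim
      case (elim n)
      define q where "q = 1 / sqrt (real n)"
      have q: "q \<ge> 0" "q * q * real n = 1" using elim by (simp_all add: q_def)
      \<comment> \<open>At most \<open>n * r\<close> differences contribute, each with error of
        order \<open>n\<close> to the power -3/2.\<close>
      have "norm (?E n - complex_of_real (exp (- ?x n))) \<le> C * (K * q) ^ 3 * real (a n r)"
        unfolding sq_eq[symmetric] C_def v_def q_def
        by (rule characteristic_function_approx) (use K elim \<eta>_le in auto)
      also have "\<dots> \<le> C * (K * q) ^ 3 * (real n * real r)"
      proof (intro mult_left_mono)
        have "a n r \<le> n * r" unfolding a_def by (rule div_le_dividend)
        then show "real (a n r) \<le> real n * real r" by (metis of_nat_le_iff of_nat_mult)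
      qed (use C K q in auto)
      also have "\<dots> = (C * K ^ 3 * real r) * (q * q * real n) * q"
        by (simp add: power3_eq_cube)
      finally show ?case using q by (simp add: q_def)
    qed
    show "(\<lambda>n. (C * K ^ 3 * real r) * (1 / sqrt (real n))) \<longlonglongrightarrow> 0"
      using tendsto_mult[OF tendsto_const inverse_sqrt_tendsto, of "C * K ^ 3 * real r"] by simp
  qed
  moreover have "(\<lambda>n. complex_of_real (exp (- ?x n))) \<longlonglongrightarrow>
      of_real (exp (- ((\<Sum>j<r. (real (Suc j) / real m - real j / real m) * (norm (t j))\<^sup>2) / 2)))"
    unfolding a_def
    by (intro tendsto_of_real tendsto_exp tendsto_minus tendsto_divide tendsto_sum tendsto_mult
        tendsto_diff tendsto_const grid_ratio_tendsto m) simp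
  ultimately have "(\<lambda>n. (?E n - complex_of_real (exp (- ?x n))) + complex_of_real (exp (- ?x n))) \<longlonglongrightarrow>
      0 + of_real (exp (- ((\<Sum>j<r. (real (Suc j) / real m - real j / real m) * (norm (t j))\<^sup>2) / 2)))"
    by (rule tendsto_add)
  moreover have "(\<Sum>j<r. (real (Suc j) / real m - real j / real m) * (norm (t j))\<^sup>2) / 2 =
      (\<Sum>j<r. (norm (t j))\<^sup>2) / (2 * real m)"
    by (simp add: diff_divide_distrib[symmetric] sum_divide_distrib mult.commute)
  ultimately show ?thesis
    unfolding sum_eq t_def[symmetric] by (simp add: mult.commute)
qed

section \<open>Oscillation within blocks and its consequences\<close>

lemma events_oscillation: "{\<omega> \<in> space M. \<exists>j\<le>K. l \<le> norm (N (a + j) \<omega> - N a \<omega>)} \<in> events"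
proof (rule dep_events)
  have "dep (a + K + 2) (\<lambda>\<omega>. l \<le> norm (N (a + j) \<omega> - N a \<omega>))" if "j \<le> K" for j
    using that by (intro dep_compose2[OF dep_N dep_N, where F="\<lambda>x y. l \<le> norm (x - y)"]) auto
  then show "dep (a + K + 2) (\<lambda>\<omega>. \<exists>j\<le>K. l \<le> norm (N (a + j) \<omega> - N a \<omega>))"
    unfolding dep_def by (intro ballI impI) (simp, metis)
qed

lemma prob_oscillation:
  assumes "0 < l"
  shows "prob (\<Union>k<r. {\<omega> \<in> space M. \<exists>j\<le>K. l \<le> norm (N (a k + j) \<omega> - N (a k) \<omega>)}) \<le>
    real r * (4 * (2 / p) ^ 4 * real CARD('d) ^ 5 * (real K)\<^sup>2 / l ^ 4)"
proof -
  have "prob (\<Union>k<r. {\<omega> \<in> space M. \<exists>j\<le>K. l \<le> norm (N (a k + j) \<omega> - N (a k) \<omega>)}) \<le>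
      (\<Sum>k<r. prob {\<omega> \<in> space M. \<exists>j\<le>K. l \<le> norm (N (a k + j) \<omega> - N (a k) \<omega>)})"
    by (intro finite_measure_subadditive_finite finite_lessThan image_subsetI events_oscillation)
  also have "\<dots> \<le> (\<Sum>k<r. 4 * (2 / p) ^ 4 * real CARD('d) ^ 5 * (real K)\<^sup>2 / l ^ 4)"
    by (rule sum_mono) (rule maximal_inequality_norm[OF assms])
  finally show ?thesis by simp
qed

lemma events_Union_oscillation:
  fixes r :: nat
  shows "(\<Union>k<r. {\<omega> \<in> space M. \<exists>j\<le>K. l \<le> norm (N (a k + j) \<omega> - N (a k) \<omega>)}) \<in> events"
  by (rule sets.finite_UN[OF finite_lessThan events_oscillation])

text \<open>A large increment forces an oscillation of order \<open>R * sqrt n\<close> within a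
  block of length of order \<open>n\<close>. The \<open>n\<close>-dependence cancels in the maximal
  inequality, which leaves a bound uniform in \<open>n\<close>.\<close>

lemma martingale_increments_tight:
  assumes m: "0 < m" and e: "0 < e"
  shows "\<exists>R0. \<forall>R\<ge>R0. \<forall>n. prob {\<omega> \<in> space M. \<exists>z\<in>{..<r} \<times> UNIV. \<not> \<bar>martingale_increments m n \<omega> z\<bar> \<le> R} \<le> e"
proof -
  define C where "C = 4 * (2 / p) ^ 4 * real CARD('d) ^ 5"
  have C: "C \<ge> 0" by (simp add: C_def)
  \<comment> \<open>The 9 comes from \<open>n div m + 2 \<le> 3 * n\<close>. The decay
    \<open>R ^ (-4)\<close> is weakened to \<open>1 / R\<close>, for which \<open>R \<ge> 1\<close>
    is needed.\<close>
  define R0 where "R0 = max 1 (real r * (C * 9 * scale ^ 4) / e)"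
  have "prob {\<omega> \<in> space M. \<exists>z\<in>{..<r} \<times> UNIV. \<not> \<bar>martingale_increments m n \<omega> z\<bar> \<le> R} \<le> e"
    if R: "R \<ge> R0" for R n
  proof (cases "n = 0")
    case True
    have "R \<ge> 0" using R by (simp add: R0_def)
    then have eq: "{\<omega> \<in> space M. \<exists>z\<in>{..<r} \<times> UNIV. \<not> \<bar>martingale_increments m n \<omega> z\<bar> \<le> R} = {}"
      using True by (auto simp: martingale_increments_def)
    show ?thesis unfolding eq using e by simp
  next
    case False
    then have n: "real n \<ge> 1" by simp
    have R1: "R \<ge> 1" "real r * (C * 9 * scale ^ 4) / e \<le> R" using R by (simp_all add: R0_def)
    define l where "l = R * sqrt (real n) / scale"
    have l: "l > 0" using R1 n scale_pos by (simp add: l_def)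
    let ?K = "n div m + 2"
    let ?B = "\<Union>k<r. {\<omega> \<in> space M. \<exists>j\<le>?K. l \<le> norm (N (n * k div m + j) \<omega> - N (n * k div m) \<omega>)}"
    have "{\<omega> \<in> space M. \<exists>z\<in>{..<r} \<times> UNIV. \<not> \<bar>martingale_increments m n \<omega> z\<bar> \<le> R} \<subseteq> ?B"
    proof safe
      fix \<omega> k i assume w: "\<omega> \<in> space M" and k: "k < r"
        and big: "\<not> \<bar>martingale_increments m n \<omega> (k, i)\<bar> \<le> R"
      let ?a = "n * k div m" and ?b = "n * Suc k div m"
      have ab: "?a \<le> ?b" by (rule grid_mono) simp
      have j: "?b - ?a \<le> ?K" using grid_step[OF m, of n k] by linarith
      have "R < \<bar>((scale / sqrt (real n)) *\<^sub>R (N ?b \<omega> - N ?a \<omega>)) $ i\<bar>"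
        using big by (simp add: martingale_increments_def)
      also have "\<dots> \<le> norm ((scale / sqrt (real n)) *\<^sub>R (N ?b \<omega> - N ?a \<omega>))"
        by (rule component_le_norm_cart)
      also have "\<dots> = scale / sqrt (real n) * norm (N ?b \<omega> - N ?a \<omega>)"
        using scale_pos by simp
      finally have "l \<le> norm (N ?b \<omega> - N ?a \<omega>)"
        using scale_pos n by (simp add: l_def field_simps)
      then have "l \<le> norm (N (?a + (?b - ?a)) \<omega> - N ?a \<omega>)" using ab by simp
      with j have "\<exists>j\<le>?K. l \<le> norm (N (?a + j) \<omega> - N ?a \<omega>)" by blast
      with w k show "\<omega> \<in> ?B" by blast
    qed
    then have "prob {\<omega> \<in> space M. \<exists>z\<in>{..<r} \<times> UNIV. \<not> \<bar>martingale_increments m n \<omega> z\<bar> \<le> R} \<le> prob ?B"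
      by (rule finite_measure_mono) (rule events_Union_oscillation)
    also have "\<dots> \<le> real r * (C * (real ?K)\<^sup>2 / l ^ 4)"
      unfolding C_def by (rule prob_oscillation[OF l])
    also have "\<dots> \<le> real r * (C * (9 * (real n)\<^sup>2) / l ^ 4)"
    proof (intro mult_left_mono divide_right_mono)
      have "n div m \<le> n" by simp
      then have "real (n div m) \<le> real n" by (simp only: of_nat_le_iff)
      moreover have "real ?K = real (n div m) + 2" by simp
      ultimately have "real ?K \<le> 3 * real n" using n by linarith
      then have "(real ?K)\<^sup>2 \<le> (3 * real n)\<^sup>2" by (rule power_mono) simp
      then show "(real ?K)\<^sup>2 \<le> 9 * (real n)\<^sup>2" by (simp add: power_mult_distrib)
    qed (use C l in auto)
    also have "\<dots> = real r * (C * 9 * scale ^ 4) / R ^ 4"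
    proof -
      have "sqrt (real n) ^ 4 = (real n)\<^sup>2"
        using power_mult[of "sqrt (real n)" 2 2] by simp
      then have "l ^ 4 = R ^ 4 * (real n)\<^sup>2 / scale ^ 4"
        by (simp add: l_def power_divide power_mult_distrib)
      then show ?thesis using n scale_pos R1 by simp
    qed
    also have "\<dots> \<le> real r * (C * 9 * scale ^ 4) / R"
    proof (rule divide_left_mono)
      show "R \<le> R ^ 4" using R1(1) power_increasing[of 1 4 R] by simp
    qed (use C R1 scale_pos in auto)
    also have "\<dots> \<le> e"
      using R1 e by (simp add: field_simps)
    finally show ?thesis .
  qed
  then show ?thesis by blast
qed


text \<open>The level \<open>e * sqrt n\<close> makes the rescaled oscillation of order
  \<open>e\<close>. As \<open>n\<close> grows, the bound on the bad event tends to a multiple of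
  \<open>(m * T + 1) / m^2\<close>, which a large \<open>m\<close> then makes small.\<close>

lemma expectation_rescaled_path_polygon:
  assumes g: "path_lipschitz L (real T) g" "\<And>x. x \<in> paths \<Longrightarrow> \<bar>g x\<bar> \<le> B"
    and m: "0 < m" and n: "0 < n" and e: "0 < e"
  shows "\<bar>expectation (\<lambda>\<omega>. g (rescaled_path n \<omega>)) -
      expectation (\<lambda>\<omega>. g (polygon m (partial_sums (martingale_increments m n \<omega>))))\<bar> \<le>
    L * (scale * (2 * e + (2 + 2 / p) * (1 / sqrt (real n)))) +
    2 * B * (real (Suc (m * T)) * (4 * (2 / p) ^ 4 * real CARD('d) ^ 5) / e ^ 4 *
      (1 / real m + 2 * (1 / real n))\<^sup>2)"
proof -
  define C where "C = 4 * (2 / p) ^ 4 * real CARD('d) ^ 5"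
  have C: "C \<ge> 0" by (simp add: C_def)
  have L: "L \<ge> 0" using g by (simp add: path_lipschitz_def)
  define l where "l = e * sqrt (real n)"
  have l: "l > 0" using e n by (simp add: l_def)
  let ?K = "n div m + 2"
  let ?A = "\<Union>k<Suc (m * T). {\<omega> \<in> space M. \<exists>j\<le>?K. l \<le> norm (N (n * k div m + j) \<omega> - N (n * k div m) \<omega>)}"
  let ?P = "\<lambda>\<omega>. polygon m (partial_sums (martingale_increments m n \<omega>))"
  have A: "?A \<in> events" by (rule events_Union_oscillation)
  have pA: "prob ?A \<le> real (Suc (m * T)) * C / e ^ 4 * (1 / real m + 2 * (1 / real n))\<^sup>2"
  proof -
    have "prob ?A \<le> real (Suc (m * T)) * (C * (real ?K)\<^sup>2 / l ^ 4)"
      unfolding C_def by (rule prob_oscillation[OF l])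
    also have "\<dots> \<le> real (Suc (m * T)) * (C * (real n * (1 / real m + 2 * (1 / real n)))\<^sup>2 / l ^ 4)"
    proof (intro mult_left_mono divide_right_mono power_mono)
      have "real (n div m) \<le> real n / real m"
        using div_grid_bounds(1)[OF m, of n 1] by simp
      then show "real ?K \<le> real n * (1 / real m + 2 * (1 / real n))"
        using n by (simp add: distrib_left)
    qed (use C l in auto)
    also have "\<dots> = real (Suc (m * T)) * C / e ^ 4 * (1 / real m + 2 * (1 / real n))\<^sup>2"
    proof -
      have "sqrt (real n) ^ 4 = (real n)\<^sup>2"
        using power_mult[of "sqrt (real n)" 2 2] by simp
      then have l4: "l ^ 4 = e ^ 4 * (real n)\<^sup>2" by (simp add: l_def power_mult_distrib)
      show ?thesis unfolding l4 power_mult_distrib using n e by simp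
    qed
    finally show ?thesis .
  qed
  have B: "B \<ge> 0" using g(2)[OF rescaled_path_in_paths] by (meson abs_ge_zero order_trans)
  have "\<bar>expectation (\<lambda>\<omega>. g (rescaled_path n \<omega>)) - expectation (\<lambda>\<omega>. g (?P \<omega>))\<bar> \<le>
      L * (scale * (2 * e + (2 + 2 / p) * (1 / sqrt (real n)))) + 2 * B * prob ?A"
  proof (rule expectation_diff_le[OF _ _ A])
    show "integrable M (\<lambda>\<omega>. g (rescaled_path n \<omega>))"
    proof (rule integrable_bounded_real)
      show "(\<lambda>\<omega>. g (rescaled_path n \<omega>)) \<in> borel_measurable M"
        by (rule measurable_compose[OF rescaled_path_measurable
              borel_measurable_continuous_path[OF continuous_map_path_lipschitz[OF g(1)]]])
    qed (rule g(2)[OF rescaled_path_in_paths])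
    show "integrable M (\<lambda>\<omega>. g (?P \<omega>))"
    proof (rule integrable_bounded_real)
      show "(\<lambda>\<omega>. g (?P \<omega>)) \<in> borel_measurable M"
        by (rule measurable_finite_dependence[OF continuous_on_polygon_functional[OF g(1)]
              polygon_functional_dependence[OF g(1)] martingale_increments_measurable])
    qed (rule g(2)[OF polygon_in_paths])
    fix \<omega> assume w: "\<omega> \<in> space M"
    show "\<bar>g (rescaled_path n \<omega>) - g (?P \<omega>)\<bar> \<le> 2 * B" if "\<omega> \<in> ?A"
      using g(2)[OF rescaled_path_in_paths, of n \<omega>]
        g(2)[OF polygon_in_paths, of m "partial_sums (martingale_increments m n \<omega>)"] by linarith
    show "\<bar>g (rescaled_path n \<omega>) - g (?P \<omega>)\<bar> \<le>
        L * (scale * (2 * e + (2 + 2 / p) * (1 / sqrt (real n))))" if "\<omega> \<notin> ?A"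
    proof (rule path_lipschitzD[OF g(1) rescaled_path_in_paths polygon_in_paths])
      fix t assume t: "t \<in> {0..real T}"
      have "dist (rescaled_path n \<omega> t) (?P \<omega> t) \<le>
          (scale / sqrt (real n)) * (2 * l + (2 + 2 / p))"
      proof (rule rescaled_path_polygon_dist[OF m n w t])
        show "0 \<le> l" using l by simp
        fix k j assume kj: "k < Suc (m * T)" "j \<le> n div m + 2"
        show "norm (N (n * k div m + j) \<omega> - N (n * k div m) \<omega>) \<le> l"
        proof (rule ccontr)
          assume "\<not> norm (N (n * k div m + j) \<omega> - N (n * k div m) \<omega>) \<le> l"
          then have "l \<le> norm (N (n * k div m + j) \<omega> - N (n * k div m) \<omega>)" by simp
          then have "\<omega> \<in> {\<omega> \<in> space M. \<exists>j\<le>?K. l \<le> norm (N (n * k div m + j) \<omega> - N (n * k div m) \<omega>)}"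
            using kj(2) w by (intro CollectI conjI exI[of _ j])
          moreover have "k \<in> {..<Suc (m * T)}" using kj(1) by simp
          ultimately have "\<omega> \<in> ?A" by (rule UN_I[rotated])
          with that show False by (rule notE)
        qed
      qed
      also have "\<dots> = scale * (2 * e + (2 + 2 / p) * (1 / sqrt (real n)))"
      proof -
        have "scale / s * (2 * (e * s) + c) = scale * (2 * e + c * (1 / s))" if "s > 0" for s c :: real
          using that by (simp add: field_simps)
        then show ?thesis using n unfolding l_def by simp
      qed
      finally show "dist (rescaled_path n \<omega> t) (?P \<omega> t) \<le>
          scale * (2 * e + (2 + 2 / p) * (1 / sqrt (real n)))" .
    qed (use scale_pos e p in auto)
  qed (use L scale_pos e p in auto)
  also have "\<dots> \<le> L * (scale * (2 * e + (2 + 2 / p) * (1 / sqrt (real n)))) +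
      2 * B * (real (Suc (m * T)) * C / e ^ 4 * (1 / real m + 2 * (1 / real n))\<^sup>2)"
    using pA B by (intro add_left_mono mult_left_mono) auto
  finally show ?thesis by (simp only: C_def)
qed

end

section \<open>Passage to the limit, first along a fixed grid and then in the mesh\<close>

lemma grid_increments_measurable:
  fixes W :: "(real \<Rightarrow> real ^ 'd) measure"
  assumes "\<And>t. 0 \<le> t \<Longrightarrow> (\<lambda>w. w t) \<in> borel_measurable W"
  shows "(\<lambda>w. grid_increments m w z) \<in> borel_measurable W"
proof -
  have "(\<lambda>x :: real ^ 'd. x $ i) \<in> borel_measurable borel" for i
    by (intro borel_measurable_continuous_onI linear_continuous_on bounded_linear_vec_nth)
  then show ?thesis
    unfolding grid_increments_def split_beta
    by (rule measurable_compose[rotated]) (intro borel_measurable_diff assms, auto)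
qed

context conservative_walk
begin

lemma martingale_polygon_tendsto:
  fixes W :: "(real \<Rightarrow> real ^ 'd) measure"
  assumes W: "wiener_measure W" and m: "0 < m"
    and g: "path_lipschitz L (real T) g" "\<And>x. x \<in> paths \<Longrightarrow> \<bar>g x\<bar> \<le> B"
  shows "(\<lambda>n. expectation (\<lambda>\<omega>. g (polygon m (partial_sums (martingale_increments m n \<omega>))))) \<longlonglongrightarrow>
    (\<integral>w. g (polygon m (partial_sums (grid_increments m w))) \<partial>W)"
proof (rule weak_convergence_trig[where J="{..<Suc (m * T)} \<times> UNIV" and
      G="\<lambda>v. g (polygon m (partial_sums v))"])
  have BM: "standard_brownian_motion W (\<lambda>t w. w t)" using W by (simp add: wiener_measure_def)
  then interpret W: prob_space W by (simp add: standard_brownian_motion_def)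
  show "prob_space M" by unfold_locales
  show "prob_space W" by unfold_locales
  show meas: "(\<lambda>\<omega>. martingale_increments m n \<omega> z) \<in> borel_measurable M" for n z
    by (rule martingale_increments_measurable)
  have w: "(\<lambda>w. w t) \<in> borel_measurable W" if "0 \<le> t" for t
    using BM that by (simp add: standard_brownian_motion_def)
  show meas': "(\<lambda>w. grid_increments m w z) \<in> borel_measurable W" for z
    by (rule grid_increments_measurable[OF w])
  show "(\<lambda>n. expectation (\<lambda>\<omega>. cos ((\<Sum>z\<in>{..<Suc (m * T)} \<times> UNIV. \<theta> z * martingale_increments m n \<omega> z) + \<phi>)))
      \<longlonglongrightarrow> (\<integral>w. cos ((\<Sum>z\<in>{..<Suc (m * T)} \<times> UNIV. \<theta> z * grid_increments m w z) + \<phi>) \<partial>W)" for \<theta> \<phi>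
  proof -
    let ?r = "Suc (m * T)"
    let ?t = "\<lambda>j. \<chi> i. \<theta> (j, i)"
    let ?l = "exp (- ((\<Sum>j<?r. (norm (?t j))\<^sup>2) / (2 * real m)))"
    have eq: "(\<Sum>z\<in>{..<?r} \<times> UNIV. \<theta> z * grid_increments m w z) =
        (\<Sum>j<?r. ?t j \<bullet> (w (real (Suc j) / real m) - w (real j / real m)))" for w
      unfolding sum.cartesian_product[symmetric] split_beta
      by (simp add: inner_vec_def grid_increments_def sum.cartesian_product')
    have "(\<integral>w. cos ((\<Sum>z\<in>{..<?r} \<times> UNIV. \<theta> z * grid_increments m w z) + \<phi>) \<partial>W) =
        Re (cis \<phi> * (\<integral>w. cis (\<Sum>z\<in>{..<?r} \<times> UNIV. \<theta> z * grid_increments m w z) \<partial>W))"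
      using meas' by (intro W.expectation_cos_cis borel_measurable_sum borel_measurable_times) auto
    also have "\<dots> = Re (cis \<phi> * complex_of_real ?l)"
      unfolding eq brownian_increments_char[OF BM m] ..
    finally have lim: "(\<integral>w. cos ((\<Sum>z\<in>{..<?r} \<times> UNIV. \<theta> z * grid_increments m w z) + \<phi>) \<partial>W) =
      Re (cis \<phi> * complex_of_real ?l)" .
    have "expectation (\<lambda>\<omega>. cos ((\<Sum>z\<in>{..<?r} \<times> UNIV. \<theta> z * martingale_increments m n \<omega> z) + \<phi>)) =
        Re (cis \<phi> * expectation (\<lambda>\<omega>. cis (\<Sum>z\<in>{..<?r} \<times> UNIV. \<theta> z * martingale_increments m n \<omega> z)))" for n
      using meas by (intro expectation_cos_cis borel_measurable_sum borel_measurable_times) auto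
    then show ?thesis
      unfolding lim
      by (simp only:) (intro tendsto_Re tendsto_mult tendsto_const martingale_increments_char_tendsto m)
  qed
  show "\<exists>R0. \<forall>R\<ge>R0. \<forall>n. prob {\<omega> \<in> space M. \<exists>z\<in>{..<Suc (m * T)} \<times> UNIV.
      \<not> \<bar>martingale_increments m n \<omega> z\<bar> \<le> R} \<le> e" if "0 < e" for e
    by (rule martingale_increments_tight[OF m that])
  show "continuous_on UNIV (\<lambda>v. g (polygon m (partial_sums v)))"
    by (rule continuous_on_polygon_functional[OF g(1)])
  show "\<bar>g (polygon m (partial_sums v))\<bar> \<le> B" for v
    by (rule g(2)[OF polygon_in_paths])
  show "g (polygon m (partial_sums v)) = g (polygon m (partial_sums v'))"
    if "\<And>z. z \<in> {..<Suc (m * T)} \<times> UNIV \<Longrightarrow> v z = v' z" for v v'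
    by (rule polygon_functional_dependence[OF g(1) that])
qed simp

end

text \<open>Increments forget the starting point, so their partial sums recover the path only if it
  starts at 0; this holds almost surely under \<open>W\<close>.\<close>

lemma wiener_polygon_tendsto:
  fixes W :: "(real \<Rightarrow> real ^ 'd) measure"
  assumes W: "wiener_measure W"
    and g: "path_lipschitz L (real T) g" "\<And>x. x \<in> paths \<Longrightarrow> \<bar>g x\<bar> \<le> B"
  shows "(\<lambda>m. \<integral>w. g (polygon (Suc m) (partial_sums (grid_increments (Suc m) w))) \<partial>W) \<longlonglongrightarrow> (\<integral>w. g w \<partial>W)"
proof (rule integral_dominated_convergence[where w="\<lambda>_. B"])
  have BM: "standard_brownian_motion W (\<lambda>t w. w t)" using W by (simp add: wiener_measure_def)
  then interpret W: prob_space W by (simp add: standard_brownian_motion_def)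
  have sets: "sets W = sets (borel_of path_topology)" using W by (simp add: wiener_measure_def)
  have space: "space W = paths"
    using sets_eq_imp_space_eq[OF sets] by (simp add: space_borel_of_paths)
  show "g \<in> borel_measurable W"
    using borel_measurable_continuous_path[OF continuous_map_path_lipschitz[OF g(1)]]
    by (simp add: measurable_cong_sets[OF sets refl])
  have w: "(\<lambda>w. w t) \<in> borel_measurable W" if "0 \<le> t" for t
    using BM that by (simp add: standard_brownian_motion_def)
  have meas: "(\<lambda>w. grid_increments (Suc m) w z) \<in> borel_measurable W" for m z
    by (rule grid_increments_measurable[OF w])
  show "(\<lambda>w. g (polygon (Suc m) (partial_sums (grid_increments (Suc m) w)))) \<in> borel_measurable W" for m
    by (rule measurable_finite_dependence[OF continuous_on_polygon_functional[OF g(1)]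
          polygon_functional_dependence[OF g(1)] meas])
  show "integrable W (\<lambda>_. B)" by simp
  show "AE w in W. norm (g (polygon (Suc m) (partial_sums (grid_increments (Suc m) w)))) \<le> B" for m
    using g(2)[OF polygon_in_paths] by simp
  have "AE w in W. w 0 = 0" using BM by (simp add: standard_brownian_motion_def)
  then show "AE w in W. (\<lambda>m. g (polygon (Suc m) (partial_sums (grid_increments (Suc m) w)))) \<longlonglongrightarrow> g w"
  proof (rule AE_mp, intro AE_I2 impI)
    fix w assume "w \<in> space W" and w0: "w 0 = 0"
    then have "w \<in> paths" using space by simp
    have "partial_sums (grid_increments m w) = (\<lambda>k. w (real k / real m))" for m
      by (rule ext) (rule partial_sums_grid_increments[where x=w, OF w0])
    then show "(\<lambda>m. g (polygon (Suc m) (partial_sums (grid_increments (Suc m) w)))) \<longlonglongrightarrow> g w"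
      using polygon_tendsto[OF g(1) \<open>w \<in> paths\<close>] by (simp only:)
  qed
qed

text \<open>The order of choices matters: \<open>e\<close> is fixed from \<open>L\<close> and
  \<open>r\<close>, since the bad event is controlled with a factor \<open>e ^ (-4)\<close>; then
  \<open>m\<close> makes the Brownian polygon error and the limiting bad-event bound small; only
  then does \<open>n\<close> grow. The budget is \<open>r / 2\<close> for passing to the polygon and
  \<open>r / 4\<close> for each of the other two errors.\<close>

lemma (in conservative_walk) rescaled_path_tendsto:
  fixes W :: "(real \<Rightarrow> real ^ 'd) measure"
  assumes W: "wiener_measure W"
    and g: "path_lipschitz L (real T) g" "\<And>x. x \<in> paths \<Longrightarrow> \<bar>g x\<bar> \<le> B"
  shows "(\<lambda>n. expectation (\<lambda>\<omega>. g (rescaled_path n \<omega>))) \<longlonglongrightarrow> (\<integral>w. g w \<partial>W)"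
proof (rule LIMSEQ_I)
  fix r :: real assume r: "0 < r"
  have L: "L \<ge> 0" using g by (simp add: path_lipschitz_def)
  define e where "e = r / (16 * (L + 1) * scale)"
  have e: "0 < e" using r L scale_pos by (simp add: e_def)
  have Le: "L * (scale * (2 * e)) < r / 4"
  proof -
    have "L * (scale * (2 * e)) \<le> (L + 1) * (scale * (2 * e))"
      using scale_pos e by (intro mult_right_mono) auto
    also have "\<dots> = e * (16 * (L + 1) * scale) / 8" by simp
    also have "e * (16 * (L + 1) * scale) = r" using L scale_pos by (simp add: e_def)
    finally show ?thesis using r by simp
  qed
  define C where "C = (4 * (2 / p) ^ 4 * real CARD('d) ^ 5) / e ^ 4"
  \<comment> \<open>For \<open>n\<close> to infinity the bad-event term leaves the factor
    \<open>(m * T + 1) / m^2 = T / m + 1 / m^2\<close>, here with \<open>Suc m\<close> in place of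
    \<open>m\<close>.\<close>
  have "(\<lambda>m. 2 * B * C * (real T * inverse (real (Suc m)) + (inverse (real (Suc m)))\<^sup>2)) \<longlonglongrightarrow>
      2 * B * C * (real T * 0 + 0\<^sup>2)"
    by (intro tendsto_intros LIMSEQ_inverse_real_of_nat)
  then have "\<forall>\<^sub>F m in sequentially. 2 * B * C * (real T * inverse (real (Suc m)) + (inverse (real (Suc m)))\<^sup>2) < r / 4"
    using r by (intro order_tendstoD(2)) auto
  moreover have "\<forall>\<^sub>F m in sequentially. dist (\<integral>w. g (polygon (Suc m) (partial_sums (grid_increments (Suc m) w))) \<partial>W)
      (\<integral>w. g w \<partial>W) < r / 4"
    by (rule tendstoD[OF wiener_polygon_tendsto[OF W g]]) (use r in auto)
  ultimately have "\<forall>\<^sub>F m in sequentially. 2 * B * C * (real T * inverse (real (Suc m)) + (inverse (real (Suc m)))\<^sup>2) < r / 4 \<and>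
      dist (\<integral>w. g (polygon (Suc m) (partial_sums (grid_increments (Suc m) w))) \<partial>W) (\<integral>w. g w \<partial>W) < r / 4"
    by (rule eventually_conj)
  then obtain m' where m': "2 * B * C * (real T * inverse (real (Suc m')) + (inverse (real (Suc m')))\<^sup>2) < r / 4"
    "dist (\<integral>w. g (polygon (Suc m') (partial_sums (grid_increments (Suc m') w))) \<partial>W) (\<integral>w. g w \<partial>W) < r / 4"
    unfolding eventually_sequentially by blast
  define m where "m = Suc m'"
  have m: "0 < m" by (simp add: m_def)
  let ?err = "\<lambda>n. L * (scale * (2 * e + (2 + 2 / p) * (1 / sqrt (real n)))) +
    2 * B * (real (Suc (m * T)) * (4 * (2 / p) ^ 4 * real CARD('d) ^ 5) / e ^ 4 *
      (1 / real m + 2 * (1 / real n))\<^sup>2)"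
  have "?err \<longlonglongrightarrow> L * (scale * (2 * e + (2 + 2 / p) * 0)) +
    2 * B * (real (Suc (m * T)) * (4 * (2 / p) ^ 4 * real CARD('d) ^ 5) / e ^ 4 *
      (1 / real m + 2 * 0)\<^sup>2)"
    by (intro tendsto_add tendsto_mult tendsto_power tendsto_const inverse_sqrt_tendsto lim_1_over_n)
  moreover have "L * (scale * (2 * e + (2 + 2 / p) * 0)) +
    2 * B * (real (Suc (m * T)) * (4 * (2 / p) ^ 4 * real CARD('d) ^ 5) / e ^ 4 *
      (1 / real m + 2 * 0)\<^sup>2) < r / 2"
  proof -
    have 1: "real (Suc (m * T)) * (1 / real m + 2 * 0)\<^sup>2 = real T * inverse (real m) + (inverse (real m))\<^sup>2"
      using m by (simp add: field_simps power2_eq_square)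
    have 2: "real (Suc (m * T)) * (4 * (2 / p) ^ 4 * real CARD('d) ^ 5) / e ^ 4 * (1 / real m + 2 * 0)\<^sup>2 =
        C * (real (Suc (m * T)) * (1 / real m + 2 * 0)\<^sup>2)"
      by (simp add: C_def)
    have "2 * B * (C * (real T * inverse (real m) + (inverse (real m))\<^sup>2)) < r / 4"
      using m'(1) unfolding m_def by (simp only: mult.assoc)
    moreover have "L * (scale * (2 * e + (2 + 2 / p) * 0)) < r / 4" using Le by simp
    ultimately show ?thesis unfolding 2 1 by linarith
  qed
  ultimately have "\<forall>\<^sub>F n in sequentially. ?err n < r / 2"
    by (rule order_tendstoD(2))
  moreover have "\<forall>\<^sub>F n in sequentially.
      dist (expectation (\<lambda>\<omega>. g (polygon m (partial_sums (martingale_increments m n \<omega>)))))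
        (\<integral>w. g (polygon m (partial_sums (grid_increments m w))) \<partial>W) < r / 4"
    by (rule tendstoD[OF martingale_polygon_tendsto[OF W m g]]) (use r in auto)
  moreover have "\<forall>\<^sub>F n in sequentially. (0::nat) < n" by (rule eventually_gt_at_top)
  ultimately have "\<forall>\<^sub>F n in sequentially. norm (expectation (\<lambda>\<omega>. g (rescaled_path n \<omega>)) - (\<integral>w. g w \<partial>W)) < r"
  proof eventually_elim
    case (elim n)
    have "\<bar>expectation (\<lambda>\<omega>. g (rescaled_path n \<omega>)) -
        expectation (\<lambda>\<omega>. g (polygon m (partial_sums (martingale_increments m n \<omega>))))\<bar> \<le> ?err n"
      by (rule expectation_rescaled_path_polygon[OF g m elim(3) e])
    then show ?case
      using elim(1,2) m'(2) unfolding m_def[symmetric] dist_real_def real_norm_def by linarith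
  qed
  then show "\<exists>no. \<forall>n\<ge>no. norm (expectation (\<lambda>\<omega>. g (rescaled_path n \<omega>)) - (\<integral>w. g w \<partial>W)) < r"
    unfolding eventually_sequentially .
qed

theorem theorem3p3:
  fixes p :: real
    and M :: "'m measure"
    and Y :: "nat \<Rightarrow> 'm \<Rightarrow> real ^ 'd"
    and W :: "(real \<Rightarrow> real ^ 'd) measure"
  assumes "0 < p" and "p < 1"
    and "walk_steps M (\<lambda>_. p) Y"
    and "wiener_measure W"
  shows "weakly_converges_on path_topology (\<lambda>n. Law M (rescaled_walk p Y n)) W"
proof -
  interpret conservative_walk M p Y
    by unfold_locales (fact assms)+
  show ?thesis
  proof (rule weakly_converges_on_lipschitzI)
    show "prob_space (Law M (rescaled_walk p Y n))" for n by (rule prob_space_Law)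
    show "sets (Law M (rescaled_walk p Y n)) = sets (borel_of path_topology)" for n
      by (simp add: Law_def)
    show "prob_space W" "sets W = sets (borel_of path_topology)"
      using assms(4) by (simp_all add: wiener_measure_def standard_brownian_motion_def)
    fix g :: "(real \<Rightarrow> real ^ 'd) \<Rightarrow> real" and L B :: real and T :: nat
    assume g: "path_lipschitz L (real T) g" "\<And>x. x \<in> paths \<Longrightarrow> \<bar>g x\<bar> \<le> B"
    show "(\<lambda>n. \<integral>w. g w \<partial>Law M (rescaled_walk p Y n)) \<longlonglongrightarrow> (\<integral>w. g w \<partial>W)"
      unfolding integral_Law[OF borel_measurable_continuous_path[OF continuous_map_path_lipschitz[OF g(1)]]]
      by (rule rescaled_path_tendsto[OF assms(4) g])
  qed
qed

end
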